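(* For every $\Xi\in C(\mathbb T^n)$, $P\in\mathbb R^n$ and $T>0$, $$\widehat H_\Xi(P)=\frac{|P|^2}{2}-\lim_{j\to\infty}D^T_P(j,\Xi).$$
   Context: $\mathbb T^n=\mathbb R^n/\mathbb Z^n$ is the flat torus and $\overline{\mathcal M}$ is the set of Borel probability measures on $\mathbb T^n$. $$F(\mu,P)=\frac12\inf_{\phi\in C^1(\mathbb T^n)}\int_{\mathbb T^n}|\nabla\phi+P|^2\,d\mu,\qquad \widehat H_\Xi(P)=\sup_{\mu\in\overline{\mathcal M}}\Big[\int_{\mathbb T^n}\Xi\,d\mu+F(\mu,P)\Big].$$ For $x,y\in\mathbb T^n$, $T>0$, $$A^\Xi_P(y,x,T)=\inf\Big\{\frac1T\int_0^T\Big(\frac{|\dot x(s)-P|^2}{2}-\Xi(x(s))\Big)ds\ :\ x(0)=y,\ x(T)=x\Big\},$$ the infimum being over (absolutely continuous) curves $x(\cdot):[0,T]\to\mathbb T^n$. For $j\in\mathbb N$, with $\Pi_j$ the set of permutations of $\{1,\dots,j\}$, $$D^T_P(j,\Xi)=\min_{x_1,\dots,x_j\in\mathbb T^n}\ \min_{\sigma\in\Pi_j}\ \frac1j\sum_{i=1}^jA^\Xi_P(x_i,x_{\sigma(i)},T).$$ *)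

theory Defs
  imports "HOL-Analysis.Analysis" "HOL-Probability.Probability"
begin

definition int_shift :: "real^'n \<Rightarrow> real^'n \<Rightarrow> bool" where
  "int_shift x y \<longleftrightarrow> (\<forall>i. x $ i - y $ i \<in> \<int>)"

lemma equivp_int_shift: "equivp int_shift"
proof (rule equivpI)
  show "reflp int_shift"
    by (simp add: reflp_def int_shift_def)
  show "symp int_shift"
    unfolding symp_def int_shift_def by (metis Ints_minus minus_diff_eq)
  show "transp int_shift"
    unfolding transp_def int_shift_def
  proof (intro allI impI)
    fix x y z :: "real^'n" and i
    assume "\<forall>i. x $ i - y $ i \<in> \<int>" and "\<forall>i. y $ i - z $ i \<in> \<int>"
    then have "(x $ i - y $ i) + (y $ i - z $ i) \<in> \<int>"
      by (intro Ints_add) auto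
    then show "x $ i - z $ i \<in> \<int>"
      by simp
  qed
qed

text \<open>The torus R^n/Z^n, n being the cardinality of the index type. The canonical
  projection is \<open>torus_proj\<close>, and the topology (hence the Borel sets) is the
  quotient topology.\<close>

quotient_type 'n torus = "real^('n::finite)" / int_shift
  by (rule equivp_int_shift)

definition torus_proj :: "real^('n::finite) \<Rightarrow> 'n torus" where
  "torus_proj = abs_torus"

instantiation torus :: (finite) topological_space
begin

definition open_torus :: "'a torus set \<Rightarrow> bool" where
  "open_torus U \<longleftrightarrow> open (torus_proj -` U)"

instance
proof
  show "open (UNIV :: 'a torus set)"
    by (simp add: open_torus_def)
  show "open (S \<inter> S')" if "open S" "open S'" for S S' :: "'a torus set"
    using that by (auto simp: open_torus_def)
  show "open (\<Union>K)" if "\<forall>S\<in>K. open S" for K :: "'a torus set set"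
    using that by (auto simp: open_torus_def vimage_Union)
qed

end

lemma torus_proj_eq_iff: "torus_proj x = torus_proj y \<longleftrightarrow> (\<forall>i. x $ i - y $ i \<in> \<int>)"
  unfolding torus_proj_def torus.abs_eq_iff int_shift_def ..

text \<open>The gradient of a function on the torus is that of its periodic lift to R^n.\<close>

definition torus_grad :: "('n::finite torus \<Rightarrow> real) \<Rightarrow> 'n torus \<Rightarrow> real^'n" where
  "torus_grad \<phi> x = (THE v. \<forall>z. torus_proj z = x \<longrightarrow> GDERIV (\<lambda>w. \<phi> (torus_proj w)) z :> v)"

definition torus_C1 :: "('n::finite torus \<Rightarrow> real) set" where
  "torus_C1 = {\<phi>. (\<forall>z. (\<lambda>w. \<phi> (torus_proj w)) differentiable (at z)) \<and>
                  continuous_on UNIV (torus_grad \<phi>)}"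

definition borel_probs :: "'n::finite torus measure set" where
  "borel_probs = {\<mu>. sets \<mu> = sets borel \<and> prob_space \<mu>}"

definition F_func :: "'n::finite torus measure \<Rightarrow> real^'n \<Rightarrow> real" where
  "F_func \<mu> P = 1/2 * (INF \<phi>\<in>torus_C1. LINT x|\<mu>. (norm (torus_grad \<phi> x + P))\<^sup>2)"

definition H_hat :: "('n::finite torus \<Rightarrow> real) \<Rightarrow> real^'n \<Rightarrow> real" where
  "H_hat \<Xi> P = (SUP \<mu>\<in>borel_probs. (LINT x|\<mu>. \<Xi> x) + F_func \<mu> P)"

definition abs_continuous_on :: "real \<Rightarrow> real \<Rightarrow> (real \<Rightarrow> 'a::metric_space) \<Rightarrow> bool" where
  "abs_continuous_on a b f \<longleftrightarrow>
     (\<forall>\<epsilon>>0. \<exists>\<delta>>0. \<forall>(m::nat) l r.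
        (\<forall>k<m. a \<le> l k \<and> l k \<le> r k \<and> r k \<le> b) \<and>
        disjoint_family_on (\<lambda>k. {l k<..<r k}) {..<m} \<and>
        (\<Sum>k<m. r k - l k) < \<delta>
        \<longrightarrow> (\<Sum>k<m. dist (f (l k)) (f (r k))) < \<epsilon>)"

text \<open>A curve in the torus is absolutely continuous if it has an absolutely continuous
  lift to R^n.\<close>

definition torus_AC :: "real \<Rightarrow> (real \<Rightarrow> 'n::finite torus) \<Rightarrow> bool" where
  "torus_AC T c \<longleftrightarrow>
     (\<exists>\<gamma>. abs_continuous_on 0 T \<gamma> \<and> (\<forall>s\<in>{0..T}. c s = torus_proj (\<gamma> s)))"

text \<open>The velocity is the derivative of any local lift that is differentiable at \<open>s\<close>: two such
  lifts differ near \<open>s\<close> by a constant in Z^n. For an absolutely continuous curve on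
  \<open>[0,T]\<close> such a lift exists for almost every \<open>s\<close>; elsewhere the value is unspecified.\<close>

definition torus_velocity :: "(real \<Rightarrow> 'n::finite torus) \<Rightarrow> real \<Rightarrow> real^'n" where
  "torus_velocity c s =
     (THE v. \<exists>\<gamma>. (\<forall>\<^sub>F r in nhds s. c r = torus_proj (\<gamma> r)) \<and> (\<gamma> has_vector_derivative v) (at s))"

text \<open>The kinetic part of the Lagrangian of an absolutely continuous curve need not be integrable,
  so the action is an extended real in \<open>(-\<infinity>,\<infinity>]\<close>; the potential part is always finite,
  which is why the integral is split.\<close>

definition torus_action ::
  "('n::finite torus \<Rightarrow> real) \<Rightarrow> real^'n \<Rightarrow> real \<Rightarrow> (real \<Rightarrow> 'n torus) \<Rightarrow> ereal" where
  "torus_action \<Xi> P T c = ereal (1 / T) *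
     (enn2ereal (\<integral>\<^sup>+ s\<in>{0..T}. ennreal ((norm (torus_velocity c s - P))\<^sup>2 / 2) \<partial>lebesgue)
      - ereal (LINT s:{0..T}|lebesgue. \<Xi> (c s)))"

definition A_cost ::
  "('n::finite torus \<Rightarrow> real) \<Rightarrow> real^'n \<Rightarrow> 'n torus \<Rightarrow> 'n torus \<Rightarrow> real \<Rightarrow> ereal" where
  "A_cost \<Xi> P y x T = (INF c\<in>{c. torus_AC T c \<and> c 0 = y \<and> c T = x}. torus_action \<Xi> P T c)"

text \<open>A tuple \<open>(x\<^sub>1,\<dots>,x\<^sub>j)\<close> is represented by a sequence of which only the entries
  with index in \<open>{1..j}\<close> matter. The minimum over tuples is attained (the cost is continuous
  in its end points and the torus is compact), so it is the infimum. The value at \<open>j = 0\<close>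
  is irrelevant.\<close>

definition D_cost ::
  "real^('n::finite) \<Rightarrow> real \<Rightarrow> nat \<Rightarrow> ('n torus \<Rightarrow> real) \<Rightarrow> ereal" where
  "D_cost P T j \<Xi> =
     (INF x :: nat \<Rightarrow> 'n torus. MIN \<sigma>\<in>{\<sigma>. \<sigma> permutes {1..j}}.
        ereal (1 / real j) * (\<Sum>i=1..j. A_cost \<Xi> P (x i) (x (\<sigma> i)) T))"

end

theory Submission
  imports Defs
begin

text \<open>Lower bound for \<open>D_cost\<close>: the occupation measure of curves joining \<open>x\<^sub>i\<close> to \<open>x\<^sub>\<sigma>\<^sub>(\<^sub>i\<^sub>)\<close> competes
  in \<open>H_hat\<close>. By Young's inequality \<open>\<integral> |\<nabla>\<phi> + P|\<^sup>2/2\<close> against it is at least \<open>|P|\<^sup>2/2\<close> minus the mean kinetic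
  action, up to the increments of \<open>\<phi>\<close> along the curves, which cancel because \<open>\<sigma>\<close> is a permutation. For
  absolutely continuous curves this needs their almost everywhere differentiability and the fundamental
  theorem of calculus.

  Upper bound: fix a time step \<open>T/N\<close> and consider closed chains of straight segments on the torus.
  If one of them has mean action less than \<open>L\<close>, then repeating it and waiting for the rest of the time
  shows \<open>D_cost P T j \<Xi> \<le> L + O(1/j)\<close>. If none has, then the value function of chains relative to \<open>L\<close>
  is a bounded discrete subsolution of \<open>|\<nabla>u + P|\<^sup>2/2 + \<Xi> \<le> |P|\<^sup>2/2 - L\<close>. Mollified, it is a \<open>C\<^sup>1\<close> subsolution
  up to a small error when \<open>N\<close> is large, so \<open>H_hat \<Xi> P\<close> does not exceed \<open>|P|\<^sup>2/2 - L\<close> by more than that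
  error. Hence no duality theorem for \<open>H_hat\<close> is needed.\<close>

section \<open>Absolutely continuous functions\<close>

text \<open>The obstacle in the upper bound is the order of choices: the discrete subsolution exists
  only once \<open>N\<close> is fixed, while \<open>N\<close> has to be large compared with the
  smoothness of its mollification. Two uniform estimates break this circle. Closing a chain in time
  \<open>T\<close> has a cost independent of \<open>N\<close>, so one constant bounds the
  subsolutions for all \<open>N\<close>; and the mollified function has a second-order expansion
  whose constant depends only on that bound and on the kernel. The subsolution is shown to be
  measurable, not continuous; all regularity comes from the kernel.

  The lower bound holds for every \<open>j \<ge> 1\<close> and the upper one with an error of order
  \<open>1/j\<close>, so the limit exists by squeezing.

  The curves in \<open>A_cost\<close> are merely absolutely continuous. Their differentiability is
  read off from difference quotients: disjoint intervals of prescribed slope cover an exceptional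
  set up to a small remainder, and absolute continuity limits the total increment over short
  families. The exceptional sets are treated through open supersets, without proving that they are
  measurable.\<close>

lemma abs_continuous_onD:
  assumes "abs_continuous_on a b f" "e > 0"
  obtains d where "d > 0"
    "\<And>(I :: 'i set) l r. \<lbrakk>finite I; \<And>i. i \<in> I \<Longrightarrow> a \<le> l i \<and> l i \<le> r i \<and> r i \<le> b;
        disjoint_family_on (\<lambda>i. {l i<..<r i}) I; (\<Sum>i\<in>I. r i - l i) < d\<rbrakk>
      \<Longrightarrow> (\<Sum>i\<in>I. dist (f (l i)) (f (r i))) < e"
proof -
  obtain d where d: "d > 0"
    "\<And>(m::nat) l r. \<lbrakk>\<forall>k<m. a \<le> l k \<and> l k \<le> r k \<and> r k \<le> b;
        disjoint_family_on (\<lambda>k. {l k<..<r k}) {..<m}; (\<Sum>k<m. r k - l k) < d\<rbrakk>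
      \<Longrightarrow> (\<Sum>k<m. dist (f (l k)) (f (r k))) < e"
    using assms(1)[unfolded abs_continuous_on_def, rule_format, OF assms(2)] by blast
  show thesis
  proof (rule that[OF \<open>d > 0\<close>])
    fix I :: "'i set" and l r
    assume fin: "finite I" and le: "\<And>i. i \<in> I \<Longrightarrow> a \<le> l i \<and> l i \<le> r i \<and> r i \<le> b"
      and disj: "disjoint_family_on (\<lambda>i. {l i<..<r i}) I" and small: "(\<Sum>i\<in>I. r i - l i) < d"
    \<comment> \<open>An enumeration carries the condition from initial segments of the naturals to
      any finite index set; below, families are indexed by intervals or by tagged intervals.\<close>
    obtain h where h: "bij_betw h {..<card I} I"
      using ex_bij_betw_nat_finite[OF fin] by (auto simp: atLeast0LessThan)
    have reindex: "(\<Sum>k<card I. g (h k)) = (\<Sum>i\<in>I. g i)" for g :: "'i \<Rightarrow> real"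
      by (rule sum.reindex_bij_betw[OF h])
    have "(\<Sum>k<card I. dist (f (l (h k))) (f (r (h k)))) < e"
    proof (rule d(2))
      show "\<forall>k<card I. a \<le> l (h k) \<and> l (h k) \<le> r (h k) \<and> r (h k) \<le> b"
        using h le by (auto simp: bij_betw_def)
      show "disjoint_family_on (\<lambda>k. {l (h k)<..<r (h k)}) {..<card I}"
        using h disj unfolding disjoint_family_on_def bij_betw_def inj_on_def
        by (metis imageI)
      show "(\<Sum>k<card I. r (h k) - l (h k)) < d"
        using small reindex[of "\<lambda>i. r i - l i"] by simp
    qed
    then show "(\<Sum>i\<in>I. dist (f (l i)) (f (r i))) < e"
      using reindex[of "\<lambda>i. dist (f (l i)) (f (r i))"] by simp
  qed
qed

lemma lipschitz_imp_abs_continuous_on: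
  assumes "C-lipschitz_on {a..b} f"
  shows "abs_continuous_on a b f"
  unfolding abs_continuous_on_def
proof (intro allI impI)
  fix e :: real assume "e > 0"
  have "C \<ge> 0"
    using assms lipschitz_on_nonneg by blast
  show "\<exists>\<delta>>0. \<forall>(m::nat) l r.
        (\<forall>k<m. a \<le> l k \<and> l k \<le> r k \<and> r k \<le> b) \<and>
        disjoint_family_on (\<lambda>k. {l k<..<r k}) {..<m} \<and>
        (\<Sum>k<m. r k - l k) < \<delta>
        \<longrightarrow> (\<Sum>k<m. dist (f (l k)) (f (r k))) < e"
  proof (intro exI[of _ "e / (C + 1)"] conjI allI impI; (elim conjE)?)
    show "0 < e / (C + 1)"
      using \<open>e > 0\<close> \<open>C \<ge> 0\<close> by simp
    fix m :: nat and l r :: "nat \<Rightarrow> real"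
    assume lr: "\<forall>k<m. a \<le> l k \<and> l k \<le> r k \<and> r k \<le> b" and "(\<Sum>k<m. r k - l k) < e / (C + 1)"
    then have small: "(\<Sum>k<m. r k - l k) * (C + 1) < e"
      using \<open>C \<ge> 0\<close> by (simp add: pos_less_divide_eq)
    have "(\<Sum>k<m. dist (f (l k)) (f (r k))) \<le> (\<Sum>k<m. C * (r k - l k))"
    proof (rule sum_mono)
      fix k assume "k \<in> {..<m}"
      with lr have "l k \<in> {a..b}" "r k \<in> {a..b}" "l k \<le> r k"
        by (auto intro: order_trans)
      then show "dist (f (l k)) (f (r k)) \<le> C * (r k - l k)"
        using lipschitz_onD[OF assms, of "l k" "r k"] by (simp add: dist_real_def)
    qed
    also have "\<dots> \<le> (C + 1) * (\<Sum>k<m. r k - l k)"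
      unfolding sum_distrib_left using lr by (intro sum_mono mult_right_mono) auto
    also have "\<dots> < e"
      using small by (simp add: mult.commute)
    finally show "(\<Sum>k<m. dist (f (l k)) (f (r k))) < e" .
  qed
qed

text \<open>The two constants serve two uses: \<open>D = 0\<close> covers negation, components and
  composition with a Lipschitz function, while \<open>D > 0\<close> allows a linear function to be
  subtracted.\<close>

lemma abs_continuous_on_lipschitz_compose:
  assumes "abs_continuous_on a b f"
    and L: "\<And>x y. x \<in> {a..b} \<Longrightarrow> y \<in> {a..b} \<Longrightarrow> dist (g x) (g y) \<le> C * dist (f x) (f y) + D * dist x y"
  shows "abs_continuous_on a b g"
  unfolding abs_continuous_on_def
proof (intro allI impI)
  fix e :: real assume "e > 0"
  define C' where "C' = \<bar>C\<bar> + 1"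
  define D' where "D' = \<bar>D\<bar> + 1"
  have pos: "C' > 0" "D' > 0" "C \<le> C'" "D \<le> D'"
    by (auto simp: C'_def D'_def)
  have "e / (2 * C') > 0"
    using \<open>e > 0\<close> pos by simp
  from abs_continuous_onD[OF assms(1) this] obtain d where d: "d > 0"
    "\<And>(I :: nat set) l r. \<lbrakk>finite I; \<And>i. i \<in> I \<Longrightarrow> a \<le> l i \<and> l i \<le> r i \<and> r i \<le> b;
        disjoint_family_on (\<lambda>i. {l i<..<r i}) I; (\<Sum>i\<in>I. r i - l i) < d\<rbrakk>
      \<Longrightarrow> (\<Sum>i\<in>I. dist (f (l i)) (f (r i))) < e / (2 * C')"
    by blast
  show "\<exists>\<delta>>0. \<forall>(m::nat) l r.
        (\<forall>k<m. a \<le> l k \<and> l k \<le> r k \<and> r k \<le> b) \<and>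
        disjoint_family_on (\<lambda>k. {l k<..<r k}) {..<m} \<and>
        (\<Sum>k<m. r k - l k) < \<delta>
        \<longrightarrow> (\<Sum>k<m. dist (g (l k)) (g (r k))) < e"
  proof (intro exI[of _ "min d (e / (2 * D'))"] conjI allI impI; (elim conjE)?)
    show "0 < min d (e / (2 * D'))"
      using \<open>e > 0\<close> \<open>d > 0\<close> pos by simp
    fix m :: nat and l r :: "nat \<Rightarrow> real"
    assume lr: "\<forall>k<m. a \<le> l k \<and> l k \<le> r k \<and> r k \<le> b"
      and disj: "disjoint_family_on (\<lambda>k. {l k<..<r k}) {..<m}"
      and small: "(\<Sum>k<m. r k - l k) < min d (e / (2 * D'))"
    have 1: "(\<Sum>k<m. dist (f (l k)) (f (r k))) * C' < e / 2"
      using d(2)[OF _ _ disj] lr small pos by (simp add: field_simps)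
    have 2: "(\<Sum>k<m. r k - l k) * D' < e / 2"
      using small pos by (simp add: field_simps)
    have "(\<Sum>k<m. dist (g (l k)) (g (r k))) \<le> (\<Sum>k<m. C' * dist (f (l k)) (f (r k)) + D' * (r k - l k))"
    proof (rule sum_mono)
      fix k assume "k \<in> {..<m}"
      with lr have k: "l k \<in> {a..b}" "r k \<in> {a..b}" "l k \<le> r k"
        by (auto intro: order_trans)
      have "dist (g (l k)) (g (r k)) \<le> C * dist (f (l k)) (f (r k)) + D * (r k - l k)"
        using L[OF k(1,2)] k(3) by (simp add: dist_real_def)
      also have "\<dots> \<le> C' * dist (f (l k)) (f (r k)) + D' * (r k - l k)"
        using pos k(3) by (intro add_mono mult_right_mono) auto
      finally show "dist (g (l k)) (g (r k)) \<le> C' * dist (f (l k)) (f (r k)) + D' * (r k - l k)" .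
    qed
    also have "\<dots> < e"
      using 1 2 by (simp add: sum.distrib sum_distrib_left[symmetric] mult.commute)
    finally show "(\<Sum>k<m. dist (g (l k)) (g (r k))) < e" .
  qed
qed

lemma abs_continuous_on_imp_continuous_on:
  assumes "abs_continuous_on a b f"
  shows "continuous_on {a..b} f"
  unfolding continuous_on_iff
proof (intro ballI allI impI)
  fix x and e :: real assume x: "x \<in> {a..b}" and "e > 0"
  from abs_continuous_onD[OF assms \<open>e > 0\<close>] obtain d where d: "d > 0"
    "\<And>(I :: unit set) l r. \<lbrakk>finite I; \<And>i. i \<in> I \<Longrightarrow> a \<le> l i \<and> l i \<le> r i \<and> r i \<le> b;
        disjoint_family_on (\<lambda>i. {l i<..<r i}) I; (\<Sum>i\<in>I. r i - l i) < d\<rbrakk>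
      \<Longrightarrow> (\<Sum>i\<in>I. dist (f (l i)) (f (r i))) < e"
    by blast
  have "dist (f x') (f x) < e" if x': "x' \<in> {a..b}" "dist x' x < d" for x'
  proof (cases "x \<le> x'")
    case True
    then show ?thesis
      using d(2)[of UNIV "\<lambda>_. x" "\<lambda>_. x'"] x x'
      by (auto simp: disjoint_family_on_def dist_real_def dist_commute[of "f x'"])
  next
    case False
    then show ?thesis
      using d(2)[of UNIV "\<lambda>_. x'" "\<lambda>_. x"] x x'
      by (auto simp: disjoint_family_on_def dist_real_def)
  qed
  then show "\<exists>d>0. \<forall>x'\<in>{a..b}. dist x' x < d \<longrightarrow> dist (f x') (f x) < e"
    using \<open>d > 0\<close> by blast
qed

section \<open>Vitali coverings by intervals of prescribed slope\<close>

lemma lmeasurable_outer_open: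
  fixes S :: "'a::euclidean_space set"
  assumes S: "S \<in> lmeasurable" and "e > 0"
  obtains V where "open V" "S \<subseteq> V" "V \<in> lmeasurable" "measure lebesgue V < measure lebesgue S + e"
proof -
  obtain V where V: "open V" "S \<subseteq> V" "V - S \<in> lmeasurable" "emeasure lebesgue (V - S) < ennreal e"
    using sets_lebesgue_outer_open[of S e] S \<open>e > 0\<close> by (auto dest: fmeasurableD)
  have Veq: "V = S \<union> (V - S)"
    using V(2) by auto
  show thesis
  proof (rule that[of V])
    show "V \<in> lmeasurable"
      by (subst Veq) (intro fmeasurable.Un S V)
    have "measure lebesgue (V - S) < e"
      using V(3,4) \<open>e > 0\<close> by (simp add: emeasure_eq_measure2 ennreal_less_iff)
    moreover have "measure lebesgue V \<le> measure lebesgue S + measure lebesgue (V - S)"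
      by (subst Veq, rule measure_Un_le) (use S V(3) in \<open>auto dest: fmeasurableD\<close>)
    ultimately show "measure lebesgue V < measure lebesgue S + e"
      by simp
  qed (use V in auto)
qed

text \<open>Short intervals with an endpoint in \<open>S\<close> and slope above \<open>c\<close>
  form a Vitali cover of \<open>S\<close>, so countably many disjoint ones exhaust \<open>S\<close>
  up to a null set. Finitely many of them suffice if what is missed goes into an open set
  \<open>V\<close> of measure below \<open>e\<close>. Keeping \<open>V\<close> open lets the result
  be compared with outer measures.\<close>

lemma Vitali_slope_cover:
  fixes f :: "real \<Rightarrow> real"
  assumes U: "open U" "U \<in> lmeasurable" and "S \<subseteq> U" "e > 0"
    and slope: "\<And>x. x \<in> S \<Longrightarrow> \<exists>\<^sub>F y in at x. (f y - f x) / (y - x) > c"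
  obtains I V where "finite I" "\<And>l r. (l, r) \<in> I \<Longrightarrow> l < r \<and> {l..r} \<subseteq> U \<and> f r - f l > c * (r - l)"
    "disjoint_family_on (\<lambda>(l, r). {l..r}) I"
    "open V" "V \<in> lmeasurable" "measure lebesgue V < e" "S \<subseteq> V \<union> (\<Union>(l, r)\<in>I. {l<..<r})"
proof -
  define K where "K = {(l, r). l < r \<and> {l..r} \<subseteq> U \<and> f r - f l > c * (r - l)}"
  \<comment> \<open>The covering theorem speaks of balls, so an interval is encoded by its midpoint
    and half its length.\<close>
  define ctr where "ctr = (\<lambda>(l::real, r). (l + r) / 2)"
  define rad where "rad = (\<lambda>(l::real, r). (r - l) / 2)"
  have cb: "cball (ctr i) (rad i) = (case i of (l, r) \<Rightarrow> {l..r})" for i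
    by (auto simp: ctr_def rad_def cball_eq_atLeastAtMost split: prod.split) (simp_all add: field_simps)
  have rad_pos: "rad i > 0" if "i \<in> K" for i
    using that by (auto simp: K_def rad_def)
  \<comment> \<open>The slope is symmetric in the two endpoints, so it does not matter on which side
    of \<open>x\<close> the point \<open>y\<close> lies.\<close>
  have fine: "\<exists>i. i \<in> K \<and> x \<in> cball (ctr i) (rad i) \<and> rad i < d" if x: "x \<in> S" and "0 < d" for x d
  proof -
    obtain h where h: "h > 0" "ball x h \<subseteq> U"
      using U x \<open>S \<subseteq> U\<close> openE by blast
    have "eventually (\<lambda>y. y \<in> ball x (min h d) \<and> y \<noteq> x) (at x)"
      using h \<open>d > 0\<close> by (auto simp: eventually_at dist_commute intro!: exI[of _ "min h d"])
    then obtain y where y: "(f y - f x) / (y - x) > c" "y \<in> ball x (min h d)" "y \<noteq> x"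
      using frequently_eventually_frequently[OF slope[OF x]] by (blast dest: frequently_ex)
    define l where "l = min x y"
    define r where "r = max x y"
    have lr: "l < r" "r - l = \<bar>y - x\<bar>"
      using y by (auto simp: l_def r_def)
    have "f r - f l > c * (r - l)"
      using y by (cases "x < y") (auto simp: l_def r_def field_simps)
    moreover have "{l..r} \<subseteq> ball x h"
      using y by (auto simp: l_def r_def dist_real_def)
    ultimately have "(l, r) \<in> K"
      using lr h by (auto simp: K_def)
    moreover have "x \<in> cball (ctr (l, r)) (rad (l, r))"
      unfolding cb by (auto simp: l_def r_def)
    moreover have "rad (l, r) < d"
      using y lr by (auto simp: rad_def dist_real_def)
    ultimately show ?thesis
      by blast
  qed
  from Vitali_covering_theorem_cballs[OF rad_pos fine] obtain C where C: "countable C" "C \<subseteq> K"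
     "pairwise (\<lambda>i j. disjnt (cball (ctr i) (rad i)) (cball (ctr j) (rad j))) C"
     "negligible(S - (\<Union>i \<in> C. cball (ctr i) (rad i)))"
    by blast
  \<comment> \<open>Passing to open intervals loses only the endpoints, a countable set.\<close>
  define op where "op = (\<lambda>(l::real, r::real). {l<..<r})"
  have Wneg: "negligible (S - (\<Union>i\<in>C. op i))"
  proof (rule negligible_subset)
    have "countable (fst ` C \<union> snd ` C)"
      using C(1) by auto
    then have "negligible (fst ` C \<union> snd ` C)"
      by (simp add: negligible_iff_null_sets countable_imp_null_set_lborel null_sets_completionI)
    then show "negligible ((S - (\<Union>i \<in> C. cball (ctr i) (rad i))) \<union> (fst ` C \<union> snd ` C))"
      by (rule negligible_Un[OF C(4)])
    show "S - (\<Union>i\<in>C. op i) \<subseteq> (S - (\<Union>i \<in> C. cball (ctr i) (rad i))) \<union> (fst ` C \<union> snd ` C)"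
    proof
      fix x assume x: "x \<in> S - (\<Union>i\<in>C. op i)"
      show "x \<in> (S - (\<Union>i \<in> C. cball (ctr i) (rad i))) \<union> (fst ` C \<union> snd ` C)"
      proof (cases "x \<in> (\<Union>i \<in> C. cball (ctr i) (rad i))")
        case True
        then obtain l r where lr: "(l, r) \<in> C" "x \<in> {l..r}"
          using cb by auto
        then have "x \<notin> {l<..<r}"
          using x by (auto simp: op_def)
        then have "x = fst (l, r) \<or> x = snd (l, r)"
          using lr by auto
        then show ?thesis
          using lr(1) by blast
      qed (use x in auto)
    qed
  qed
  have opU: "op i \<subseteq> U" if "i \<in> C" for i
    using that C(2) by (fastforce simp: K_def op_def)
  obtain V1 where V1: "open V1" "S - (\<Union>i\<in>C. op i) \<subseteq> V1" "V1 \<in> lmeasurable" "measure lebesgue V1 < e / 2"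
  proof -
    have "S - (\<Union>i\<in>C. op i) \<in> lmeasurable" and m0: "measure lebesgue (S - (\<Union>i\<in>C. op i)) = 0"
      using Wneg negligible_iff_measure by blast+
    then obtain V where V: "open V" "S - (\<Union>i\<in>C. op i) \<subseteq> V" "V \<in> lmeasurable"
         "measure lebesgue V < measure lebesgue (S - (\<Union>i\<in>C. op i)) + e/2"
      using lmeasurable_outer_open[of "S - (\<Union>i\<in>C. op i)" "e / 2"] \<open>e > 0\<close> by auto
    then show thesis using m0 that by auto
  qed
  \<comment> \<open>The countable union lies in \<open>U\<close> and has finite measure, so its
    finite partial unions approach it in measure. The missed part, below \<open>e / 4\<close>, is
    enclosed in \<open>V2\<close> at a further cost of \<open>e / 4\<close>; \<open>V1\<close> uses
    the other half of \<open>e\<close>.\<close>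
  obtain I where I: "finite I" "I \<subseteq> C" and I_meas: "measure lebesgue ((\<Union>i\<in>C. op i) - (\<Union>i\<in>I. op i)) < e / 4"
  proof (cases "C = {}")
    case True
    show ?thesis
      by (rule that[of "{}"]) (use True \<open>e > 0\<close> in auto)
  next
    case False
    define en where "en = from_nat_into C"
    have en: "range en = C"
      using False C(1) by (simp add: en_def range_from_nat_into)
    define W where "W = (\<lambda>n. \<Union>i<n. op (en i))"
    have Wtot: "(\<Union>n. W n) = (\<Union>i\<in>C. op i)"
      unfolding W_def en[symmetric] by auto
    have op_meas: "op i \<in> sets lebesgue" for i
      by (auto simp: op_def split: prod.split)
    have Wmeas: "W n \<in> sets lebesgue" for n
      using op_meas by (auto simp: W_def)
    have sub: "(\<Union>i\<in>C. op i) \<subseteq> U"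
      using opU by auto
    have totm: "(\<Union>i\<in>C. op i) \<in> lmeasurable"
      by (rule fmeasurableI2[OF U(2) sub]) (use op_meas C(1) in auto)
    have "(\<lambda>n. measure lebesgue (W n)) \<longlonglongrightarrow> measure lebesgue (\<Union>n. W n)"
    proof (rule Lim_measure_incseq)
      show "incseq W"
        by (auto simp: incseq_def W_def dest: less_le_trans)
      show "emeasure lebesgue (\<Union>n. W n) \<noteq> \<infinity>"
        unfolding Wtot using totm fmeasurableD2 by (metis infinity_ennreal_def)
    qed (use Wmeas in auto)
    then have "eventually (\<lambda>n. dist (measure lebesgue (W n)) (measure lebesgue (\<Union>n. W n)) < e / 4) sequentially"
      using \<open>e > 0\<close> by (intro tendstoD) auto
    then obtain n where n: "dist (measure lebesgue (W n)) (measure lebesgue (\<Union>n. W n)) < e / 4"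
      by (auto simp: eventually_sequentially)
    have "measure lebesgue ((\<Union>n. W n) - W n) = measure lebesgue (\<Union>n. W n) - measure lebesgue (W n)"
      by (rule measurable_measure_Diff) (use totm Wmeas in \<open>auto simp: Wtot\<close>, auto simp: W_def en[symmetric])
    then have small: "measure lebesgue ((\<Union>n. W n) - W n) < e / 4"
      using n unfolding dist_real_def by linarith
    show ?thesis
    proof (rule that[of "en ` {..<n}"])
      show "measure lebesgue ((\<Union>i\<in>C. op i) - (\<Union>i\<in>en ` {..<n}. op i)) < e / 4"
        using small unfolding Wtot by (simp add: W_def)
    qed (use en in auto)
  qed
  have R: "(\<Union>i\<in>C. op i) - (\<Union>i\<in>I. op i) \<in> lmeasurable"
  proof (rule fmeasurableI2[OF U(2)])
    show "(\<Union>i\<in>C. op i) - (\<Union>i\<in>I. op i) \<subseteq> U"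
      using opU by auto
    have "op i \<in> sets lebesgue" for i
      by (auto simp: op_def split: prod.split)
    then show "(\<Union>i\<in>C. op i) - (\<Union>i\<in>I. op i) \<in> sets lebesgue"
      using C(1) I(1) by (intro sets.Diff sets.countable_UN'[of C] sets.finite_UN) auto
  qed
  obtain V2 where V2: "open V2" "(\<Union>i\<in>C. op i) - (\<Union>i\<in>I. op i) \<subseteq> V2" "V2 \<in> lmeasurable" "measure lebesgue V2 < e / 2"
  proof -
    obtain V where "open V" "(\<Union>i\<in>C. op i) - (\<Union>i\<in>I. op i) \<subseteq> V" "V \<in> lmeasurable"
         "measure lebesgue V < measure lebesgue ((\<Union>i\<in>C. op i) - (\<Union>i\<in>I. op i)) + e/4"
      using lmeasurable_outer_open[OF R, of "e / 4"] \<open>e > 0\<close> by auto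
    then show thesis
      using I_meas by (intro that[of V]) auto
  qed
  show thesis
  proof (rule that[of I "V1 \<union> V2"])
    show "disjoint_family_on (\<lambda>(l, r). {l..r}) I"
      using C(3) I(2) cb unfolding disjoint_family_on_def pairwise_def disjnt_def
      by (metis (no_types, lifting) subsetD)
    show "measure lebesgue (V1 \<union> V2) < e"
      using measure_Un_le[of V1 lebesgue V2] V1 V2 by (auto dest: fmeasurableD)
    show "S \<subseteq> V1 \<union> V2 \<union> (\<Union>(l, r)\<in>I. {l<..<r})"
      using V1(2) V2(2) by (auto simp: op_def)
  qed (use I C V1 V2 in \<open>auto simp: K_def\<close>)
qed

section \<open>Increments over families of intervals\<close>

lemma additive_division_1:
  fixes f :: "real \<Rightarrow> real"
  assumes "a \<le> b" "q division_of {a..b}"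
  shows "(\<Sum>K\<in>q. f (Sup K) - f (Inf K)) = f b - f a"
proof -
  define tag where "tag = (\<lambda>K::real set. (Inf K, K))"
  have "tag ` q tagged_division_of {a..b}"
  proof (rule tagged_division_ofI)
    show "finite (tag ` q)"
      using assms by (auto simp: division_of_def)
    show "x \<in> K" "K \<subseteq> {a..b}" "\<exists>a b. K = cbox a b" if "(x, K) \<in> tag ` q" for x K
    proof -
      have K: "K \<in> q" "x = Inf K"
        using that by (auto simp: tag_def)
      then obtain u v where uv: "K = cbox u v" "K \<noteq> {}" "K \<subseteq> {a..b}"
        using assms(2) division_ofD(2,3,4) by metis
      then show "x \<in> K" "K \<subseteq> {a..b}" "\<exists>a b. K = cbox a b"
        using K by auto
    qed
    show "interior K1 \<inter> interior K2 = {}"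
      if "(x1, K1) \<in> tag ` q" "(x2, K2) \<in> tag ` q" "(x1, K1) \<noteq> (x2, K2)" for x1 K1 x2 K2
      using that assms(2) division_ofD(5)[of q "{a..b}" K1 K2] by (auto simp: tag_def)
    have "{K. \<exists>x. (x, K) \<in> tag ` q} = q"
      by (auto simp: tag_def)
    then show "\<Union>{K. \<exists>x. (x, K) \<in> tag ` q} = {a..b}"
      using assms(2) by auto
  qed
  from additive_tagged_division_1[OF assms(1) this, of f]
  show ?thesis
    by (subst (asm) sum.reindex) (auto simp: tag_def inj_on_def)
qed

text \<open>The two total increments differ by the increments over the gaps between the inner intervals,
  whose total length is less than \<open>d\<close>.\<close>

lemma increments_nested_families:
  fixes f :: "real \<Rightarrow> real"
  assumes I: "finite I" "\<And>l r. (l, r) \<in> I \<Longrightarrow> a \<le> l \<and> l < r \<and> r \<le> b"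
      "disjoint_family_on (\<lambda>(l, r). {l..r}) I"
    and J: "finite J" "\<And>l r. (l, r) \<in> J \<Longrightarrow> l < r \<and> {l..r} \<subseteq> (\<Union>(l, r)\<in>I. {l<..<r})"
      "disjoint_family_on (\<lambda>(l, r). {l..r}) J"
    and f: "\<And>(G :: ((real \<times> real) \<times> real set) set) l r. \<lbrakk>finite G; \<And>i. i \<in> G \<Longrightarrow> a \<le> l i \<and> l i \<le> r i \<and> r i \<le> b;
        disjoint_family_on (\<lambda>i. {l i<..<r i}) G; (\<Sum>i\<in>G. r i - l i) < d\<rbrakk>
      \<Longrightarrow> (\<Sum>i\<in>G. dist (f (l i)) (f (r i))) < e"
    and small: "(\<Sum>(l, r)\<in>I. r - l) - (\<Sum>(l, r)\<in>J. r - l) < d"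
  shows "\<bar>(\<Sum>(l, r)\<in>I. f r - f l) - (\<Sum>(l, r)\<in>J. f r - f l)\<bar> < e"
proof -
  \<comment> \<open>An inner interval cannot leave the outer interval that contains its left end:
    the right end \<open>v\<close> of the latter would have to lie in another open interval of
    \<open>I\<close>, contrary to the disjointness of the closed ones.\<close>
  have par: "\<exists>i. i \<in> I \<and> {fst j..snd j} \<subseteq> {fst i<..<snd i}" if j: "j \<in> J" for j
  proof -
    obtain l r where lr: "j = (l, r)" by (cases j)
    have lJ: "l < r" "{l..r} \<subseteq> (\<Union>(l, r)\<in>I. {l<..<r})"
      using J(2) j lr by auto
    have "l \<in> {l..r}" using lJ(1) by simp
    then have "l \<in> (\<Union>(l, r)\<in>I. {l<..<r})"
      using lJ(2) by (rule subsetD[rotated])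
    then obtain u v where uv: "(u, v) \<in> I" "l \<in> {u<..<v}"
      by auto
    have "r < v"
    proof (rule ccontr)
      assume "\<not> r < v"
      then have "v \<in> {l..r}"
        using uv by auto
      then obtain u' v' where uv': "(u', v') \<in> I" "v \<in> {u'<..<v'}"
        using lJ(2) by blast
      have "(u, v) = (u', v')"
      proof (rule ccontr)
        assume "(u, v) \<noteq> (u', v')"
        then have "{u..v} \<inter> {u'..v'} = {}"
          using disjoint_family_onD[OF I(3) uv(1) uv'(1)] by simp
        moreover have "v \<in> {u..v} \<inter> {u'..v'}"
          using uv uv' by auto
        ultimately show False by blast
      qed
      then show False
        using uv' by auto
    qed
    then show ?thesis
      using uv lr by (intro exI[of _ "(u, v)"]) auto
  qed
  then obtain g where g: "\<And>j. j \<in> J \<Longrightarrow> g j \<in> I \<and> {fst j..snd j} \<subseteq> {fst (g j)<..<snd (g j)}"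
    by metis
  define box where "box = (\<lambda>(l::real, r::real). {l..r})"
  define p where "p = (\<lambda>i. box ` {j\<in>J. g j = i})"
  have ne: "fst j < snd j" if "j \<in> J" for j
    using J(2)[of "fst j" "snd j"] that by simp
  have inj: "inj_on box J"
  proof (rule inj_onI)
    fix j k assume "j \<in> J" "k \<in> J" "box j = box k"
    then show "j = k"
      using ne[of j] ne[of k] by (cases j; cases k) (auto simp: box_def Icc_eq_Icc)
  qed
  have pdiv: "p i division_of \<Union>(p i)" for i
  proof (rule division_ofI)
    show "finite (p i)"
      using J(1) by (simp add: p_def)
    show "K \<noteq> {}" "\<exists>a b. K = cbox a b" if "K \<in> p i" for K
      using that ne by (force simp: p_def box_def split: prod.split)+
    show "interior K1 \<inter> interior K2 = {}" if K: "K1 \<in> p i" "K2 \<in> p i" "K1 \<noteq> K2" for K1 K2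
    proof -
      obtain j k where jk: "j \<in> J" "k \<in> J" "K1 = box j" "K2 = box k" "j \<noteq> k"
        using K unfolding p_def by blast
      then have "K1 \<inter> K2 = {}"
        using J(3) unfolding disjoint_family_on_def box_def by blast
      then show ?thesis
        using interior_subset by blast
    qed
  qed auto
  \<comment> \<open>Completing the inner intervals to a division of the outer one makes the gaps
    explicit as \<open>q i - p i\<close>.\<close>
  have "\<exists>q. p i \<subseteq> q \<and> q division_of cbox (fst i) (snd i)" if "i \<in> I" for i
  proof -
    have "\<Union>(p i) \<subseteq> cbox (fst i) (snd i)"
      using g by (fastforce simp: p_def box_def)
    then show ?thesis
      using partial_division_extend_interval[OF pdiv] by metis
  qed
  then obtain q where q: "\<And>i. i \<in> I \<Longrightarrow> p i \<subseteq> q i \<and> q i division_of cbox (fst i) (snd i)"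
    by metis
  have inc: "(\<Sum>K\<in>q i. h (Sup K) - h (Inf K)) = h (snd i) - h (fst i)" if "i \<in> I" for i and h :: "real \<Rightarrow> real"
    using additive_division_1[of "fst i" "snd i" "q i" h] q[OF that] I(2)[of "fst i" "snd i"] that
    by simp
  have finq: "finite (q i)" if "i \<in> I" for i
    using q[OF that] by auto
  \<comment> \<open>Stated for every \<open>h\<close>, because it is applied to \<open>f\<close> for
    the increments and to the identity for the lengths.\<close>
  have split: "(\<Sum>(l, r)\<in>I. h r - h l) - (\<Sum>(l, r)\<in>J. h r - h l)
      = (\<Sum>(i, K)\<in>(SIGMA i:I. q i - p i). h (Sup K) - h (Inf K))" for h :: "real \<Rightarrow> real"
  proof -
    have "(\<Sum>(l, r)\<in>I. h r - h l) = (\<Sum>i\<in>I. \<Sum>K\<in>q i. h (Sup K) - h (Inf K))"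
      by (rule sum.cong[OF refl]) (use inc in \<open>auto simp: split_def\<close>)
    also have "\<dots> = (\<Sum>i\<in>I. (\<Sum>K\<in>q i - p i. h (Sup K) - h (Inf K)) + (\<Sum>K\<in>p i. h (Sup K) - h (Inf K)))"
      by (rule sum.cong[OF refl], rule sum.subset_diff) (use q finq in auto)
    also have "\<dots> = (\<Sum>i\<in>I. \<Sum>K\<in>q i - p i. h (Sup K) - h (Inf K)) + (\<Sum>i\<in>I. \<Sum>K\<in>p i. h (Sup K) - h (Inf K))"
      by (rule sum.distrib)
    also have "(\<Sum>i\<in>I. \<Sum>K\<in>p i. h (Sup K) - h (Inf K)) = (\<Sum>i\<in>I. \<Sum>j\<in>{j\<in>J. g j = i}. h (snd j) - h (fst j))"
    proof (rule sum.cong[OF refl])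
      fix i
      have "inj_on box {j\<in>J. g j = i}"
        using inj by (rule inj_on_subset) auto
      then have "(\<Sum>K\<in>p i. h (Sup K) - h (Inf K)) = (\<Sum>j\<in>{j\<in>J. g j = i}. h (Sup (box j)) - h (Inf (box j)))"
        by (simp add: p_def sum.reindex)
      also have "\<dots> = (\<Sum>j\<in>{j\<in>J. g j = i}. h (snd j) - h (fst j))"
        by (rule sum.cong[OF refl]) (use ne in \<open>auto simp: box_def less_imp_le split: prod.split\<close>)
      finally show "(\<Sum>K\<in>p i. h (Sup K) - h (Inf K)) = (\<Sum>j\<in>{j\<in>J. g j = i}. h (snd j) - h (fst j))" .
    qed
    also have "\<dots> = (\<Sum>j\<in>J. h (snd j) - h (fst j))"
      by (rule sum.group) (use I J g in auto)
    also have "(\<Sum>i\<in>I. \<Sum>K\<in>q i - p i. h (Sup K) - h (Inf K)) = (\<Sum>(i, K)\<in>(SIGMA i:I. q i - p i). h (Sup K) - h (Inf K))"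
      by (rule sum.Sigma) (use I finq in auto)
    finally show ?thesis
      by (simp add: split_def)
  qed
  \<comment> \<open>Each gap is paired with its outer interval, so that the double sum over gaps
    becomes a sum over one finite index set.\<close>
  define G where "G = (SIGMA i:I. q i - p i)"
  have GK: "\<exists>u v. snd x = {u..v} \<and> u \<le> v \<and> fst (fst x) \<le> u \<and> v \<le> snd (fst x)" if "x \<in> G" for x
  proof -
    have x: "fst x \<in> I" "snd x \<in> q (fst x)"
      using that by (auto simp: G_def)
    then have qd: "q (fst x) division_of cbox (fst (fst x)) (snd (fst x))"
      using q by blast
    obtain u v where "snd x = cbox u v"
      using division_ofD(4)[OF qd x(2)] by blast
    then show ?thesis
      using division_ofD(2,3)[OF qd x(2)] by auto
  qed
  have "(\<Sum>x\<in>G. dist (f (Inf (snd x))) (f (Sup (snd x)))) < e"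
  proof (rule f)
    show "finite G"
      unfolding G_def by (rule finite_SigmaI) (use I finq in auto)
    show "a \<le> Inf (snd x) \<and> Inf (snd x) \<le> Sup (snd x) \<and> Sup (snd x) \<le> b" if "x \<in> G" for x
    proof -
      have "fst x \<in> I" using that by (auto simp: G_def)
      then have "a \<le> fst (fst x)" "snd (fst x) \<le> b"
        using I(2)[of "fst (fst x)" "snd (fst x)"] by auto
      then show ?thesis
        using GK[OF that] by auto
    qed
    show "disjoint_family_on (\<lambda>x. {Inf (snd x)<..<Sup (snd x)}) G"
      unfolding disjoint_family_on_def
    proof (intro ballI impI)
      fix x y assume x: "x \<in> G" and y: "y \<in> G" and "x \<noteq> y"
      obtain u v where uv: "snd x = {u..v}" "u \<le> v" "fst (fst x) \<le> u" "v \<le> snd (fst x)"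
        using GK[OF x] by auto
      obtain u' v' where uv': "snd y = {u'..v'}" "u' \<le> v'" "fst (fst y) \<le> u'" "v' \<le> snd (fst y)"
        using GK[OF y] by auto
      have I': "fst x \<in> I" "fst y \<in> I" "snd x \<in> q (fst x)" "snd y \<in> q (fst y)"
        using x y by (auto simp: G_def)
      show "{Inf (snd x)<..<Sup (snd x)} \<inter> {Inf (snd y)<..<Sup (snd y)} = {}"
      proof (cases "fst x = fst y")
        case True
        then have ne': "snd x \<noteq> snd y"
          using \<open>x \<noteq> y\<close> by (simp add: prod_eq_iff)
        have qd: "q (fst x) division_of cbox (fst (fst x)) (snd (fst x))"
          using q I' by blast
        have "interior (snd x) \<inter> interior (snd y) = {}"
          using division_ofD(5)[OF qd] I' True ne' by auto
        then show ?thesis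
          using uv uv' by (simp add: interior_atLeastAtMost_real)
      next
        case False
        have "(\<lambda>(l, r). {l..r}) (fst x) \<inter> (\<lambda>(l, r). {l..r}) (fst y) = {}"
          by (rule disjoint_family_onD[OF I(3) I'(1,2) False])
        then have "{fst (fst x)..snd (fst x)} \<inter> {fst (fst y)..snd (fst y)} = {}"
          by (simp add: split_def)
        moreover have "{u<..<v} \<subseteq> {fst (fst x)..snd (fst x)}" "{u'<..<v'} \<subseteq> {fst (fst y)..snd (fst y)}"
          using uv uv' by auto
        ultimately have "{u<..<v} \<inter> {u'<..<v'} = {}"
          by blast
        then show ?thesis
          using uv(2) uv'(2) by (simp only: uv(1) uv'(1) cSup_atLeastAtMost cInf_atLeastAtMost)
      qed
    qed
    show "(\<Sum>x\<in>G. Sup (snd x) - Inf (snd x)) < d"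
      using small split[of "\<lambda>x. x"] by (simp add: G_def split_def)
  qed
  moreover have "\<bar>\<Sum>x\<in>G. f (Sup (snd x)) - f (Inf (snd x))\<bar> \<le> (\<Sum>x\<in>G. dist (f (Inf (snd x))) (f (Sup (snd x))))"
    by (rule order_trans[OF sum_abs]) (auto simp: dist_real_def abs_minus_commute)
  moreover have "(\<Sum>(l, r)\<in>I. f r - f l) - (\<Sum>(l, r)\<in>J. f r - f l) = (\<Sum>x\<in>G. f (Sup (snd x)) - f (Inf (snd x)))"
    using split[of f] by (simp add: G_def split_def)
  ultimately show ?thesis
    by simp
qed

section \<open>Difference quotients and almost everywhere differentiability\<close>

lemma measure_UN_disjoint_intervals:
  fixes I :: "(real \<times> real) set"
  assumes "finite I" "\<And>l r. (l, r) \<in> I \<Longrightarrow> l < r" "disjoint_family_on (\<lambda>(l, r). {l..r}) I"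
  shows "(\<Union>(l, r)\<in>I. {l<..<r}) \<in> lmeasurable"
    "measure lebesgue (\<Union>(l, r)\<in>I. {l<..<r}) = (\<Sum>(l, r)\<in>I. r - l)"
proof -
  have lm: "(\<lambda>(l, r). {l<..<r}) i \<in> lmeasurable" for i :: "real \<times> real"
    by (auto split: prod.split)
  show "(\<Union>(l, r)\<in>I. {l<..<r}) \<in> lmeasurable"
    using lm by (intro fmeasurable.finite_UN[OF assms(1)])
  have "measure lebesgue (\<Union>(l, r)\<in>I. {l<..<r}) = (\<Sum>i\<in>I. measure lebesgue ((\<lambda>(l, r). {l<..<r}) i))"
  proof (rule measure_finite_Union[OF assms(1)])
    show "disjoint_family_on (\<lambda>(l, r). {l<..<r}) I"
      using assms(3) unfolding disjoint_family_on_def by fastforce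
    show "(\<lambda>(l, r). {l<..<r}) ` I \<subseteq> sets lebesgue"
      using fmeasurableD[OF lm] by blast
    show "emeasure lebesgue ((\<lambda>(l, r). {l<..<r}) i) \<noteq> \<infinity>" for i :: "real \<times> real"
      using fmeasurableD2[OF lm] by (simp add: top_ennreal_def[symmetric])
  qed
  also have "\<dots> = (\<Sum>(l, r)\<in>I. r - l)"
    using assms(2) by (intro sum.cong) (auto simp: less_imp_le)
  finally show "measure lebesgue (\<Union>(l, r)\<in>I. {l<..<r}) = (\<Sum>(l, r)\<in>I. r - l)" .
qed

text \<open>On a family of total length below \<open>d\<close> the increments sum to less than 1, so
  intervals of slope above \<open>c\<close> have total length below \<open>1 / c\<close>. This needs
  short families, hence negligibility is shown locally: a ball of radius \<open>d / 3\<close> has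
  length below \<open>d\<close>.\<close>

lemma abs_continuous_on_negligible_infinite_slope:
  fixes f :: "real \<Rightarrow> real"
  assumes f: "abs_continuous_on a b f"
  shows "negligible {x \<in> {a<..<b}. \<forall>c. \<exists>\<^sub>F y in at x. (f y - f x) / (y - x) > c}" (is "negligible ?S")
proof -
  from abs_continuous_onD[OF f zero_less_one, where ?'i = "real \<times> real"] obtain d where d: "d > 0"
    "\<And>(I :: (real \<times> real) set) l r. \<lbrakk>finite I; \<And>i. i \<in> I \<Longrightarrow> a \<le> l i \<and> l i \<le> r i \<and> r i \<le> b;
        disjoint_family_on (\<lambda>i. {l i<..<r i}) I; (\<Sum>i\<in>I. r i - l i) < d\<rbrakk>
      \<Longrightarrow> (\<Sum>i\<in>I. dist (f (l i)) (f (r i))) < 1"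
    by blast
  have "\<exists>V. openin (top_of_set ?S) V \<and> x \<in> V \<and> negligible V" if x: "x \<in> ?S" for x
  proof (intro exI[of _ "?S \<inter> ball x (d / 3)"] conjI)
    let ?U = "{a<..<b} \<inter> ball x (d / 3)"
    show "openin (top_of_set ?S) (?S \<inter> ball x (d / 3))"
      by (simp add: openin_open_Int)
    show "x \<in> ?S \<inter> ball x (d / 3)"
      using x d(1) by auto
    show "negligible (?S \<inter> ball x (d / 3))"
      unfolding negligible_outer
    proof (intro allI impI)
      fix e :: real assume "e > 0"
      \<comment> \<open>This slope forces the intervals to have total measure below
        \<open>e / 2\<close>; the other half of \<open>e\<close> is left for
        \<open>V\<close>.\<close>
      define c where "c = 2 / e"
      have "c > 0" using \<open>e > 0\<close> by (simp add: c_def)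
      have Ulm: "?U \<in> lmeasurable"
        by (intro fmeasurable_Int_fmeasurable) auto
      obtain I V where I: "finite I" "\<And>l r. (l, r) \<in> I \<Longrightarrow> l < r \<and> {l..r} \<subseteq> ?U \<and> f r - f l > c * (r - l)"
        "disjoint_family_on (\<lambda>(l, r). {l..r}) I"
        and V: "open V" "V \<in> lmeasurable" "measure lebesgue V < e / 2"
          "?S \<inter> ball x (d / 3) \<subseteq> V \<union> (\<Union>(l, r)\<in>I. {l<..<r})"
        by (rule Vitali_slope_cover[of ?U "?S \<inter> ball x (d / 3)" "e / 2" c f])
           (use Ulm \<open>e > 0\<close> in \<open>auto simp: open_Int\<close>)
      have lt: "l < r" if "(l, r) \<in> I" for l r
        using I(2) that by blast
      note W = measure_UN_disjoint_intervals[OF I(1) lt I(3)]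
      have "measure lebesgue (\<Union>(l, r)\<in>I. {l<..<r}) \<le> measure lebesgue (ball x (d / 3))"
      proof (rule measure_mono_fmeasurable)
        have "{l<..<r} \<subseteq> ball x (d / 3)" if "(l, r) \<in> I" for l r
          using I(2)[OF that] greaterThanLessThan_subseteq_atLeastAtMost_iff[of l r l r] by blast
        then show "(\<Union>(l, r)\<in>I. {l<..<r}) \<subseteq> ball x (d / 3)"
          by blast
      qed (use W in auto)
      also have "\<dots> < d"
        using d(1) by (simp add: ball_eq_greaterThanLessThan)
      finally have "(\<Sum>i\<in>I. snd i - fst i) < d"
        using W(2) by (simp add: split_def)
      then have "(\<Sum>i\<in>I. dist (f (fst i)) (f (snd i))) < 1"
      proof (intro d(2))
        show "disjoint_family_on (\<lambda>i. {fst i<..<snd i}) I"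
          using I(3) unfolding disjoint_family_on_def by fastforce
        show "a \<le> fst i \<and> fst i \<le> snd i \<and> snd i \<le> b" if "i \<in> I" for i
        proof -
          have "fst i < snd i" "{fst i..snd i} \<subseteq> {a<..<b}"
            using I(2)[of "fst i" "snd i"] that by auto
          then show ?thesis
            by (auto dest: subsetD[of _ _ "fst i"] subsetD[of _ _ "snd i"])
        qed
      qed (use I in auto)
      moreover have "(\<Sum>i\<in>I. c * (snd i - fst i)) \<le> (\<Sum>i\<in>I. dist (f (fst i)) (f (snd i)))"
      proof (rule sum_mono)
        fix i assume "i \<in> I"
        then have "c * (snd i - fst i) < f (snd i) - f (fst i)"
          using I(2)[of "fst i" "snd i"] by auto
        then show "c * (snd i - fst i) \<le> dist (f (fst i)) (f (snd i))"
          by (simp add: dist_real_def)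
      qed
      moreover have "c * measure lebesgue (\<Union>(l, r)\<in>I. {l<..<r}) = (\<Sum>i\<in>I. c * (snd i - fst i))"
        by (subst W(2)) (auto simp: split_def sum_distrib_left)
      ultimately have "c * measure lebesgue (\<Union>(l, r)\<in>I. {l<..<r}) < 1"
        by simp
      then have small: "measure lebesgue (\<Union>(l, r)\<in>I. {l<..<r}) < e / 2"
        using \<open>e > 0\<close> by (simp add: c_def field_simps)
      show "\<exists>T. ?S \<inter> ball x (d / 3) \<subseteq> T \<and> T \<in> lmeasurable \<and> measure lebesgue T < e"
      proof (intro exI conjI)
        show "?S \<inter> ball x (d / 3) \<subseteq> V \<union> (\<Union>(l, r)\<in>I. {l<..<r})" by fact
        show "V \<union> (\<Union>(l, r)\<in>I. {l<..<r}) \<in> lmeasurable"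
          using V W by auto
        have "measure lebesgue (V \<union> (\<Union>(l, r)\<in>I. {l<..<r})) \<le> measure lebesgue V + measure lebesgue (\<Union>(l, r)\<in>I. {l<..<r})"
          using V W by (intro measure_Un_le) (auto dest: fmeasurableD)
        then show "measure lebesgue (V \<union> (\<Union>(l, r)\<in>I. {l<..<r})) < e"
          using small V by linarith
      qed
    qed
  qed
  then show ?thesis
    unfolding locally_negligible_alt[of ?S] by blast
qed

text \<open>Cover the set up to a small remainder by intervals on which \<open>f\<close> decreases, and again, inside these,
  by intervals of slope at least \<open>q\<close>. The two families nearly fill the same set, but their total
  increments differ by a multiple of its outer measure.\<close>

lemma abs_continuous_on_negligible_slope_gap_aux:
  fixes f :: "real \<Rightarrow> real"
  assumes f: "abs_continuous_on a b f" and "q > 0"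
  shows "negligible {x \<in> {a<..<b}. (\<exists>\<^sub>F y in at x. (f y - f x) / (y - x) < 0) \<and>
                                   (\<exists>\<^sub>F y in at x. (f y - f x) / (y - x) > q)}" (is "negligible ?S")
proof -
  \<comment> \<open>\<open>s\<close> is the outer measure of the set, taken over open supersets
    inside the interval; it can be used before anything is known about measurability.\<close>
  define A where "A = {measure lebesgue U |U. open U \<and> ?S \<subseteq> U \<and> U \<subseteq> {a<..<b}}"
  define s where "s = Inf A"
  have "measure lebesgue {a<..<b} \<in> A"
    unfolding A_def by (intro CollectI exI[of _ "{a<..<b}"]) auto
  then have "A \<noteq> {}"
    by auto
  have bdd: "bdd_below A"
    by (rule bdd_belowI[of _ 0]) (auto simp: A_def)
  have lm: "U \<in> lmeasurable" if "open U" "U \<subseteq> {a<..<b}" for U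
    by (rule fmeasurableI2[of "{a<..<b}"]) (use that in auto)
  have s_le: "s \<le> measure lebesgue U" if "open U" "?S \<subseteq> U" "U \<in> lmeasurable" for U
  proof -
    have "s \<le> measure lebesgue (U \<inter> {a<..<b})"
      unfolding s_def
    proof (rule cInf_lower[OF _ bdd])
      show "measure lebesgue (U \<inter> {a<..<b}) \<in> A"
        unfolding A_def using that by (intro CollectI exI[of _ "U \<inter> {a<..<b}"]) auto
    qed
    also have "\<dots> \<le> measure lebesgue U"
      using that by (intro measure_mono_fmeasurable) auto
    finally show ?thesis .
  qed
  have approx: "\<exists>U. open U \<and> ?S \<subseteq> U \<and> U \<subseteq> {a<..<b} \<and> measure lebesgue U < s + e" if "e > 0" for e
  proof -
    have "Inf A < s + e"
      using that by (simp add: s_def)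
    from cInf_lessD[OF \<open>A \<noteq> {}\<close> this] show ?thesis
      by (auto simp: A_def)
  qed
  have "s \<le> 0"
  proof (rule ccontr)
    assume "\<not> s \<le> 0"
    then have "s > 0" by simp
    \<comment> \<open>The increments over \<open>J\<close> will be at least \<open>q * s / 2\<close>
      and those over \<open>I\<close> at most 0, so closeness within \<open>q * s / 4\<close> is
      contradictory.\<close>
    then have "q * s / 4 > 0"
      using \<open>q > 0\<close> by simp
    from abs_continuous_onD[OF f this, where ?'i = "(real \<times> real) \<times> real set"]
    obtain d where d: "d > 0"
    "\<And>(I :: ((real \<times> real) \<times> real set) set) l r. \<lbrakk>finite I; \<And>i. i \<in> I \<Longrightarrow> a \<le> l i \<and> l i \<le> r i \<and> r i \<le> b;
        disjoint_family_on (\<lambda>i. {l i<..<r i}) I; (\<Sum>i\<in>I. r i - l i) < d\<rbrakk>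
      \<Longrightarrow> (\<Sum>i\<in>I. dist (f (l i)) (f (r i))) < q * s / 4"
      by blast
    \<comment> \<open>With this \<open>e\<close>, \<open>W\<close> has measure below
      \<open>s + e\<close> and \<open>W'\<close> above \<open>s - 2 * e\<close>. The gaps then have
      total length below \<open>3 * e < d\<close>, and \<open>W'\<close> retains measure at least
      \<open>s / 2\<close>.\<close>
    define e where "e = min (d / 4) (s / 8)"
    have e: "e > 0" "3 * e < d" "2 * e < s / 2"
      using d(1) \<open>s > 0\<close> by (auto simp: e_def)
    obtain U where U: "open U" "?S \<subseteq> U" "U \<subseteq> {a<..<b}" "measure lebesgue U < s + e"
      using approx[OF e(1)] by blast
    have slope_neg: "\<exists>\<^sub>F y in at x. (- f y - - f x) / (y - x) > 0" if "x \<in> ?S" for x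
    proof -
      have "\<exists>\<^sub>F y in at x. (f y - f x) / (y - x) < 0"
        using that by auto
      then show ?thesis
        by (rule frequently_elim1) (simp add: divide_less_0_iff zero_less_divide_iff, linarith)
    qed
    obtain I V where I: "finite I" "\<And>l r. (l, r) \<in> I \<Longrightarrow> l < r \<and> {l..r} \<subseteq> U \<and> - f r - - f l > 0 * (r - l)"
        "disjoint_family_on (\<lambda>(l, r). {l..r}) I"
        and V: "open V" "V \<in> lmeasurable" "measure lebesgue V < e"
          "?S \<subseteq> V \<union> (\<Union>(l, r)\<in>I. {l<..<r})"
      by (rule Vitali_slope_cover[OF U(1) lm[OF U(1,3)] U(2) e(1) slope_neg]) (assumption, rule that)
    define W where "W = (\<Union>(l, r)\<in>I. {l<..<r})"
    have ltI: "l < r" if "(l, r) \<in> I" for l r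
      using I(2) that by blast
    have W: "W \<in> lmeasurable" "measure lebesgue W = (\<Sum>(l, r)\<in>I. r - l)" "open W"
      using measure_UN_disjoint_intervals[OF I(1) ltI I(3)] by (auto simp: W_def)
    have "{l<..<r} \<subseteq> U" if "(l, r) \<in> I" for l r
      using I(2)[OF that] greaterThanLessThan_subseteq_atLeastAtMost_iff[of l r l r] by blast
    then have "W \<subseteq> U"
      unfolding W_def by blast
    obtain J V' where J: "finite J" "\<And>l r. (l, r) \<in> J \<Longrightarrow> l < r \<and> {l..r} \<subseteq> W \<and> f r - f l > q * (r - l)"
        "disjoint_family_on (\<lambda>(l, r). {l..r}) J"
        and V': "open V'" "V' \<in> lmeasurable" "measure lebesgue V' < e"
          "?S \<inter> W \<subseteq> V' \<union> (\<Union>(l, r)\<in>J. {l<..<r})"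
      by (rule Vitali_slope_cover[of W "?S \<inter> W" e q f]) (use W e in auto)
    define W' where "W' = (\<Union>(l, r)\<in>J. {l<..<r})"
    have ltJ: "l < r" if "(l, r) \<in> J" for l r
      using J(2) that by blast
    have W': "W' \<in> lmeasurable" "measure lebesgue W' = (\<Sum>(l, r)\<in>J. r - l)" "open W'"
      using measure_UN_disjoint_intervals[OF J(1) ltJ J(3)] by (auto simp: W'_def)
    have WU: "measure lebesgue W < s + e"
    proof -
      have "measure lebesgue W \<le> measure lebesgue U"
        by (rule measure_mono_fmeasurable) (use \<open>W \<subseteq> U\<close> lm[OF U(1,3)] W in auto)
      then show ?thesis using U by simp
    qed
    have sW': "s < measure lebesgue W' + 2 * e"
    proof -
      have "s \<le> measure lebesgue (V \<union> (V' \<union> W'))"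
        using V V' W' by (intro s_le) (auto simp: W_def W'_def)
      also have "\<dots> \<le> measure lebesgue V + measure lebesgue (V' \<union> W')"
        using V V' W' by (intro measure_Un_le) (auto dest: fmeasurableD)
      also have "measure lebesgue (V' \<union> W') \<le> measure lebesgue V' + measure lebesgue W'"
        using V V' W' by (intro measure_Un_le) (auto dest: fmeasurableD)
      finally show ?thesis
        using V V' by simp
    qed
    have "\<bar>(\<Sum>(l, r)\<in>I. f r - f l) - (\<Sum>(l, r)\<in>J. f r - f l)\<bar> < q * s / 4"
    proof (rule increments_nested_families[OF I(1) _ I(3) J(1) _ J(3) d(2)])
      show "a \<le> l \<and> l < r \<and> r \<le> b" if "(l, r) \<in> I" for l r
      proof -
        have "l < r" "{l..r} \<subseteq> {a<..<b}"
          using I(2)[OF that] U(3) by auto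
        then show ?thesis
          by (auto dest: subsetD[of _ _ l] subsetD[of _ _ r])
      qed
      show "l < r \<and> {l..r} \<subseteq> (\<Union>(l, r)\<in>I. {l<..<r})" if "(l, r) \<in> J" for l r
        using J(2)[OF that] by (simp add: W_def)
      show "(\<Sum>(l, r)\<in>I. r - l) - (\<Sum>(l, r)\<in>J. r - l) < d"
        using WU sW' e unfolding W(2) W'(2) by linarith
    qed
    moreover have "(\<Sum>(l, r)\<in>I. f r - f l) \<le> 0"
      using I(2) by (intro sum_nonpos) fastforce
    moreover have "q * (\<Sum>(l, r)\<in>J. r - l) \<le> (\<Sum>(l, r)\<in>J. f r - f l)"
      unfolding sum_distrib_left using J(2) by (intro sum_mono) (auto intro: less_imp_le)
    moreover have "q * (s / 2) \<le> q * (\<Sum>(l, r)\<in>J. r - l)"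
      using sW' e \<open>q > 0\<close> unfolding W'(2) by (intro mult_left_mono) linarith+
    moreover have "q * s > 0"
      using \<open>q > 0\<close> \<open>s > 0\<close> by simp
    ultimately show False
      by (simp add: abs_less_iff)
  qed
  show ?thesis
    unfolding negligible_outer
  proof (intro allI impI)
    fix e :: real assume "e > 0"
    from approx[OF this] obtain U where "open U" "?S \<subseteq> U" "U \<subseteq> {a<..<b}" "measure lebesgue U < s + e"
      by blast
    then show "\<exists>T. ?S \<subseteq> T \<and> T \<in> lmeasurable \<and> measure lebesgue T < e"
      using lm \<open>s \<le> 0\<close> by (intro exI[of _ U]) auto
  qed
qed

text \<open>Subtracting \<open>p * x\<close> moves the lower threshold to 0 and the upper one to
  \<open>q - p\<close>.\<close>

lemma abs_continuous_on_negligible_slope_gap: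
  fixes f :: "real \<Rightarrow> real"
  assumes f: "abs_continuous_on a b f" and "p < q"
  shows "negligible {x \<in> {a<..<b}. (\<exists>\<^sub>F y in at x. (f y - f x) / (y - x) < p) \<and>
                                   (\<exists>\<^sub>F y in at x. (f y - f x) / (y - x) > q)}" (is "negligible ?S")
proof (rule negligible_subset)
  let ?g = "\<lambda>x. f x - p * x"
  have "abs_continuous_on a b ?g"
  proof (rule abs_continuous_on_lipschitz_compose[OF f])
    show "dist (?g x) (?g y) \<le> 1 * dist (f x) (f y) + \<bar>p\<bar> * dist x y" for x y
    proof -
      have "?g x - ?g y = (f x - f y) - p * (x - y)"
        by (simp add: algebra_simps)
      then have "\<bar>?g x - ?g y\<bar> \<le> \<bar>f x - f y\<bar> + \<bar>p * (x - y)\<bar>"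
        by linarith
      then show ?thesis
        by (simp add: dist_real_def abs_mult)
    qed
  qed
  then show "negligible {x \<in> {a<..<b}. (\<exists>\<^sub>F y in at x. (?g y - ?g x) / (y - x) < 0) \<and>
                                   (\<exists>\<^sub>F y in at x. (?g y - ?g x) / (y - x) > q - p)}" (is "negligible ?S'")
    using \<open>p < q\<close> by (intro abs_continuous_on_negligible_slope_gap_aux) auto
  have eq: "(?g y - ?g x) / (y - x) = (f y - f x) / (y - x) - p" if "y \<noteq> x" for x y
    using that by (simp add: field_simps)
  have ev: "eventually (\<lambda>y. y \<noteq> x) (at x)" for x :: real
    by (simp add: eventually_at_filter)
  show "?S \<subseteq> ?S'"
  proof safe
    fix x
    assume 1: "\<exists>\<^sub>F y in at x. (f y - f x) / (y - x) < p" and 2: "\<exists>\<^sub>F y in at x. q < (f y - f x) / (y - x)"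
    show "\<exists>\<^sub>F y in at x. (?g y - ?g x) / (y - x) < 0"
      using frequently_eventually_frequently[OF 1 ev] by (rule frequently_elim1) (auto simp: eq)
    show "\<exists>\<^sub>F y in at x. q - p < (?g y - ?g x) / (y - x)"
      using frequently_eventually_frequently[OF 2 ev] by (rule frequently_elim1) (auto simp: eq)
  qed
qed

text \<open>The first two hypotheses keep the lower and upper limits of the quotient finite, and the
  third excludes any gap between them. Restricting the gap to rational thresholds keeps the family
  of exceptional sets countable.\<close>

lemma differentiable_if_slopes_converge:
  fixes f :: "real \<Rightarrow> real"
  assumes up: "\<not> (\<forall>c. \<exists>\<^sub>F y in at x. (f y - f x) / (y - x) > c)"
    and low: "\<not> (\<forall>c. \<exists>\<^sub>F y in at x. (- f y - - f x) / (y - x) > c)"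
    and gap: "\<And>p q. p \<in> \<rat> \<Longrightarrow> q \<in> \<rat> \<Longrightarrow> p < q \<Longrightarrow>
      \<not> ((\<exists>\<^sub>F y in at x. (f y - f x) / (y - x) < p) \<and> (\<exists>\<^sub>F y in at x. (f y - f x) / (y - x) > q))"
  shows "f differentiable (at x)"
proof -
  define g where "g = (\<lambda>y. (f y - f x) / (y - x))"
  obtain B where B: "eventually (\<lambda>y. g y \<le> B) (at x)"
    using up by (auto simp: not_frequently g_def not_less)
  obtain B' where "\<not> (\<exists>\<^sub>F y in at x. (- f y - - f x) / (y - x) > B')"
    using low by blast
  moreover have "(- f y - - f x) / (y - x) = - g y" for y
    unfolding g_def by (simp add: divide_simps)
  ultimately have B': "eventually (\<lambda>y. - B' \<le> g y) (at x)"
    by (simp add: not_frequently not_less minus_le_iff)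
  let ?G = "\<lambda>y. ereal (g y)"
  define l u where "l = Liminf (at x) ?G" and "u = Limsup (at x) ?G"
  have nb: "at x \<noteq> bot"
    by simp
  have "l \<le> u"
    unfolding l_def u_def by (rule Liminf_le_Limsup[OF nb])
  have "u \<le> ereal B"
    unfolding u_def using B by (intro Limsup_bounded) (auto elim: eventually_mono)
  have "ereal (- B') \<le> l"
    unfolding l_def using B' by (intro Liminf_bounded) (auto elim: eventually_mono)
  have "l = u"
  proof (rule ccontr)
    assume "l \<noteq> u"
    with \<open>l \<le> u\<close> have "l < u" by simp
    \<comment> \<open>The density lemma yields reals; three of them, \<open>q' < p < q\<close>,
      leave room for rationals \<open>r < p < r'\<close> still strictly between \<open>l\<close> and
      \<open>u\<close>.\<close>
    then obtain q where q: "l < ereal q" "ereal q < u"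
      using ereal_dense2 by blast
    then obtain p where p: "l < ereal p" "ereal p < ereal q"
      using ereal_dense2 by blast
    obtain q' where q': "l < ereal q'" "ereal q' < ereal p"
      using ereal_dense2[OF p(1)] by blast
    obtain r where r: "r \<in> \<rat>" "q' < r" "r < p"
      using Rats_dense_in_real[of q' p] q' by auto
    obtain r' where r': "r' \<in> \<rat>" "p < r'" "r' < q"
      using Rats_dense_in_real[of p q] p by auto
    have "l < ereal r" "ereal r' < u"
      using q' q r r' by (meson less_ereal.simps(1) less_trans)+
    have "\<exists>\<^sub>F y in at x. g y < r"
    proof (rule ccontr)
      assume "\<not> (\<exists>\<^sub>F y in at x. g y < r)"
      then have "ereal r \<le> l"
        unfolding l_def by (intro Liminf_bounded) (auto simp: not_frequently not_less elim: eventually_mono)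
      then show False using \<open>l < ereal r\<close> by simp
    qed
    moreover have "\<exists>\<^sub>F y in at x. g y > r'"
    proof (rule ccontr)
      assume "\<not> (\<exists>\<^sub>F y in at x. g y > r')"
      then have "u \<le> ereal r'"
        unfolding u_def by (intro Limsup_bounded) (auto simp: not_frequently not_less elim: eventually_mono)
      then show False using \<open>ereal r' < u\<close> by simp
    qed
    ultimately show False
      using gap[OF r(1) r'(1)] r r' by (auto simp: g_def)
  qed
  obtain D where D: "l = ereal D"
    using \<open>l = u\<close> \<open>u \<le> ereal B\<close> \<open>ereal (- B') \<le> l\<close> by (cases l) auto
  have "(?G \<longlongrightarrow> ereal D) (at x)"
    using D \<open>l = u\<close> by (intro Liminf_eq_Limsup[OF nb]) (auto simp: l_def u_def)
  then have "(g \<longlongrightarrow> D) (at x)"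
    by simp
  then have "(f has_field_derivative D) (at x)"
    unfolding has_field_derivative_iff g_def .
  then show ?thesis
    by (auto simp: differentiable_def has_field_derivative_def)
qed

text \<open>A point of non-differentiability has quotients unbounded above, or unbounded below
  (unbounded above for \<open>- f\<close>), or a rational gap between their lower and upper limits.
  These are countably many negligible sets.\<close>

lemma abs_continuous_on_negligible_nondifferentiable_real:
  fixes f :: "real \<Rightarrow> real"
  assumes f: "abs_continuous_on a b f"
  shows "negligible {x \<in> {a<..<b}. \<not> f differentiable (at x)}"
proof (rule negligible_subset)
  have mf: "abs_continuous_on a b (\<lambda>x. - f x)"
    by (rule abs_continuous_on_lipschitz_compose[OF f, where C = 1 and D = 0]) (simp add: dist_minus)
  let ?U = "\<lambda>f. {x \<in> {a<..<b}. \<forall>c. \<exists>\<^sub>F y in at x. (f y - f x) / (y - x) > c}"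
  let ?S = "\<lambda>(p, q). {x \<in> {a<..<b}. (\<exists>\<^sub>F y in at x. (f y - f x) / (y - x) < p) \<and>
                                   (\<exists>\<^sub>F y in at x. (f y - f x) / (y - x) > q)}"
  let ?R = "{(p, q). p \<in> \<rat> \<and> q \<in> \<rat> \<and> p < (q::real)}"
  have "countable ?R"
    by (rule countable_subset[of _ "\<rat> \<times> \<rat>"]) (auto intro: countable_rat)
  moreover have "negligible (?S pq)" if "pq \<in> ?R" for pq
    using that abs_continuous_on_negligible_slope_gap[OF f, of "fst pq" "snd pq"] by (simp add: split_def)
  ultimately have "negligible (\<Union>(?S ` ?R))"
    by (intro negligible_countable_Union) auto
  then show "negligible (?U f \<union> ?U (\<lambda>x. - f x) \<union> (\<Union>(?S ` ?R)))"
    by (intro negligible_Un abs_continuous_on_negligible_infinite_slope f mf)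
  show "{x \<in> {a<..<b}. \<not> f differentiable (at x)} \<subseteq> ?U f \<union> ?U (\<lambda>x. - f x) \<union> (\<Union>(?S ` ?R))"
  proof
    fix x assume x: "x \<in> {x \<in> {a<..<b}. \<not> f differentiable (at x)}"
    show "x \<in> ?U f \<union> ?U (\<lambda>x. - f x) \<union> (\<Union>(?S ` ?R))"
    proof (rule ccontr)
      assume no: "x \<notin> ?U f \<union> ?U (\<lambda>x. - f x) \<union> (\<Union>(?S ` ?R))"
      have "f differentiable (at x)"
        by (rule differentiable_if_slopes_converge) (use x no in auto)
      then show False
        using x by blast
    qed
  qed
qed

theorem abs_continuous_on_negligible_nondifferentiable:
  fixes f :: "real \<Rightarrow> 'a::euclidean_space"
  assumes f: "abs_continuous_on a b f"
  shows "negligible {x \<in> {a<..<b}. \<not> f differentiable (at x)}"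
proof (rule negligible_subset)
  have "negligible {x \<in> {a<..<b}. \<not> (\<lambda>y. f y \<bullet> i) differentiable (at x)}" for i
  proof (rule abs_continuous_on_negligible_nondifferentiable_real)
    show "abs_continuous_on a b (\<lambda>y. f y \<bullet> i)"
    proof (rule abs_continuous_on_lipschitz_compose[OF f])
      show "dist (f x \<bullet> i) (f y \<bullet> i) \<le> norm i * dist (f x) (f y) + 0 * dist x y" for x y
        using Cauchy_Schwarz_ineq2[of "f x - f y" i]
        by (simp add: dist_real_def dist_norm inner_diff_left mult.commute)
    qed
  qed
  then show "negligible (\<Union>i\<in>Basis. {x \<in> {a<..<b}. \<not> (\<lambda>y. f y \<bullet> i) differentiable (at x)})"
    by (intro negligible_Union) auto
  show "{x \<in> {a<..<b}. \<not> f differentiable (at x)} \<subseteq>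
      (\<Union>i\<in>Basis. {x \<in> {a<..<b}. \<not> (\<lambda>y. f y \<bullet> i) differentiable (at x)})"
    using differentiable_componentwise_within[of f _ UNIV] by auto
qed

text \<open>In a fine tagged division, the intervals tagged in \<open>N\<close> lie in an open set of small measure, so
  absolute continuity makes their increments negligible.\<close>

theorem abs_continuous_on_has_integral_derivative:
  fixes f :: "real \<Rightarrow> 'a::euclidean_space"
  assumes f: "abs_continuous_on a b f" and "a \<le> b" and N: "negligible N"
    and deriv: "\<And>x. x \<in> {a..b} - N \<Longrightarrow> (f has_vector_derivative f' x) (at x within {a..b})"
  shows "(f' has_integral (f b - f a)) {a..b}"
proof (cases "a = b")
  case True
  then show ?thesis by (simp add: has_integral_refl)
next
  case False
  with \<open>a \<le> b\<close> have "a < b" by simp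
  \<comment> \<open>With the value 0 on \<open>N\<close>, an interval tagged in \<open>N\<close>
    contributes to the error only the increment of \<open>f\<close>.\<close>
  define g where "g = (\<lambda>x. if x \<in> N then 0 else f' x)"
  have "(g has_integral (f b - f a)) {a..b}"
    unfolding has_integral_factor_content box_real[symmetric]
  proof safe
    fix e :: real
    assume "e > 0"
    then have "\<forall>x. \<exists>d>0. x \<in> {a..b} - N \<longrightarrow>
         (\<forall>y\<in>{a..b}. norm (y-x) < d \<longrightarrow> norm (f y - f x - (y-x) *\<^sub>R f' x) \<le> e / 2 * norm (y-x))"
      using deriv[unfolded has_vector_derivative_def has_derivative_within_alt] half_gt_zero by blast
    then obtain d where d: "\<And>x. 0 < d x"
                   "\<And>x y. \<lbrakk>x \<in> {a..b} - N; y \<in> {a..b}; norm (y-x) < d x\<rbrakk>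
                          \<Longrightarrow> norm (f y - f x - (y-x) *\<^sub>R f' x) \<le> e / 2 * norm (y-x)"
      by metis
    \<comment> \<open>Half of the error allowance \<open>e * (b - a)\<close> goes to the intervals
      tagged in \<open>N\<close>; the linear approximation at the other tags, with constant
      \<open>e / 2\<close>, uses the rest.\<close>
    define e' where "e' = e / 2 * (b - a)"
    have "e' > 0"
      using \<open>e > 0\<close> \<open>a < b\<close> by (simp add: e'_def)
    from abs_continuous_onD[OF f this, where ?'i = "real \<times> real set"]
    obtain \<delta> where \<delta>: "\<delta> > 0"
      "\<And>(I :: (real \<times> real set) set) l r. \<lbrakk>finite I; \<And>i. i \<in> I \<Longrightarrow> a \<le> l i \<and> l i \<le> r i \<and> r i \<le> b;
        disjoint_family_on (\<lambda>i. {l i<..<r i}) I; (\<Sum>i\<in>I. r i - l i) < \<delta>\<rbrakk>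
      \<Longrightarrow> (\<Sum>i\<in>I. dist (f (l i)) (f (r i))) < e'"
      by blast
    have "N \<in> lmeasurable" "measure lebesgue N = 0"
      using N negligible_iff_measure by auto
    then obtain V where V: "open V" "N \<subseteq> V" "V \<in> lmeasurable" "measure lebesgue V < \<delta>"
      using lmeasurable_outer_open[OF _ \<delta>(1), of N] by auto
    define \<gamma> where "\<gamma> = (\<lambda>x. if x \<in> N then V else ball x (d x))"
    show "\<exists>\<gamma>. gauge \<gamma> \<and> (\<forall>p. p tagged_division_of (cbox a b) \<and> \<gamma> fine p \<longrightarrow>
      norm ((\<Sum>(x, k)\<in>p. measure lborel k *\<^sub>R g x) - (f b - f a)) \<le> e * measure lborel (cbox a b))"
    proof (rule exI, safe)
      show "gauge \<gamma>"
        using V d(1) by (auto simp: gauge_def \<gamma>_def)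
    next
      fix p
      assume ptag: "p tagged_division_of cbox a b" and finep: "\<gamma> fine p"
      have finp: "finite p"
        using ptag by blast
      have ba: "b - a = (\<Sum>(x,K)\<in>p. Sup K - Inf K)" "f b - f a = (\<Sum>(x,K)\<in>p. f(Sup K) - f(Inf K))"
        using additive_tagged_division_1[where f= "\<lambda>x. x"] additive_tagged_division_1[where f= f]
              \<open>a \<le> b\<close> ptag by auto
      have K: "\<exists>u v. K = {u..v} \<and> u \<le> v \<and> a \<le> u \<and> v \<le> b \<and> u \<le> x \<and> x \<le> v \<and> {u..v} \<subseteq> \<gamma> x"
        if xK: "(x, K) \<in> p" for x K
      proof -
        have "x \<in> K" "K \<subseteq> cbox a b" "K \<subseteq> \<gamma> x"
          using ptag finep xK by blast+
        moreover obtain u v where "K = cbox u v"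
          using ptag xK by blast
        ultimately show ?thesis
          by (intro exI[of _ u] exI[of _ v]) auto
      qed
      define pN where "pN = {i \<in> p. fst i \<in> N}"
      define q where "q = {i \<in> p. fst i \<notin> N}"
      have split: "sum h p = sum h pN + sum h q" for h :: "real \<times> real set \<Rightarrow> 'a"
        using finp by (subst sum.union_disjoint[symmetric]) (auto simp: pN_def q_def intro: sum.cong)
      have "norm (\<Sum>(x, K)\<in>q. measure lborel K *\<^sub>R g x - (f (Sup K) - f (Inf K)))
          \<le> (\<Sum>(x, K)\<in>q. e / 2 * (Sup K - Inf K))"
      proof (rule sum_norm_le, safe)
        fix x K assume "(x, K) \<in> q"
        then have xK: "(x, K) \<in> p" "x \<notin> N"
          by (auto simp: q_def)
        obtain u v where uv: "K = {u..v}" "u \<le> v" "a \<le> u" "v \<le> b" "u \<le> x" "x \<le> v" "{u..v} \<subseteq> \<gamma> x"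
          using K[OF xK(1)] by blast
        have ball: "{u..v} \<subseteq> ball x (d x)"
          using uv xK by (simp add: \<gamma>_def)
        have close: "norm (u - x) < d x" "norm (v - x) < d x"
          using subsetD[OF ball, of u] subsetD[OF ball, of v] uv
          by (auto simp: dist_real_def abs_minus_commute)
        have "norm ((v - u) *\<^sub>R f' x - (f v - f u)) = norm ((f u - f x - (u - x) *\<^sub>R f' x) - (f v - f x - (v - x) *\<^sub>R f' x))"
          by (simp add: algebra_simps)
        also have "\<dots> \<le> norm (f u - f x - (u - x) *\<^sub>R f' x) + norm (f v - f x - (v - x) *\<^sub>R f' x)"
          by (rule norm_triangle_ineq4)
        also have "\<dots> \<le> e / 2 * norm (u - x) + e / 2 * norm (v - x)"
          using uv xK close by (intro add_mono d(2)) auto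
        also have "\<dots> = e / 2 * (v - u)"
        proof -
          have "norm (u - x) = x - u" "norm (v - x) = v - x"
            using uv by auto
          then show ?thesis
            unfolding distrib_left[symmetric] by simp
        qed
        finally show "norm (measure lborel K *\<^sub>R g x - (f (Sup K) - f (Inf K))) \<le> e / 2 * (Sup K - Inf K)"
          using uv xK by (simp add: g_def)
      qed
      also have "\<dots> \<le> (\<Sum>(x, K)\<in>p. e / 2 * (Sup K - Inf K))"
      proof (rule sum_mono2)
        show "0 \<le> (case i of (x, K) \<Rightarrow> e / 2 * (Sup K - Inf K))" if "i \<in> p - q" for i
          using K[of "fst i" "snd i"] that \<open>e > 0\<close> by (auto simp: split_def)
      qed (use finp in \<open>auto simp: q_def\<close>)
      also have "\<dots> = e / 2 * (b - a)"
        by (simp add: ba split_def sum_distrib_left)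
      finally have 1: "norm (\<Sum>(x, K)\<in>q. measure lborel K *\<^sub>R g x - (f (Sup K) - f (Inf K))) \<le> e / 2 * (b - a)" .
      have disj: "disjoint_family_on (\<lambda>i. {Inf (snd i)<..<Sup (snd i)}) pN"
        unfolding disjoint_family_on_def
      proof (intro ballI impI)
        fix i j assume ij: "i \<in> pN" "j \<in> pN" "i \<noteq> j"
        then have ij': "(fst i, snd i) \<in> p" "(fst j, snd j) \<in> p" "(fst i, snd i) \<noteq> (fst j, snd j)"
          by (auto simp: pN_def prod_eq_iff)
        have "interior (snd i) \<inter> interior (snd j) = {}"
          using tagged_division_ofD(5)[OF ptag ij'] .
        then show "{Inf (snd i)<..<Sup (snd i)} \<inter> {Inf (snd j)<..<Sup (snd j)} = {}"
          using K[OF ij'(1)] K[OF ij'(2)] by (auto simp: interior_atLeastAtMost_real)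
      qed
      have pNK: "\<exists>u v. snd i = {u..v} \<and> u \<le> v \<and> a \<le> u \<and> v \<le> b \<and> {u..v} \<subseteq> V" if "i \<in> pN" for i
        using K[of "fst i" "snd i"] that by (auto simp: pN_def \<gamma>_def)
      have "(\<Sum>i\<in>pN. Sup (snd i) - Inf (snd i)) = (\<Sum>i\<in>pN. measure lebesgue {Inf (snd i)<..<Sup (snd i)})"
        using pNK by (intro sum.cong[OF refl]) fastforce
      also have "\<dots> = measure lebesgue (\<Union>i\<in>pN. {Inf (snd i)<..<Sup (snd i)})"
      proof (rule measure_finite_Union[symmetric])
        show "emeasure lebesgue {Inf (snd i)<..<Sup (snd i)} \<noteq> \<infinity>" for i :: "real \<times> real set"
        proof -
          have "{Inf (snd i)<..<Sup (snd i)} \<in> lmeasurable"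
            by simp
          then show ?thesis
            unfolding infinity_ennreal_def by (rule fmeasurableD2)
        qed
      qed (use finp disj in \<open>auto simp: pN_def\<close>)
      also have "\<dots> \<le> measure lebesgue V"
      proof (rule measure_mono_fmeasurable[OF _ _ V(3)])
        have "{Inf (snd i)<..<Sup (snd i)} \<subseteq> V" if "i \<in> pN" for i
          using pNK[OF that] by auto
        then show "(\<Union>i\<in>pN. {Inf (snd i)<..<Sup (snd i)}) \<subseteq> V"
          by blast
        show "(\<Union>i\<in>pN. {Inf (snd i)<..<Sup (snd i)}) \<in> sets lebesgue"
          using finp by (intro sets.finite_UN) (auto simp: pN_def)
      qed
      finally have small: "(\<Sum>i\<in>pN. Sup (snd i) - Inf (snd i)) < \<delta>"
        using V(4) by simp
      have "norm (\<Sum>(x, K)\<in>pN. measure lborel K *\<^sub>R g x - (f (Sup K) - f (Inf K)))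
          \<le> (\<Sum>i\<in>pN. dist (f (Inf (snd i))) (f (Sup (snd i))))"
        by (rule sum_norm_le) (auto simp: pN_def g_def dist_norm norm_minus_commute)
      also have "\<dots> < e'"
      proof (rule \<delta>(2)[OF _ _ disj small])
        show "a \<le> Inf (snd i) \<and> Inf (snd i) \<le> Sup (snd i) \<and> Sup (snd i) \<le> b" if "i \<in> pN" for i
          using pNK[OF that] by auto
      qed (use finp in \<open>auto simp: pN_def\<close>)
      finally have 2: "norm (\<Sum>(x, K)\<in>pN. measure lborel K *\<^sub>R g x - (f (Sup K) - f (Inf K))) \<le> e / 2 * (b - a)"
        by (simp add: e'_def)
      have "(\<Sum>(x, k)\<in>p. measure lborel k *\<^sub>R g x) - (f b - f a) = (\<Sum>(x, K)\<in>p. measure lborel K *\<^sub>R g x - (f (Sup K) - f (Inf K)))"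
        unfolding ba(2) by (simp add: split_def sum_subtractf)
      also have "norm \<dots> \<le> e / 2 * (b - a) + e / 2 * (b - a)"
        unfolding split by (rule norm_triangle_le[OF add_mono[OF 2 1]])
      also have "\<dots> = e * measure lborel (cbox a b)"
        using \<open>a \<le> b\<close> by simp
      finally show "norm ((\<Sum>(x, k)\<in>p. measure lborel k *\<^sub>R g x) - (f b - f a)) \<le> e * measure lborel (cbox a b)" .
    qed
  qed
  then show ?thesis
    by (rule has_integral_spike[OF N, rotated]) (auto simp: g_def)
qed

section \<open>Functions and curves on the torus\<close>

lemma torus_proj_surj: "\<exists>z. torus_proj z = x"
  by (metis torus_proj_def Quotient3_abs_rep Quotient3_torus)

lemma torus_cases: obtains z where "x = torus_proj z"
  using torus_proj_surj by metis

text \<open>The compact cube of representatives stands in for the compactness of the torus.\<close>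

lemma torus_cases_unit_cube:
  obtains z where "x = torus_proj z" "z \<in> cbox 0 1"
proof -
  obtain w where w: "x = torus_proj w"
    by (rule torus_cases)
  show thesis
  proof (rule that[of "\<chi> i. frac (w $ i)"])
    show "x = torus_proj (\<chi> i. frac (w $ i))"
      by (simp add: w torus_proj_eq_iff frac_def)
    show "(\<chi> i. frac (w $ i)) \<in> cbox 0 1"
      by (auto simp: mem_box_cart frac_ge_0 intro: less_imp_le frac_lt_1)
  qed
qed

lemma open_torus_iff: "open U \<longleftrightarrow> open (torus_proj -` U)"
  by (rule open_torus_def)

lemma continuous_on_torus_proj: "continuous_on S torus_proj"
  by (rule continuous_on_subset[of UNIV]) (auto simp: continuous_on_open_vimage open_torus_iff)

lemma continuous_on_torus_iff:
  "continuous_on UNIV f \<longleftrightarrow> continuous_on UNIV (\<lambda>w. f (torus_proj w))"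
  by (simp add: continuous_on_open_vimage open_torus_iff vimage_def)

lemma torus_bounded:
  fixes f :: "'n::finite torus \<Rightarrow> 'b::real_normed_vector"
  assumes "continuous_on UNIV f"
  obtains B where "B \<ge> 0" "\<And>x. norm (f x) \<le> B"
proof -
  have "continuous_on (cbox 0 1) (\<lambda>w. f (torus_proj w))"
    using assms unfolding continuous_on_torus_iff by (rule continuous_on_subset) simp
  then have "bounded ((\<lambda>w. f (torus_proj w)) ` cbox 0 1)"
    by (intro compact_imp_bounded compact_continuous_image) auto
  then obtain B where B: "B > 0" "\<And>w. w \<in> cbox 0 1 \<Longrightarrow> norm (f (torus_proj w)) \<le> B"
    unfolding bounded_pos by auto
  have "norm (f x) \<le> B" for x
    by (rule torus_cases_unit_cube[of x]) (use B in auto)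
  with B show thesis
    by (intro that[of B]) auto
qed

section \<open>Gradients of functions and velocities of curves\<close>

lemma GDERIV_unique: "GDERIV f x :> u \<Longrightarrow> GDERIV f x :> v \<Longrightarrow> u = v"
  unfolding gderiv_def by (metis has_derivative_unique vector_eq_ldot inner_commute)

lemma GDERIV_torus_shift:
  assumes "torus_proj z' = torus_proj z" "GDERIV (\<lambda>w. \<phi> (torus_proj w)) z :> v"
  shows "GDERIV (\<lambda>w. \<phi> (torus_proj w)) z' :> v"
proof -
  have eq: "torus_proj (w + (z - z')) = torus_proj w" for w
    using assms(1) unfolding torus_proj_eq_iff by (metis Ints_minus add_diff_cancel_left' minus_diff_eq vector_add_component vector_minus_component)
  have "((\<lambda>w. w + (z - z')) has_derivative (\<lambda>h. h)) (at z')"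
    by (auto intro!: derivative_eq_intros)
  moreover have "((\<lambda>w. \<phi> (torus_proj w)) has_derivative (\<lambda>h. h \<bullet> v)) (at (z' + (z - z')))"
    using assms(2) by (simp add: gderiv_def)
  ultimately have "((\<lambda>w. \<phi> (torus_proj (w + (z - z')))) has_derivative (\<lambda>h. h \<bullet> v)) (at z')"
    by (rule has_derivative_compose)
  then show ?thesis
    unfolding eq gderiv_def .
qed

lemma torus_grad_eqI:
  assumes "GDERIV (\<lambda>w. \<phi> (torus_proj w)) z :> v"
  shows "torus_grad \<phi> (torus_proj z) = v"
  unfolding torus_grad_def
proof (rule the_equality)
  show "\<forall>w. torus_proj w = torus_proj z \<longrightarrow> GDERIV (\<lambda>w. \<phi> (torus_proj w)) w :> v"
    using GDERIV_torus_shift[OF _ assms] by blast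
  show "u = v" if "\<forall>w. torus_proj w = torus_proj z \<longrightarrow> GDERIV (\<lambda>w. \<phi> (torus_proj w)) w :> u" for u
    using that assms GDERIV_unique by blast
qed

lemma torus_C1_GDERIV:
  assumes "\<phi> \<in> torus_C1"
  shows "GDERIV (\<lambda>w. \<phi> (torus_proj w)) z :> torus_grad \<phi> (torus_proj z)"
proof -
  have "(\<lambda>w. \<phi> (torus_proj w)) differentiable (at z)"
    using assms by (auto simp: torus_C1_def)
  then obtain D where D: "((\<lambda>w. \<phi> (torus_proj w)) has_derivative D) (at z)"
    by (auto simp: differentiable_def)
  then have lin: "linear D"
    using has_derivative_linear by blast
  \<comment> \<open>The adjoint of the functional \<open>D\<close> sends 1 to its Riesz
    vector.\<close>
  have "D h = h \<bullet> adjoint D 1" for h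
    using adjoint_works[OF lin, of h 1] by simp
  then have "D = (\<lambda>h. h \<bullet> adjoint D 1)"
    by auto
  then have "GDERIV (\<lambda>w. \<phi> (torus_proj w)) z :> adjoint D 1"
    using D by (simp add: gderiv_def)
  then show ?thesis
    using torus_grad_eqI by metis
qed

lemma torus_C1I:
  assumes "\<And>z. GDERIV (\<lambda>w. \<phi> (torus_proj w)) z :> G z" "continuous_on UNIV G"
  shows "\<phi> \<in> torus_C1"
  unfolding torus_C1_def
proof (intro CollectI conjI allI)
  show "(\<lambda>w. \<phi> (torus_proj w)) differentiable (at z)" for z
    using assms(1) by (auto simp: differentiable_def gderiv_def)
  show "continuous_on UNIV (torus_grad \<phi>)"
    using assms(2) unfolding continuous_on_torus_iff torus_grad_eqI[OF assms(1)] .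
qed

text \<open>Differentiability makes the difference \<delta> of two lifts continuous at
  \<open>s\<close> only, but that suffices: near \<open>s\<close> its values are integer vectors at
  distance less than 1 from \<open>\<delta> s\<close>, hence equal to it, and the derivative of
  \<delta> vanishes.\<close>

lemma torus_velocity_eqI:
  assumes "\<forall>\<^sub>F r in nhds s. c r = torus_proj (\<gamma> r)" "(\<gamma> has_vector_derivative v) (at s)"
  shows "torus_velocity c s = v"
  unfolding torus_velocity_def
proof (rule the_equality)
  show "\<exists>\<gamma>. (\<forall>\<^sub>F r in nhds s. c r = torus_proj (\<gamma> r)) \<and> (\<gamma> has_vector_derivative v) (at s)"
    using assms by blast
  fix v' assume "\<exists>\<gamma>. (\<forall>\<^sub>F r in nhds s. c r = torus_proj (\<gamma> r)) \<and> (\<gamma> has_vector_derivative v') (at s)"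
  then obtain \<gamma>' where \<gamma>': "\<forall>\<^sub>F r in nhds s. c r = torus_proj (\<gamma>' r)" "(\<gamma>' has_vector_derivative v') (at s)"
    by blast
  define \<delta> where "\<delta> = (\<lambda>r. \<gamma>' r - \<gamma> r)"
  have der: "(\<delta> has_vector_derivative (v' - v)) (at s)"
    unfolding \<delta>_def by (intro has_vector_derivative_diff assms \<gamma>')
  then have "continuous (at s) \<delta>"
    by (rule has_vector_derivative_continuous)
  then have "\<forall>\<^sub>F r in at s. dist (\<delta> r) (\<delta> s) < 1"
    unfolding continuous_at by (rule tendstoD) simp
  then have near: "\<forall>\<^sub>F r in nhds s. dist (\<delta> r) (\<delta> s) < 1"
    by (simp add: eventually_nhds_conv_at)
  have int: "\<forall>\<^sub>F r in nhds s. \<forall>i. \<delta> r $ i \<in> \<int>"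
    using assms(1) \<gamma>'(1) by eventually_elim (auto simp: \<delta>_def torus_proj_eq_iff)
  then have "\<forall>i. \<delta> s $ i \<in> \<int>"
    by (rule eventually_nhds_x_imp_x)
  from near int have "\<forall>\<^sub>F r in nhds s. \<delta> r = \<delta> s"
  proof eventually_elim
    case (elim r)
    show ?case
    proof (rule vec_eq_iff[THEN iffD2], rule allI)
      fix i
      have "\<bar>\<delta> r $ i - \<delta> s $ i\<bar> < 1"
        using elim(1) component_le_norm_cart[of "\<delta> r - \<delta> s" i] by (simp add: dist_norm)
      moreover have "\<delta> r $ i - \<delta> s $ i \<in> \<int>"
        using elim(2) \<open>\<forall>i. \<delta> s $ i \<in> \<int>\<close> by simp
      ultimately show "\<delta> r $ i = \<delta> s $ i"
        using Ints_nonzero_abs_less1 by fastforce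
    qed
  qed
  then have "(\<delta> has_vector_derivative 0) (at s)"
    by (subst has_vector_derivative_cong_ev[where g = "\<lambda>_. \<delta> s"]) (auto intro: eventually_nhds_x_imp_x)
  with der have "v' - v = 0"
    by (rule vector_derivative_unique_at)
  then show "v' = v"
    by simp
qed

lemma torus_AC_continuous_on: "torus_AC T c \<Longrightarrow> continuous_on {0..T} c"
  unfolding torus_AC_def
  by (metis abs_continuous_on_imp_continuous_on continuous_on_cong continuous_on_compose2[OF continuous_on_torus_proj[of UNIV]] subset_UNIV)

text \<open>The gradient is continuous and periodic, hence bounded. The Lipschitz bound makes \<phi>
  absolutely continuous along an absolutely continuous curve.\<close>

lemma torus_C1_lipschitz:
  assumes "\<phi> \<in> torus_C1"
  obtains B where "\<And>z w. dist (\<phi> (torus_proj z)) (\<phi> (torus_proj w)) \<le> B * dist z w"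
proof -
  obtain B where B: "B \<ge> 0" "\<And>x. norm (torus_grad \<phi> x) \<le> B"
    using torus_bounded[of "torus_grad \<phi>"] assms by (auto simp: torus_C1_def)
  have "norm (\<phi> (torus_proj z) - \<phi> (torus_proj w)) \<le> B * norm (z - w)" for z w
  proof (rule differentiable_bound[where S = UNIV and f' = "\<lambda>z h. h \<bullet> torus_grad \<phi> (torus_proj z)"])
    show "((\<lambda>w. \<phi> (torus_proj w)) has_derivative (\<lambda>h. h \<bullet> torus_grad \<phi> (torus_proj x))) (at x within UNIV)" for x
      using torus_C1_GDERIV[OF assms, of x] by (simp add: gderiv_def)
    show "onorm (\<lambda>h. h \<bullet> torus_grad \<phi> (torus_proj x)) \<le> B" for x
    proof (rule onorm_le)
      show "norm (h \<bullet> torus_grad \<phi> (torus_proj x)) \<le> B * norm h" for h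
      proof -
        have "norm (h \<bullet> torus_grad \<phi> (torus_proj x)) \<le> norm h * norm (torus_grad \<phi> (torus_proj x))"
          using Cauchy_Schwarz_ineq2 by auto
        also have "\<dots> \<le> norm h * B"
          using B by (intro mult_left_mono) auto
        finally show ?thesis
          by (simp add: mult.commute)
      qed
    qed
  qed auto
  then show thesis
    by (intro that[of B]) (simp add: dist_norm)
qed

lemma torus_curve_velocity:
  assumes \<gamma>: "abs_continuous_on 0 T \<gamma>" "\<And>s. s \<in> {0..T} \<Longrightarrow> c s = torus_proj (\<gamma> s)"
  obtains N where "negligible N" "\<And>s. s \<in> {0..T} - N \<Longrightarrow>
    s \<in> {0<..<T} \<and> (\<gamma> has_vector_derivative torus_velocity c s) (at s)"
proof (rule that)
  \<comment> \<open>The ends are put into the exceptional set because the velocity there also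
    depends on values of \<open>c\<close> outside the time interval.\<close>
  let ?N = "{s \<in> {0<..<T}. \<not> \<gamma> differentiable (at s)} \<union> {0, T}"
  show "negligible ?N"
    by (intro negligible_Un abs_continuous_on_negligible_nondifferentiable \<gamma>) auto
  fix s assume s: "s \<in> {0..T} - ?N"
  then have s': "s \<in> {0<..<T}" "\<gamma> differentiable (at s)"
    by auto
  then have der: "(\<gamma> has_vector_derivative vector_derivative \<gamma> (at s)) (at s)"
    using vector_derivative_works by blast
  have "\<forall>\<^sub>F r in nhds s. r \<in> {0<..<T}"
    using s'(1) by (intro eventually_nhds_in_open) auto
  then have "\<forall>\<^sub>F r in nhds s. c r = torus_proj (\<gamma> r)"
    by eventually_elim (auto intro: \<gamma>(2))
  then have "torus_velocity c s = vector_derivative \<gamma> (at s)"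
    using der by (rule torus_velocity_eqI)
  with der s' show "s \<in> {0<..<T} \<and> (\<gamma> has_vector_derivative torus_velocity c s) (at s)"
    by simp
qed

text \<open>Young's inequality \<open>v \<cdot> p \<le> |v|\<^sup>2/2 + |p|\<^sup>2/2\<close> with \<open>p = \<nabla>\<phi> + P\<close>, integrated along the curve.\<close>

lemma torus_curve_increment_le:
  fixes P :: "real^'n::finite"
  assumes c: "torus_AC T c" and "T > 0" and \<phi>: "\<phi> \<in> torus_C1"
    and fin: "(\<integral>\<^sup>+ s\<in>{0..T}. ennreal ((norm (torus_velocity c s - P))\<^sup>2 / 2) \<partial>lebesgue) < \<infinity>"
  shows "\<phi> (c T) - \<phi> (c 0) \<le>
     enn2real (\<integral>\<^sup>+ s\<in>{0..T}. ennreal ((norm (torus_velocity c s - P))\<^sup>2 / 2) \<partial>lebesgue)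
     + integral {0..T} (\<lambda>s. (norm (torus_grad \<phi> (c s) + P))\<^sup>2 / 2) - T * ((norm P)\<^sup>2 / 2)"
proof -
  obtain \<gamma> where \<gamma>: "abs_continuous_on 0 T \<gamma>" "\<And>s. s \<in> {0..T} \<Longrightarrow> c s = torus_proj (\<gamma> s)"
    using c unfolding torus_AC_def by blast
  obtain N where N: "negligible N" "\<And>s. s \<in> {0..T} - N \<Longrightarrow>
    s \<in> {0<..<T} \<and> (\<gamma> has_vector_derivative torus_velocity c s) (at s)"
    using torus_curve_velocity[of T \<gamma> c] \<gamma> by blast
  define k where "k = (\<lambda>s. (norm (torus_velocity c s - P))\<^sup>2 / 2)"
  define g where "g = (\<lambda>s. torus_grad \<phi> (c s))"
  have cont_c: "continuous_on {0..T} c"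
    by (rule torus_AC_continuous_on[OF c])
  \<comment> \<open>The velocity is defined by a description, which gives no measurability; here it
    follows from integrability.\<close>
  have "(torus_velocity c has_integral (\<gamma> T - \<gamma> 0)) {0..T}"
    using \<open>T > 0\<close> N(2) by (intro abs_continuous_on_has_integral_derivative[OF \<gamma>(1) _ N(1)])
      (auto intro: has_vector_derivative_at_within)
  then have "torus_velocity c \<in> borel_measurable (lebesgue_on {0..T})"
    by (intro integrable_imp_measurable has_integral_integrable)
  then have k_meas: "k \<in> borel_measurable (lebesgue_on {0..T})"
    unfolding k_def by (intro borel_measurable_divide borel_measurable_power borel_measurable_norm borel_measurable_diff) auto
  have nn: "(\<integral>\<^sup>+ s. ennreal (k s) \<partial>lebesgue_on {0..T}) =
     (\<integral>\<^sup>+ s\<in>{0..T}. ennreal ((norm (torus_velocity c s - P))\<^sup>2 / 2) \<partial>lebesgue)"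
    by (subst nn_integral_restrict_space) (auto simp: k_def)
  have k_int: "integrable (lebesgue_on {0..T}) k"
    using fin nn by (intro integrableI_nonneg k_meas) (auto simp: k_def)
  have "integral\<^sup>L (lebesgue_on {0..T}) k = enn2real (\<integral>\<^sup>+ s\<in>{0..T}. ennreal ((norm (torus_velocity c s - P))\<^sup>2 / 2) \<partial>lebesgue)"
    unfolding nn[symmetric] by (rule integral_eq_nn_integral[OF k_meas]) (simp add: k_def)
  then have k_has: "(k has_integral enn2real (\<integral>\<^sup>+ s\<in>{0..T}. ennreal ((norm (torus_velocity c s - P))\<^sup>2 / 2) \<partial>lebesgue)) {0..T}"
    using has_integral_integral_lebesgue_on[OF k_int] by simp
  have "continuous_on UNIV (torus_grad \<phi>)"
    using \<phi> by (simp add: torus_C1_def)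
  then have cont_g: "continuous_on {0..T} g"
    unfolding g_def by (rule continuous_on_compose2[OF _ cont_c]) auto
  then have "((\<lambda>s. (norm (g s + P))\<^sup>2 / 2) has_integral integral {0..T} (\<lambda>s. (norm (g s + P))\<^sup>2 / 2)) {0..T}"
    by (intro integrable_integral integrable_continuous_interval continuous_intros) auto
  note h_has = has_integral_add[OF k_has has_integral_diff[OF this has_integral_const_real[of "(norm P)\<^sup>2 / 2" 0 T]]]
  define f where "f = (\<lambda>s. \<phi> (torus_proj (\<gamma> s)))"
  obtain B where B: "\<And>z w. dist (\<phi> (torus_proj z)) (\<phi> (torus_proj w)) \<le> B * dist z w"
    using torus_C1_lipschitz[OF \<phi>] by blast
  have "abs_continuous_on 0 T f"
    by (rule abs_continuous_on_lipschitz_compose[OF \<gamma>(1), where C = B and D = 0]) (simp add: f_def B)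
  moreover have "(f has_vector_derivative (torus_velocity c s \<bullet> g s)) (at s within {0..T})"
    if s: "s \<in> {0..T} - N" for s
  proof -
    have "((\<lambda>w. \<phi> (torus_proj w)) has_derivative (\<lambda>h. h \<bullet> g s)) (at (\<gamma> s))"
      using torus_C1_GDERIV[OF \<phi>, of "\<gamma> s"] s \<gamma>(2) by (simp add: gderiv_def g_def)
    moreover have "(\<gamma> has_derivative (\<lambda>t. t *\<^sub>R torus_velocity c s)) (at s within {0..T})"
      using N(2)[OF s] has_vector_derivative_at_within unfolding has_vector_derivative_def[symmetric] by blast
    ultimately have "(f has_derivative (\<lambda>t. (t *\<^sub>R torus_velocity c s) \<bullet> g s)) (at s within {0..T})"
      unfolding f_def using has_derivative_compose by blast
    then show ?thesis
      by (simp add: has_vector_derivative_def)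
  qed
  ultimately have "((\<lambda>s. torus_velocity c s \<bullet> g s) has_integral (f T - f 0)) {0..T}"
    using \<open>T > 0\<close> by (intro abs_continuous_on_has_integral_derivative[OF _ _ N(1)]) auto
  then have "f T - f 0 \<le> enn2real (\<integral>\<^sup>+ s\<in>{0..T}. ennreal ((norm (torus_velocity c s - P))\<^sup>2 / 2) \<partial>lebesgue)
     + (integral {0..T} (\<lambda>s. (norm (g s + P))\<^sup>2 / 2) - (T - 0) *\<^sub>R ((norm P)\<^sup>2 / 2))"
  proof (rule has_integral_le)
    show "((\<lambda>s. k s + ((norm (g s + P))\<^sup>2 / 2 - (norm P)\<^sup>2 / 2)) has_integral
       (enn2real (\<integral>\<^sup>+ s\<in>{0..T}. ennreal ((norm (torus_velocity c s - P))\<^sup>2 / 2) \<partial>lebesgue)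
     + (integral {0..T} (\<lambda>s. (norm (g s + P))\<^sup>2 / 2) - (T - 0) *\<^sub>R ((norm P)\<^sup>2 / 2)))) {0..T}"
      using h_has \<open>T > 0\<close> by simp
    show "torus_velocity c s \<bullet> g s \<le> k s + ((norm (g s + P))\<^sup>2 / 2 - (norm P)\<^sup>2 / 2)" for s
    proof -
      have "k s + ((norm (g s + P))\<^sup>2 / 2 - (norm P)\<^sup>2 / 2) - torus_velocity c s \<bullet> g s
        = (norm (torus_velocity c s - g s - P))\<^sup>2 / 2"
        by (simp add: k_def power2_norm_eq_inner inner_diff_left inner_diff_right inner_add_left inner_add_right
            inner_commute field_simps)
      moreover have "(norm (torus_velocity c s - g s - P))\<^sup>2 / 2 \<ge> 0"
        by simp
      ultimately show ?thesis
        by linarith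
    qed
  qed
  then show ?thesis
    using \<open>T > 0\<close> by (simp add: f_def g_def \<gamma>(2))
qed

text \<open>The measure is the image, under the map from an index and a time to a point of a curve,
  of the product of the uniform distributions on the indices and on the time interval.\<close>

lemma occupation_measure_exists:
  fixes c :: "nat \<Rightarrow> real \<Rightarrow> 'n::finite torus"
  assumes "j \<ge> 1" "T > 0" and c: "\<And>i. i \<in> {1..j} \<Longrightarrow> continuous_on {0..T} (c i)"
  obtains \<mu> where "\<mu> \<in> borel_probs"
    "\<And>f :: 'n torus \<Rightarrow> real. continuous_on UNIV f \<Longrightarrow>
      (LINT x|\<mu>. f x) = (\<Sum>i=1..j. integral {0..T} (\<lambda>s. f (c i s))) / (real j * T)"
proof -
  define M1 where "M1 = measure_pmf (pmf_of_set {1..j})"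
  define M2 where "M2 = density lborel (\<lambda>s. ennreal (indicator {0..T} s / T))"
  \<comment> \<open>Index and time are clamped so that \<open>C\<close> is defined and continuous in
    time for all parameters; the values outside the given ranges carry no mass.\<close>
  define C where "C = (\<lambda>(i, s). c (if i \<in> {1..j} then i else 1) (min (max 0 s) T))"
  have cont: "continuous_on UNIV (\<lambda>s. C (i, s))" for i
  proof -
    have "continuous_on UNIV (\<lambda>s. c (if i \<in> {1..j} then i else 1) (min (max 0 s) T))"
      by (rule continuous_on_compose2[of "{0..T}"]) (use c \<open>j \<ge> 1\<close> \<open>T > 0\<close> in \<open>auto intro!: continuous_intros\<close>)
    then show ?thesis
      by (simp add: C_def)
  qed
  interpret M1: prob_space M1
    unfolding M1_def by (rule prob_space_measure_pmf)
  have "emeasure M2 (space M2) = 1"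
  proof -
    have "emeasure M2 (space M2) = (\<integral>\<^sup>+ s. ennreal (1 / T) * indicator {0..T} s \<partial>lborel)"
      unfolding M2_def by (subst emeasure_density) (auto intro!: nn_integral_cong simp: indicator_def)
    also have "\<dots> = ennreal (1 / T) * ennreal T"
      using \<open>T > 0\<close> by (subst nn_integral_cmult_indicator) auto
    also have "\<dots> = 1"
      using \<open>T > 0\<close> by (simp add: ennreal_mult[symmetric])
    finally show ?thesis .
  qed
  then interpret M2: prob_space M2
    by (rule prob_spaceI)
  interpret pair_prob_space M1 M2 ..
  have C_meas: "C \<in> M1 \<Otimes>\<^sub>M M2 \<rightarrow>\<^sub>M borel"
  proof -
    have "C \<in> count_space UNIV \<Otimes>\<^sub>M lborel \<rightarrow>\<^sub>M borel"
    proof (rule measurable_pair_measure_countable1)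
      show "(\<lambda>s. C (i, s)) \<in> lborel \<rightarrow>\<^sub>M borel" for i
        using borel_measurable_continuous_onI[OF cont] by simp
    qed simp
    moreover have "sets (M1 \<Otimes>\<^sub>M M2) = sets (count_space UNIV \<Otimes>\<^sub>M lborel)"
      by (rule sets_pair_measure_cong) (auto simp: M1_def M2_def)
    ultimately show ?thesis
      using measurable_cong_sets by blast
  qed
  define \<mu> where "\<mu> = distr (M1 \<Otimes>\<^sub>M M2) borel C"
  show thesis
  proof (rule that[of \<mu>])
    show "\<mu> \<in> borel_probs"
      unfolding borel_probs_def \<mu>_def using prob_space_distr[OF C_meas] by simp
    fix f :: "'n torus \<Rightarrow> real" assume f: "continuous_on UNIV f"
    obtain B where B: "\<And>x. norm (f x) \<le> B"
      using torus_bounded[OF f] by blast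
    have f_meas: "f \<in> borel_measurable borel"
      by (rule borel_measurable_continuous_onI[OF f])
    have fC: "(\<lambda>x. f (C x)) \<in> borel_measurable (M1 \<Otimes>\<^sub>M M2)"
      using measurable_compose[OF C_meas f_meas] .
    have "(LINT x|\<mu>. f x) = (LINT x|(M1 \<Otimes>\<^sub>M M2). f (C x))"
      unfolding \<mu>_def by (rule integral_distr[OF C_meas f_meas])
    also have "\<dots> = (LINT i|M1. LINT s|M2. f (C (i, s)))"
    proof (rule integral_fst'[symmetric])
      show "integrable (M1 \<Otimes>\<^sub>M M2) (\<lambda>x. f (C x))"
        by (rule integrable_const_bound[of _ B]) (use B fC in auto)
    qed
    also have "\<dots> = (\<Sum>i=1..j. LINT s|M2. f (C (i, s))) / real j"
      unfolding M1_def using \<open>j \<ge> 1\<close> by (subst integral_pmf_of_set) auto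
    also have "(\<Sum>i=1..j. LINT s|M2. f (C (i, s))) = (\<Sum>i=1..j. integral {0..T} (\<lambda>s. f (c i s)) / T)"
    proof (rule sum.cong[OF refl])
      fix i assume i: "i \<in> {1..j}"
      have "(LINT s|M2. f (C (i, s))) = (LINT s|lborel. (indicator {0..T} s / T) *\<^sub>R f (C (i, s)))"
        unfolding M2_def
        by (rule integral_density) (use measurable_compose[OF borel_measurable_continuous_onI[OF cont] f_meas] \<open>T > 0\<close> in auto)
      also have "\<dots> = (LINT s|lborel. (1 / T) * (indicator {0..T} s *\<^sub>R f (c i s)))"
        by (rule Bochner_Integration.integral_cong) (use i in \<open>auto simp: C_def indicator_def\<close>)
      also have "\<dots> = (1 / T) * (LINT s:{0..T}|lborel. f (c i s))"
        by (simp add: set_lebesgue_integral_def)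
      also have "(LINT s:{0..T}|lborel. f (c i s)) = integral {0..T} (\<lambda>s. f (c i s))"
        by (intro set_borel_integral_eq_integral(2) borel_integrable_atLeastAtMost' continuous_on_compose2[OF f c[OF i]]) auto
      finally show "(LINT s|M2. f (C (i, s))) = integral {0..T} (\<lambda>s. f (c i s)) / T"
        by simp
    qed
    finally show "(LINT x|\<mu>. f x) = (\<Sum>i=1..j. integral {0..T} (\<lambda>s. f (c i s))) / (real j * T)"
      by (simp add: sum_divide_distrib[symmetric] mult.commute)
  qed
qed

section \<open>The lower bound for \<open>D_cost\<close>\<close>

lemma zero_in_torus_C1: "(\<lambda>_. 0) \<in> (torus_C1 :: ('n::finite torus \<Rightarrow> real) set)"
  and torus_grad_zero: "torus_grad (\<lambda>_. 0 :: real) x = (0 :: real^'n::finite)"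
proof -
  have 0: "GDERIV (\<lambda>w::real^'n. (\<lambda>_. 0) (torus_proj w)) z :> 0" for z
    by (simp add: gderiv_def)
  show "(\<lambda>_. 0) \<in> (torus_C1 :: ('n torus \<Rightarrow> real) set)"
    by (rule torus_C1I[OF 0]) auto
  show "torus_grad (\<lambda>_. 0 :: real) x = (0 :: real^'n)"
    by (rule torus_cases[of x]) (use torus_grad_eqI[OF 0] in auto)
qed

lemma continuous_on_torus_energy:
  "\<phi> \<in> torus_C1 \<Longrightarrow> continuous_on UNIV (\<lambda>x. (norm (torus_grad \<phi> x + P))\<^sup>2)"
  unfolding torus_C1_def by (auto intro!: continuous_intros)

lemma integrable_borel_probs:
  fixes f :: "'n::finite torus \<Rightarrow> real"
  assumes "\<mu> \<in> borel_probs" "continuous_on UNIV f"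
  shows "integrable \<mu> f"
proof -
  interpret prob_space \<mu>
    using assms(1) by (simp add: borel_probs_def)
  have sets: "sets \<mu> = sets borel"
    using assms(1) by (simp add: borel_probs_def)
  obtain B where "\<And>x. norm (f x) \<le> B"
    using torus_bounded[OF assms(2)] by blast
  moreover have "f \<in> borel_measurable \<mu>"
    using borel_measurable_continuous_onI[OF assms(2)] measurable_cong_sets[OF sets refl] by blast
  ultimately show ?thesis
    by (intro integrable_const_bound) auto
qed

lemma integral_borel_probs_le:
  fixes f :: "'n::finite torus \<Rightarrow> real"
  assumes "\<mu> \<in> borel_probs" "continuous_on UNIV f" "\<And>x. f x \<le> C"
  shows "(LINT x|\<mu>. f x) \<le> C"
proof -
  interpret prob_space \<mu>
    using assms(1) by (simp add: borel_probs_def)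
  show ?thesis
    by (rule integral_le_const[OF integrable_borel_probs[OF assms(1,2)]]) (use assms(3) in auto)
qed

lemma F_func_le:
  assumes "\<mu> \<in> borel_probs" "\<phi> \<in> torus_C1"
  shows "F_func \<mu> P \<le> (LINT x|\<mu>. (norm (torus_grad \<phi> x + P))\<^sup>2 / 2)"
proof -
  have "(INF \<phi>\<in>torus_C1. LINT x|\<mu>. (norm (torus_grad \<phi> x + P))\<^sup>2) \<le> (LINT x|\<mu>. (norm (torus_grad \<phi> x + P))\<^sup>2)"
    by (rule cINF_lower[OF _ assms(2)]) (auto intro!: bdd_belowI2[of _ 0])
  then show ?thesis
    by (simp add: F_func_def)
qed

lemma F_func_ge:
  assumes "\<And>\<phi>. \<phi> \<in> torus_C1 \<Longrightarrow> C \<le> (LINT x|\<mu>. (norm (torus_grad \<phi> x + P))\<^sup>2 / 2)"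
  shows "C \<le> F_func \<mu> P"
proof -
  have "2 * C \<le> (INF \<phi>\<in>torus_C1. LINT x|\<mu>. (norm (torus_grad \<phi> x + P))\<^sup>2)"
    using assms zero_in_torus_C1 by (intro cINF_greatest) force+
  then show ?thesis
    by (simp add: F_func_def)
qed

lemma H_hat_ge:
  fixes \<Xi> :: "'n::finite torus \<Rightarrow> real"
  assumes \<Xi>: "continuous_on UNIV \<Xi>" and "\<mu> \<in> borel_probs"
  shows "(LINT x|\<mu>. \<Xi> x) + F_func \<mu> P \<le> H_hat \<Xi> P"
  unfolding H_hat_def
proof (rule cSUP_upper[OF assms(2)])
  obtain B where B: "\<And>x. norm (\<Xi> x) \<le> B"
    using torus_bounded[OF \<Xi>] by blast
  \<comment> \<open>The zero potential in the infimum defining \<open>F_func\<close> bounds every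
    competitor at once; without a bound the real supremum would carry no information.\<close>
  show "bdd_above ((\<lambda>\<mu>. (LINT x|\<mu>. \<Xi> x) + F_func \<mu> P) ` borel_probs)"
  proof (rule bdd_aboveI2)
    fix \<nu> :: "'n torus measure" assume \<nu>: "\<nu> \<in> borel_probs"
    have "(LINT x|\<nu>. \<Xi> x) \<le> B"
      using B by (intro integral_borel_probs_le[OF \<nu> \<Xi>]) (auto simp: abs_le_iff)
    moreover have "F_func \<nu> P \<le> (LINT x|\<nu>. (norm (torus_grad (\<lambda>_. 0) x + P))\<^sup>2 / 2)"
      by (rule F_func_le[OF \<nu> zero_in_torus_C1])
    moreover have "\<dots> \<le> (norm P)\<^sup>2 / 2"
      by (rule integral_borel_probs_le[OF \<nu>]) (auto simp: torus_grad_zero)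
    ultimately show "(LINT x|\<nu>. \<Xi> x) + F_func \<nu> P \<le> B + (norm P)\<^sup>2 / 2"
      by linarith
  qed
qed

text \<open>The same subsolution \<phi> is admissible in the infimum for every \<mu>, and
  integrating the pointwise inequality against a probability measure preserves \<open>C\<close>.
  This is the elementary half of the minimax duality.\<close>

lemma H_hat_le:
  fixes \<Xi> :: "'n::finite torus \<Rightarrow> real"
  assumes \<Xi>: "continuous_on UNIV \<Xi>" and \<phi>: "\<phi> \<in> torus_C1"
    and le: "\<And>x. (norm (torus_grad \<phi> x + P))\<^sup>2 / 2 + \<Xi> x \<le> C"
  shows "H_hat \<Xi> P \<le> C"
  unfolding H_hat_def
proof (rule cSUP_least)
  have "return borel undefined \<in> (borel_probs :: 'n torus measure set)"
    by (simp add: borel_probs_def prob_space_return)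
  then show "(borel_probs :: 'n torus measure set) \<noteq> {}"
    by blast
  fix \<mu> :: "'n torus measure" assume \<mu>: "\<mu> \<in> borel_probs"
  have cont: "continuous_on UNIV (\<lambda>x. (norm (torus_grad \<phi> x + P))\<^sup>2 / 2)"
    by (intro continuous_on_divide continuous_on_torus_energy \<phi>) auto
  have "(LINT x|\<mu>. \<Xi> x) + F_func \<mu> P \<le> (LINT x|\<mu>. \<Xi> x) + (LINT x|\<mu>. (norm (torus_grad \<phi> x + P))\<^sup>2 / 2)"
    using F_func_le[OF \<mu> \<phi>] by simp
  also have "\<dots> = (LINT x|\<mu>. \<Xi> x + (norm (torus_grad \<phi> x + P))\<^sup>2 / 2)"
    by (rule Bochner_Integration.integral_add[symmetric]) (intro integrable_borel_probs \<mu> \<Xi> cont)+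
  also have "\<dots> \<le> C"
    using le by (intro integral_borel_probs_le \<mu> continuous_on_add \<Xi> cont) (simp add: add.commute)
  finally show "(LINT x|\<mu>. \<Xi> x) + F_func \<mu> P \<le> C" .
qed

section \<open>The action and its lower bound\<close>

lemma torus_action_eq:
  fixes \<Xi> :: "'n::finite torus \<Rightarrow> real"
  assumes \<Xi>: "continuous_on UNIV \<Xi>" and c: "torus_AC T c"
  shows "torus_action \<Xi> P T c = ereal (1 / T) *
     (enn2ereal (\<integral>\<^sup>+ s\<in>{0..T}. ennreal ((norm (torus_velocity c s - P))\<^sup>2 / 2) \<partial>lebesgue)
      - ereal (integral {0..T} (\<lambda>s. \<Xi> (c s))))"
proof -
  have "continuous_on {0..T} (\<lambda>s. \<Xi> (c s))"
    by (rule continuous_on_compose2[OF \<Xi> torus_AC_continuous_on[OF c]]) auto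
  then have "(LINT s:{0..T}|lebesgue. \<Xi> (c s)) = integral {0..T} (\<lambda>s. \<Xi> (c s))"
    by (intro set_lebesgue_integral_eq_integral(2) absolutely_integrable_continuous_real)
  then show ?thesis
    by (simp add: torus_action_def)
qed

lemma torus_potential_integral_le:
  fixes \<Xi> :: "'n::finite torus \<Rightarrow> real"
  assumes \<Xi>: "continuous_on UNIV \<Xi>" and c: "torus_AC T c" and "T > 0" and B: "\<And>x. norm (\<Xi> x) \<le> B"
  shows "integral {0..T} (\<lambda>s. \<Xi> (c s)) \<le> T * B"
proof -
  have "continuous_on {0..T} (\<lambda>s. \<Xi> (c s))"
    by (rule continuous_on_compose2[OF \<Xi> torus_AC_continuous_on[OF c]]) auto
  then have "integral {0..T} (\<lambda>s. \<Xi> (c s)) \<le> integral {0..T} (\<lambda>s. B)"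
    using B by (intro integral_le integrable_continuous_interval) (auto simp: abs_le_iff)
  then show ?thesis
    using \<open>T > 0\<close> by simp
qed

text \<open>The kinetic part is nonnegative. The bound excludes the value minus infinity, so each
  cost in a sum is either real or plus infinity, and in the latter case the sum is infinite.\<close>

lemma A_cost_ge:
  fixes \<Xi> :: "'n::finite torus \<Rightarrow> real"
  assumes \<Xi>: "continuous_on UNIV \<Xi>" and "T > 0" and B: "\<And>x. norm (\<Xi> x) \<le> B"
  shows "ereal (- B) \<le> A_cost \<Xi> P y x T"
  unfolding A_cost_def
proof (rule INF_greatest)
  fix c assume "c \<in> {c. torus_AC T c \<and> c 0 = y \<and> c T = x}"
  then have c: "torus_AC T c" by simp
  let ?K = "\<integral>\<^sup>+ s\<in>{0..T}. ennreal ((norm (torus_velocity c s - P))\<^sup>2 / 2) \<partial>lebesgue"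
  have "ereal (- (T * B)) \<le> enn2ereal ?K - ereal (integral {0..T} (\<lambda>s. \<Xi> (c s)))"
  proof -
    have "ereal (- (T * B)) \<le> 0 - ereal (integral {0..T} (\<lambda>s. \<Xi> (c s)))"
      using torus_potential_integral_le[OF \<Xi> c \<open>T > 0\<close> B] by simp
    also have "\<dots> \<le> enn2ereal ?K - ereal (integral {0..T} (\<lambda>s. \<Xi> (c s)))"
      by (intro ereal_minus_mono) auto
    finally show ?thesis .
  qed
  then have "ereal (1 / T) * ereal (- (T * B)) \<le> torus_action \<Xi> P T c"
    unfolding torus_action_eq[OF \<Xi> c] using \<open>T > 0\<close> by (intro ereal_mult_left_mono) auto
  then show "ereal (- B) \<le> torus_action \<Xi> P T c"
    using \<open>T > 0\<close> by simp
qed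

lemma torus_action_real:
  fixes \<Xi> :: "'n::finite torus \<Rightarrow> real"
  assumes \<Xi>: "continuous_on UNIV \<Xi>" and c: "torus_AC T c" and "T > 0" and fin: "torus_action \<Xi> P T c < \<infinity>"
  shows "(\<integral>\<^sup>+ s\<in>{0..T}. ennreal ((norm (torus_velocity c s - P))\<^sup>2 / 2) \<partial>lebesgue) < \<infinity>"
    and "torus_action \<Xi> P T c = ereal ((enn2real (\<integral>\<^sup>+ s\<in>{0..T}. ennreal ((norm (torus_velocity c s - P))\<^sup>2 / 2) \<partial>lebesgue) - integral {0..T} (\<lambda>s. \<Xi> (c s))) / T)"
proof -
  let ?K = "\<integral>\<^sup>+ s\<in>{0..T}. ennreal ((norm (torus_velocity c s - P))\<^sup>2 / 2) \<partial>lebesgue"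
  have "?K \<noteq> \<infinity>"
  proof
    assume "?K = \<infinity>"
    then have "torus_action \<Xi> P T c = \<infinity>"
      unfolding torus_action_eq[OF \<Xi> c] using \<open>T > 0\<close> by simp
    with fin show False by simp
  qed
  then show "?K < \<infinity>"
    by (simp add: top.not_eq_extremum)
  then obtain k where k: "?K = ennreal k" "k \<ge> 0"
    by (cases ?K) auto
  then show "torus_action \<Xi> P T c = ereal ((enn2real ?K - integral {0..T} (\<lambda>s. \<Xi> (c s))) / T)"
    unfolding torus_action_eq[OF \<Xi> c] by (simp add: enn2ereal_ennreal)
qed

text \<open>The occupation measure of curves joining \<open>x\<^sub>i\<close> to \<open>x\<^sub>\<sigma>\<^sub>(\<^sub>i\<^sub>)\<close> is admissible for \<open>H_hat\<close>;
  the increments of a potential cancel in the sum because \<open>\<sigma>\<close> is a permutation.\<close>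

lemma H_hat_occupation:
  fixes \<Xi> :: "'n::finite torus \<Rightarrow> real" and c :: "nat \<Rightarrow> real \<Rightarrow> 'n torus"
  assumes \<Xi>: "continuous_on UNIV \<Xi>" and "T > 0" and "j \<ge> 1" and \<sigma>: "\<sigma> permutes {1..j}"
    and c: "\<And>i. i \<in> {1..j} \<Longrightarrow> torus_AC T (c i) \<and> c i 0 = x i \<and> c i T = x (\<sigma> i)"
    and fin: "\<And>i. i \<in> {1..j} \<Longrightarrow> torus_action \<Xi> P T (c i) = ereal (a i)"
  shows "(norm P)\<^sup>2 / 2 - H_hat \<Xi> P \<le> (\<Sum>i=1..j. a i) / real j"
proof -
  define k where "k = (\<lambda>i. enn2real (\<integral>\<^sup>+ s\<in>{0..T}. ennreal ((norm (torus_velocity (c i) s - P))\<^sup>2 / 2) \<partial>lebesgue))"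
  define I where "I = (\<lambda>i. integral {0..T} (\<lambda>s. \<Xi> (c i s)))"
  have a: "a i = (k i - I i) / T" if "i \<in> {1..j}" for i
    using torus_action_real(2)[OF \<Xi> _ \<open>T > 0\<close>, of "c i" P] c[OF that] fin[OF that] by (simp add: k_def I_def)
  have cont: "continuous_on {0..T} (c i)" if "i \<in> {1..j}" for i
    using c[OF that] torus_AC_continuous_on by blast
  obtain \<mu> where \<mu>: "\<mu> \<in> borel_probs"
    "\<And>f :: 'n torus \<Rightarrow> real. continuous_on UNIV f \<Longrightarrow>
      (LINT x|\<mu>. f x) = (\<Sum>i=1..j. integral {0..T} (\<lambda>s. f (c i s))) / (real j * T)"
    using occupation_measure_exists[of j T c] \<open>j \<ge> 1\<close> \<open>T > 0\<close> cont by blast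
  have jT: "real j * T > 0"
    using \<open>j \<ge> 1\<close> \<open>T > 0\<close> by simp
  have "(norm P)\<^sup>2 / 2 - (\<Sum>i=1..j. k i) / (real j * T) \<le> F_func \<mu> P"
  proof (rule F_func_ge)
    fix \<phi> :: "'n torus \<Rightarrow> real" assume \<phi>: "\<phi> \<in> torus_C1"
    define g where "g = (\<lambda>i. integral {0..T} (\<lambda>s. (norm (torus_grad \<phi> (c i s) + P))\<^sup>2 / 2))"
    have "(\<Sum>i=1..j. \<phi> (x (\<sigma> i)) - \<phi> (x i)) \<le> (\<Sum>i=1..j. k i + g i - T * ((norm P)\<^sup>2 / 2))"
    proof (rule sum_mono)
      fix i assume i: "i \<in> {1..j}"
      have "\<phi> (c i T) - \<phi> (c i 0) \<le> k i + g i - T * ((norm P)\<^sup>2 / 2)"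
        unfolding k_def g_def
        using c[OF i] fin[OF i] torus_action_real(1)[OF \<Xi> _ \<open>T > 0\<close>, of "c i" P]
        by (intro torus_curve_increment_le \<phi> \<open>T > 0\<close>) auto
      then show "\<phi> (x (\<sigma> i)) - \<phi> (x i) \<le> k i + g i - T * ((norm P)\<^sup>2 / 2)"
        using c[OF i] by simp
    qed
    moreover have "(\<Sum>i=1..j. \<phi> (x (\<sigma> i))) = (\<Sum>i=1..j. \<phi> (x i))"
      using sum.permute[OF \<sigma>, of "\<lambda>i. \<phi> (x i)"] by (simp add: o_def)
    ultimately have "real j * T * ((norm P)\<^sup>2 / 2) \<le> (\<Sum>i=1..j. k i) + (\<Sum>i=1..j. g i)"
      by (simp add: sum.distrib sum_subtractf)
    then have "(norm P)\<^sup>2 / 2 \<le> ((\<Sum>i=1..j. k i) + (\<Sum>i=1..j. g i)) / (real j * T)"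
      using jT by (simp add: pos_le_divide_eq mult.commute)
    moreover have "(LINT x|\<mu>. (norm (torus_grad \<phi> x + P))\<^sup>2 / 2) = (\<Sum>i=1..j. g i) / (real j * T)"
      unfolding g_def by (intro \<mu>(2) continuous_on_divide continuous_on_torus_energy \<phi>) auto
    ultimately show "(norm P)\<^sup>2 / 2 - (\<Sum>i=1..j. k i) / (real j * T) \<le> (LINT x|\<mu>. (norm (torus_grad \<phi> x + P))\<^sup>2 / 2)"
      unfolding add_divide_distrib by linarith
  qed
  moreover have "(LINT x|\<mu>. \<Xi> x) = (\<Sum>i=1..j. I i) / (real j * T)"
    unfolding I_def by (rule \<mu>(2)[OF \<Xi>])
  moreover have "(LINT x|\<mu>. \<Xi> x) + F_func \<mu> P \<le> H_hat \<Xi> P"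
    by (rule H_hat_ge[OF \<Xi> \<mu>(1)])
  ultimately have "(norm P)\<^sup>2 / 2 - H_hat \<Xi> P \<le> (\<Sum>i=1..j. k i) / (real j * T) - (\<Sum>i=1..j. I i) / (real j * T)"
    by linarith
  also have "\<dots> = ((\<Sum>i=1..j. k i - I i) / T) / real j"
    by (simp add: diff_divide_distrib[symmetric] sum_subtractf mult.commute)
  also have "(\<Sum>i=1..j. k i - I i) / T = (\<Sum>i=1..j. a i)"
    unfolding sum_divide_distrib by (rule sum.cong) (use a in auto)
  finally show ?thesis .
qed

text \<open>Each choice of points and permutation is estimated separately by the occupation measure
  of its curves, so the bound already holds at every finite \<open>j\<close>.\<close>

theorem D_cost_ge:
  fixes \<Xi> :: "'n::finite torus \<Rightarrow> real"
  assumes \<Xi>: "continuous_on UNIV \<Xi>" and "T > 0" and "j \<ge> 1"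
  shows "ereal ((norm P)\<^sup>2 / 2 - H_hat \<Xi> P) \<le> D_cost P T j \<Xi>"
  unfolding D_cost_def
proof (rule INF_greatest)
  fix x :: "nat \<Rightarrow> 'n torus"
  let ?S = "{\<sigma>. \<sigma> permutes {1..j}}"
  have "finite ?S"
    by (rule finite_permutations) simp
  moreover have "?S \<noteq> {}"
    using permutes_id by blast
  moreover have "ereal ((norm P)\<^sup>2 / 2 - H_hat \<Xi> P) \<le> ereal (1 / real j) * (\<Sum>i=1..j. A_cost \<Xi> P (x i) (x (\<sigma> i)) T)"
    if \<sigma>: "\<sigma> \<in> ?S" for \<sigma>
  proof -
    obtain B where B: "\<And>x. norm (\<Xi> x) \<le> B"
      using torus_bounded[OF \<Xi>] by blast
    define A where "A = (\<lambda>i. A_cost \<Xi> P (x i) (x (\<sigma> i)) T)"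
    have A_ge: "ereal (- B) \<le> A i" for i
      unfolding A_def by (rule A_cost_ge[OF \<Xi> \<open>T > 0\<close> B])
    show ?thesis
    proof (cases "\<exists>i\<in>{1..j}. A i = \<infinity>")
      case True
      then have "(\<Sum>i=1..j. A i) = \<infinity>"
        by (simp add: sum_Pinfty)
      then show ?thesis
        unfolding A_def using \<open>j \<ge> 1\<close> by simp
    next
      case False
      have fin: "\<exists>r. A i = ereal r" if "i \<in> {1..j}" for i
        using False that A_ge[of i] by (cases "A i") auto
      then obtain r where r: "\<And>i. i \<in> {1..j} \<Longrightarrow> A i = ereal (r i)"
        by metis
      \<comment> \<open>Minimising curves are not claimed to exist; each cost is approached within
        \<open>e\<close> by a curve of finite action.\<close>
      have "(norm P)\<^sup>2 / 2 - H_hat \<Xi> P \<le> (\<Sum>i=1..j. r i) / real j + e" if "e > 0" for e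
      proof -
        have "\<exists>c. torus_AC T c \<and> c 0 = x i \<and> c T = x (\<sigma> i) \<and> (\<exists>a. torus_action \<Xi> P T c = ereal a \<and> a \<le> r i + e)"
          if i: "i \<in> {1..j}" for i
        proof -
          have "A i < ereal (r i + e)"
            using r[OF i] \<open>e > 0\<close> by simp
          then obtain c where c: "torus_AC T c" "c 0 = x i" "c T = x (\<sigma> i)" "torus_action \<Xi> P T c < ereal (r i + e)"
            unfolding A_def A_cost_def INF_less_iff by blast
          have "torus_action \<Xi> P T c < \<infinity>"
            using c(4) by (rule less_trans) simp
          from torus_action_real(2)[OF \<Xi> c(1) \<open>T > 0\<close> this] obtain a where "torus_action \<Xi> P T c = ereal a"
            by blast
          then show ?thesis
            using c by (intro exI[of _ c]) auto
        qed
        then obtain c a where c: "\<And>i. i \<in> {1..j} \<Longrightarrow> torus_AC T (c i) \<and> c i 0 = x i \<and> c i T = x (\<sigma> i) \<and>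
             torus_action \<Xi> P T (c i) = ereal (a i) \<and> a i \<le> r i + e"
          by metis
        have "(norm P)\<^sup>2 / 2 - H_hat \<Xi> P \<le> (\<Sum>i=1..j. a i) / real j"
          by (rule H_hat_occupation[OF \<Xi> \<open>T > 0\<close> \<open>j \<ge> 1\<close>, of \<sigma> c x]) (use \<sigma> c in auto)
        also have "\<dots> \<le> (\<Sum>i=1..j. r i + e) / real j"
          using c by (intro divide_right_mono sum_mono) auto
        also have "\<dots> = (\<Sum>i=1..j. r i) / real j + e"
          using \<open>j \<ge> 1\<close> by (simp add: sum.distrib add_divide_distrib)
        finally show ?thesis .
      qed
      then have "(norm P)\<^sup>2 / 2 - H_hat \<Xi> P \<le> (\<Sum>i=1..j. r i) / real j"
        by (rule field_le_epsilon)
      moreover have "(\<Sum>i=1..j. A i) = ereal (\<Sum>i=1..j. r i)"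
        using r by simp
      ultimately show ?thesis
        unfolding A_def by simp
    qed
  qed
  ultimately show "ereal ((norm P)\<^sup>2 / 2 - H_hat \<Xi> P) \<le>
      (MIN \<sigma>\<in>?S. ereal (1 / real j) * (\<Sum>i=1..j. A_cost \<Xi> P (x i) (x (\<sigma> i)) T))"
    by (subst Min_ge_iff) auto
qed

section \<open>Chains of segments\<close>

text \<open>Mean action over the time step \<open>\<tau>\<close> of the straight segment from \<open>y\<close> to \<open>z\<close>, for a potential
  \<open>X\<close> on R^n.\<close>

definition seg_cost :: "(real^'n \<Rightarrow> real) \<Rightarrow> real^'n \<Rightarrow> real \<Rightarrow> real^'n \<Rightarrow> real^'n \<Rightarrow> real" where
  "seg_cost X P \<tau> y z = (norm ((1 / \<tau>) *\<^sub>R (z - y) - P))\<^sup>2 / 2 - integral {0..1} (\<lambda>\<theta>. X (y + \<theta> *\<^sub>R (z - y)))"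

section \<open>Piecewise linear curves\<close>

lemma has_integral_combine_uniform:
  fixes f :: "real \<Rightarrow> 'a::banach"
  assumes "\<tau> \<ge> 0" "\<And>i. i < N \<Longrightarrow> (f has_integral I i) {real i * \<tau>..real (Suc i) * \<tau>}"
  shows "(f has_integral (\<Sum>i<N. I i)) {0..real N * \<tau>}"
  using assms(2)
proof (induction N)
  case 0
  then show ?case by (simp add: has_integral_refl)
next
  case (Suc N)
  have "(f has_integral ((\<Sum>i<N. I i) + I N)) {0..real (Suc N) * \<tau>}"
  proof (rule has_integral_combine)
    show "0 \<le> real N * \<tau>" "real N * \<tau> \<le> real (Suc N) * \<tau>"
      using assms(1) by (auto intro: mult_right_mono)
    show "(f has_integral (\<Sum>i<N. I i)) {0..real N * \<tau>}"
      using Suc by simp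
    show "(f has_integral I N) {real N * \<tau>..real (Suc N) * \<tau>}"
      using Suc.prems by blast
  qed
  then show ?case by simp
qed

text \<open>Each increment is switched on by a clamped ramp on its own time slot. In this form the
  curve is defined for all times and its Lipschitz bound follows term by term, without cases at the
  nodes; outside the \<open>N\<close> slots it is constant.\<close>

definition polygon :: "(nat \<Rightarrow> real^'n) \<Rightarrow> real \<Rightarrow> nat \<Rightarrow> real \<Rightarrow> real^'n" where
  "polygon z \<tau> N s = z 0 + (\<Sum>i<N. max 0 (min 1 (s / \<tau> - real i)) *\<^sub>R (z (Suc i) - z i))"

lemma polygon_eq:
  assumes "\<tau> > 0" "k < N" and s: "s \<in> {real k * \<tau>..real (Suc k) * \<tau>}"
  shows "polygon z \<tau> N s = z k + (s / \<tau> - real k) *\<^sub>R (z (Suc k) - z k)"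
proof -
  have st: "real k \<le> s / \<tau>" "s / \<tau> \<le> real (Suc k)"
    using s \<open>\<tau> > 0\<close> by (auto simp: field_simps)
  have "(\<Sum>i<N. max 0 (min 1 (s / \<tau> - real i)) *\<^sub>R (z (Suc i) - z i))
      = (\<Sum>i<Suc k. max 0 (min 1 (s / \<tau> - real i)) *\<^sub>R (z (Suc i) - z i))"
  proof (rule sum.mono_neutral_right)
    show "\<forall>i\<in>{..<N} - {..<Suc k}. max 0 (min 1 (s / \<tau> - real i)) *\<^sub>R (z (Suc i) - z i) = 0"
      using st by auto
  qed (use \<open>k < N\<close> in auto)
  also have "\<dots> = (\<Sum>i<k. max 0 (min 1 (s / \<tau> - real i)) *\<^sub>R (z (Suc i) - z i)) + (s / \<tau> - real k) *\<^sub>R (z (Suc k) - z k)"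
    using st by (simp add: max_def min_def)
  also have "(\<Sum>i<k. max 0 (min 1 (s / \<tau> - real i)) *\<^sub>R (z (Suc i) - z i)) = (\<Sum>i<k. z (Suc i) - z i)"
  proof (rule sum.cong[OF refl])
    fix i assume "i \<in> {..<k}"
    then have "real (Suc i) \<le> real k"
      by (intro of_nat_mono) auto
    then have "max 0 (min 1 (s / \<tau> - real i)) = 1"
      using st by simp
    then show "max 0 (min 1 (s / \<tau> - real i)) *\<^sub>R (z (Suc i) - z i) = z (Suc i) - z i"
      by simp
  qed
  also have "\<dots> = z k - z 0"
    by (rule sum_lessThan_telescope)
  finally show ?thesis
    by (simp add: polygon_def)
qed

lemma polygon_lipschitz:
  assumes "\<tau> > 0"
  shows "((\<Sum>i<N. norm (z (Suc i) - z i)) / \<tau>)-lipschitz_on UNIV (polygon z \<tau> N)"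
proof (rule lipschitz_onI)
  show "0 \<le> (\<Sum>i<N. norm (z (Suc i) - z i)) / \<tau>"
    using assms by (simp add: sum_nonneg)
  fix s t :: real
  let ?c = "\<lambda>s i. max 0 (min 1 (s / \<tau> - real i))"
  have clamp: "\<bar>?c s i - ?c t i\<bar> \<le> \<bar>s - t\<bar> / \<tau>" for i
  proof -
    have "\<bar>?c s i - ?c t i\<bar> \<le> \<bar>s / \<tau> - t / \<tau>\<bar>"
      by (auto simp: max_def min_def)
    also have "\<dots> = \<bar>s - t\<bar> / \<tau>"
      using assms by (simp add: diff_divide_distrib[symmetric])
    finally show ?thesis .
  qed
  have "dist (polygon z \<tau> N s) (polygon z \<tau> N t) = norm (\<Sum>i<N. (?c s i - ?c t i) *\<^sub>R (z (Suc i) - z i))"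
    by (simp add: polygon_def dist_norm sum_subtractf scaleR_left_diff_distrib)
  also have "\<dots> \<le> (\<Sum>i<N. \<bar>s - t\<bar> / \<tau> * norm (z (Suc i) - z i))"
    by (intro sum_norm_le) (unfold norm_scaleR, intro mult_right_mono clamp norm_ge_zero)
  also have "\<dots> = (\<Sum>i<N. norm (z (Suc i) - z i)) / \<tau> * dist s t"
    unfolding sum_distrib_left[symmetric] by (simp add: dist_real_def)
  finally show "dist (polygon z \<tau> N s) (polygon z \<tau> N t) \<le> (\<Sum>i<N. norm (z (Suc i) - z i)) / \<tau> * dist s t" .
qed

lemma torus_velocity_polygon:
  assumes "\<tau> > 0" "k < N" "s \<in> {real k * \<tau><..<real (Suc k) * \<tau>}"
  shows "torus_velocity (\<lambda>s. torus_proj (polygon z \<tau> N s)) s = (1 / \<tau>) *\<^sub>R (z (Suc k) - z k)"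
proof (rule torus_velocity_eqI)
  let ?\<gamma> = "\<lambda>s. z k + (s / \<tau> - real k) *\<^sub>R (z (Suc k) - z k)"
  have "\<forall>\<^sub>F r in nhds s. r \<in> {real k * \<tau><..<real (Suc k) * \<tau>}"
    using assms(3) by (intro eventually_nhds_in_open) auto
  then show "\<forall>\<^sub>F r in nhds s. torus_proj (polygon z \<tau> N r) = torus_proj (?\<gamma> r)"
    by eventually_elim (subst polygon_eq[OF assms(1,2)], auto)
  show "(?\<gamma> has_vector_derivative (1 / \<tau>) *\<^sub>R (z (Suc k) - z k)) (at s)"
    using assms(1) by (auto intro!: derivative_eq_intros)
qed

lemma has_integral_polygon_piece:
  fixes f :: "real^'n \<Rightarrow> real"
  assumes "\<tau> > 0" "k < N" and f: "continuous_on UNIV f"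
  shows "((\<lambda>s. f (polygon z \<tau> N s)) has_integral
    \<tau> * integral {0..1} (\<lambda>\<theta>. f (z k + \<theta> *\<^sub>R (z (Suc k) - z k)))) {real k * \<tau>..real (Suc k) * \<tau>}"
proof -
  let ?h = "\<lambda>\<theta>. f (z k + \<theta> *\<^sub>R (z (Suc k) - z k))"
  have "continuous_on {0..1} ?h"
    by (intro continuous_on_compose2[OF f] continuous_intros) auto
  then have "(?h has_integral integral {0..1} ?h) (cbox 0 1)"
    by (simp add: integrable_continuous_interval integrable_integral)
  from has_integral_affinity[OF this, of "1 / \<tau>" "- real k"]
  have "((\<lambda>s. ?h ((1 / \<tau>) *\<^sub>R s + - real k)) has_integral \<tau> * integral {0..1} ?h)
      ((\<lambda>x. (1 / (1 / \<tau>)) *\<^sub>R x + - ((1 / (1 / \<tau>)) *\<^sub>R (- real k))) ` cbox 0 1)"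
    using \<open>\<tau> > 0\<close> by simp
  also have "(\<lambda>x. (1 / (1 / \<tau>)) *\<^sub>R x + - ((1 / (1 / \<tau>)) *\<^sub>R (- real k))) ` cbox 0 1 = {real k * \<tau>..real (Suc k) * \<tau>}"
    using \<open>\<tau> > 0\<close> image_affinity_atLeastAtMost[of \<tau> "\<tau> * real k" 0 1] by (simp add: algebra_simps)
  finally show ?thesis
    by (rule has_integral_eq[rotated]) (simp add: polygon_eq[OF assms(1,2)])
qed

text \<open>The polygon through the nodes, run with time step \<open>T / N\<close>, is a competitor.
  Its velocity is constant on each slot, so the action is exactly the mean of the segment
  costs.\<close>

lemma A_cost_le_chain:
  fixes \<Xi> :: "'n::finite torus \<Rightarrow> real"
  assumes \<Xi>: "continuous_on UNIV \<Xi>" and "T > 0" and "N \<ge> 1"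
  shows "A_cost \<Xi> P (torus_proj (z 0)) (torus_proj (z N)) T \<le>
    ereal ((\<Sum>i<N. seg_cost (\<lambda>w. \<Xi> (torus_proj w)) P (T / real N) (z i) (z (Suc i))) / real N)"
proof -
  define \<tau> where "\<tau> = T / real N"
  define X where "X = (\<lambda>w. \<Xi> (torus_proj w))"
  have "\<tau> > 0" and N\<tau>: "real N * \<tau> = T"
    using \<open>T > 0\<close> \<open>N \<ge> 1\<close> by (auto simp: \<tau>_def)
  have X: "continuous_on UNIV X"
    using \<Xi> unfolding X_def by (simp add: continuous_on_torus_iff)
  define c where "c = (\<lambda>s. torus_proj (polygon z \<tau> N s))"
  have "torus_AC T c"
    unfolding torus_AC_def c_def
    using lipschitz_imp_abs_continuous_on[OF lipschitz_on_subset[OF polygon_lipschitz[OF \<open>\<tau> > 0\<close>]]] by blast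
  moreover have "c 0 = torus_proj (z 0)"
    using polygon_eq[of \<tau> 0 N 0 z] \<open>\<tau> > 0\<close> \<open>N \<ge> 1\<close> by (simp add: c_def)
  moreover have "c T = torus_proj (z N)"
  proof -
    obtain M where M: "N = Suc M"
      using \<open>N \<ge> 1\<close> by (cases N) auto
    have "T / \<tau> = 1 + real M"
      using N\<tau> \<open>\<tau> > 0\<close> by (simp add: M nonzero_divide_eq_eq)
    moreover have "real M * \<tau> \<le> T" "T \<le> real (Suc M) * \<tau>"
      using N\<tau> \<open>\<tau> > 0\<close> unfolding M by (auto simp: algebra_simps)
    ultimately show ?thesis
      using polygon_eq[of \<tau> M N T z] \<open>\<tau> > 0\<close> by (simp add: c_def M)
  qed
  ultimately have le: "A_cost \<Xi> P (torus_proj (z 0)) (torus_proj (z N)) T \<le> torus_action \<Xi> P T c"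
    unfolding A_cost_def by (intro INF_lower) auto
  define kin where "kin = (\<lambda>i. (norm ((1 / \<tau>) *\<^sub>R (z (Suc i) - z i) - P))\<^sup>2 / 2)"
  define pot where "pot = (\<lambda>i. integral {0..1} (\<lambda>\<theta>. X (z i + \<theta> *\<^sub>R (z (Suc i) - z i))))"
  have kin: "((\<lambda>s. (norm (torus_velocity c s - P))\<^sup>2 / 2) has_integral (\<Sum>i<N. \<tau> * kin i)) {0..real N * \<tau>}"
  proof (rule has_integral_combine_uniform)
    fix i assume "i < N"
    have "((\<lambda>s. kin i) has_integral \<tau> * kin i) {real i * \<tau>..real (Suc i) * \<tau>}"
      using has_integral_const_real[of "kin i" "real i * \<tau>" "real (Suc i) * \<tau>"] \<open>\<tau> > 0\<close>
      by (simp add: algebra_simps)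
    then show "((\<lambda>s. (norm (torus_velocity c s - P))\<^sup>2 / 2) has_integral \<tau> * kin i) {real i * \<tau>..real (Suc i) * \<tau>}"
    proof (rule has_integral_spike_finite[of "{real i * \<tau>, real (Suc i) * \<tau>}", rotated 2])
      show "(norm (torus_velocity c s - P))\<^sup>2 / 2 = kin i"
        if "s \<in> {real i * \<tau>..real (Suc i) * \<tau>} - {real i * \<tau>, real (Suc i) * \<tau>}" for s
      proof -
        have "s \<in> {real i * \<tau><..<real (Suc i) * \<tau>}"
          using that by auto
        then show ?thesis
          unfolding c_def by (subst torus_velocity_polygon[OF \<open>\<tau> > 0\<close> \<open>i < N\<close>]) (auto simp: kin_def)
      qed
    qed simp
  qed (use \<open>\<tau> > 0\<close> in simp)
  have pot: "((\<lambda>s. \<Xi> (c s)) has_integral (\<Sum>i<N. \<tau> * pot i)) {0..real N * \<tau>}"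
  proof (rule has_integral_combine_uniform)
    show "((\<lambda>s. \<Xi> (c s)) has_integral \<tau> * pot i) {real i * \<tau>..real (Suc i) * \<tau>}" if "i < N" for i
      using has_integral_polygon_piece[OF \<open>\<tau> > 0\<close> that X] by (simp add: c_def X_def pot_def)
  qed (use \<open>\<tau> > 0\<close> in simp)
  have "(\<integral>\<^sup>+ s\<in>{0..T}. ennreal ((norm (torus_velocity c s - P))\<^sup>2 / 2) \<partial>lebesgue)
      = (\<integral>\<^sup>+ s. ennreal (indicator {0..T} s * ((norm (torus_velocity c s - P))\<^sup>2 / 2)) \<partial>lborel)"
    unfolding nn_integral_completion by (intro nn_integral_cong) (auto simp: indicator_def)
  also have "\<dots> = ennreal (\<Sum>i<N. \<tau> * kin i)"
    using kin unfolding N\<tau> by (intro nn_integral_has_integral_lebesgue) auto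
  finally have K: "(\<integral>\<^sup>+ s\<in>{0..T}. ennreal ((norm (torus_velocity c s - P))\<^sup>2 / 2) \<partial>lebesgue) = ennreal (\<Sum>i<N. \<tau> * kin i)" .
  have "(\<Sum>i<N. \<tau> * kin i) \<ge> 0"
    using \<open>\<tau> > 0\<close> by (intro sum_nonneg) (auto simp: kin_def)
  then have "torus_action \<Xi> P T c = ereal (((\<Sum>i<N. \<tau> * kin i) - (\<Sum>i<N. \<tau> * pot i)) / T)"
    unfolding torus_action_eq[OF \<Xi> \<open>torus_AC T c\<close>] K
    using integral_unique[OF pot] by (simp add: N\<tau> enn2ereal_ennreal)
  also have "((\<Sum>i<N. \<tau> * kin i) - (\<Sum>i<N. \<tau> * pot i)) / T = (\<Sum>i<N. kin i - pot i) / real N"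
  proof -
    have "(\<Sum>i<N. \<tau> * kin i) = \<tau> * sum kin {..<N}" "(\<Sum>i<N. \<tau> * pot i) = \<tau> * sum pot {..<N}"
      by (simp_all add: sum_distrib_left)
    then show ?thesis
      using \<open>T > 0\<close> \<open>N \<ge> 1\<close> by (simp add: sum_subtractf \<tau>_def field_simps)
  qed
  also have "(\<Sum>i<N. kin i - pot i) = (\<Sum>i<N. seg_cost X P \<tau> (z i) (z (Suc i)))"
    by (simp add: seg_cost_def kin_def pot_def)
  finally show ?thesis
    using le by (simp add: X_def \<tau>_def)
qed

section \<open>Closed chains as competitors for \<open>D_cost\<close>\<close>

lemma seg_cost_translate:
  assumes "\<And>x. X (x + w) = X x"
  shows "seg_cost X P \<tau> (y + w) (z + w) = seg_cost X P \<tau> y z"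
proof -
  have "X (y + w + v) = X (y + v)" for v
    using assms[of "y + v"] by (simp add: ac_simps)
  then show ?thesis
    by (simp add: seg_cost_def)
qed

text \<open>Cut the closed chain into \<open>j\<close> blocks of \<open>N\<close> segments, each
  lasting time \<open>T\<close>. The points are the block starts, numbered from 1, and the
  permutation is the cyclic shift; its last step returns to the first point because the chain closes
  on the torus.\<close>

lemma D_cost_le_chain:
  fixes \<Xi> :: "'n::finite torus \<Rightarrow> real"
  assumes \<Xi>: "continuous_on UNIV \<Xi>" and "T > 0" and "N \<ge> 1" and "j \<ge> 1"
    and closed: "torus_proj (z (j * N)) = torus_proj (z 0)"
  shows "D_cost P T j \<Xi> \<le>
    ereal ((\<Sum>i<j * N. seg_cost (\<lambda>w. \<Xi> (torus_proj w)) P (T / real N) (z i) (z (Suc i))) / (real j * real N))"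
proof -
  define S where "S = (\<lambda>i. seg_cost (\<lambda>w. \<Xi> (torus_proj w)) P (T / real N) (z i) (z (Suc i)))"
  define x where "x = (\<lambda>b. torus_proj (z ((b - 1) * N)))"
  define \<sigma> where "\<sigma> = (\<lambda>b. if b \<in> {1..<j} then Suc b else if b = j then 1 else b)"
  have \<sigma>: "\<sigma> permutes {1..j}"
  proof (rule bij_imp_permutes)
    show "bij_betw \<sigma> {1..j} {1..j}"
      by (rule bij_betw_byWitness[where f' = "\<lambda>b. if b = 1 then j else b - 1"])
         (use \<open>j \<ge> 1\<close> in \<open>auto simp: \<sigma>_def\<close>)
    show "\<sigma> b = b" if "b \<notin> {1..j}" for b
      using that \<open>j \<ge> 1\<close> by (auto simp: \<sigma>_def)
  qed
  have x\<sigma>: "x (\<sigma> b) = torus_proj (z (b * N))" if "b \<in> {1..j}" for b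
    using that closed by (auto simp: x_def \<sigma>_def)
  have block: "A_cost \<Xi> P (x b) (x (\<sigma> b)) T \<le> ereal ((\<Sum>i\<in>{(b - 1) * N..<(b - 1) * N + N}. S i) / real N)"
    if b: "b \<in> {1..j}" for b
  proof -
    have "b * N = (b - 1) * N + N"
      using b by (cases b) auto
    then have "A_cost \<Xi> P (x b) (x (\<sigma> b)) T \<le> ereal ((\<Sum>i<N. S ((b - 1) * N + i)) / real N)"
      using A_cost_le_chain[OF \<Xi> \<open>T > 0\<close> \<open>N \<ge> 1\<close>, of P "\<lambda>i. z ((b - 1) * N + i)"] x\<sigma>[OF b]
      by (simp add: x_def S_def)
    also have "(\<Sum>i<N. S ((b - 1) * N + i)) = (\<Sum>i\<in>{(b - 1) * N..<(b - 1) * N + N}. S i)"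
      using sum.shift_bounds_nat_ivl[of S 0 "(b - 1) * N" N] by (simp add: atLeast0LessThan add.commute)
    finally show ?thesis .
  qed
  have "(\<Sum>b=1..j. A_cost \<Xi> P (x b) (x (\<sigma> b)) T) \<le> (\<Sum>b=1..j. ereal ((\<Sum>i\<in>{(b - 1) * N..<(b - 1) * N + N}. S i) / real N))"
    by (rule sum_mono) (rule block)
  also have "\<dots> = ereal ((\<Sum>b=1..j. \<Sum>i\<in>{(b - 1) * N..<(b - 1) * N + N}. S i) / real N)"
    by (simp add: sum_divide_distrib)
  also have "(\<Sum>b=1..j. \<Sum>i\<in>{(b - 1) * N..<(b - 1) * N + N}. S i) = (\<Sum>m<j. \<Sum>i\<in>{m * N..<m * N + N}. S i)"
    by (rule sum.reindex_bij_witness[where i = Suc and j = "\<lambda>b. b - 1"]) auto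
  also have "\<dots> = (\<Sum>i<j * N. S i)"
    by (rule sum.nat_group)
  finally have "ereal (1 / real j) * (\<Sum>b=1..j. A_cost \<Xi> P (x b) (x (\<sigma> b)) T) \<le> ereal (1 / real j) * ereal ((\<Sum>i<j * N. S i) / real N)"
    by (rule ereal_mult_left_mono) simp
  also have "\<dots> = ereal ((\<Sum>i<j * N. S i) / (real j * real N))"
    by simp
  finally have bound: "ereal (1 / real j) * (\<Sum>b=1..j. A_cost \<Xi> P (x b) (x (\<sigma> b)) T) \<le> ereal ((\<Sum>i<j * N. S i) / (real j * real N))" .
  have "D_cost P T j \<Xi> \<le> (MIN \<sigma>\<in>{\<sigma>. \<sigma> permutes {1..j}}. ereal (1 / real j) * (\<Sum>i=1..j. A_cost \<Xi> P (x i) (x (\<sigma> i)) T))"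
    unfolding D_cost_def by (rule INF_lower) simp
  also have "\<dots> \<le> ereal (1 / real j) * (\<Sum>b=1..j. A_cost \<Xi> P (x b) (x (\<sigma> b)) T)"
    by (rule Min_le) (use \<sigma> in \<open>auto intro!: finite_imageI finite_permutations\<close>)
  also note bound
  finally show ?thesis
    by (simp add: S_def)
qed

text \<open>Run through the loop as often as the time \<open>jT\<close> allows, then wait.\<close>

lemma D_cost_le_loop:
  fixes \<Xi> :: "'n::finite torus \<Rightarrow> real"
  assumes \<Xi>: "continuous_on UNIV \<Xi>" and "T > 0" and "N \<ge> 1" and "k \<ge> 1"
    and closed: "torus_proj (y k) = torus_proj (y 0)"
    and cost: "(\<Sum>i<k. seg_cost (\<lambda>w. \<Xi> (torus_proj w)) P (T / real N) (y i) (y (Suc i))) \<le> real k * L"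
  shows "\<exists>C. \<forall>j\<ge>1. D_cost P T j \<Xi> \<le> ereal (L + C / real j)"
proof -
  define S where "S = seg_cost (\<lambda>w. \<Xi> (torus_proj w)) P (T / real N)"
  obtain B where B: "B \<ge> 0" "\<And>x. norm (\<Xi> x) \<le> B"
    using torus_bounded[OF \<Xi>] by blast
  \<comment> \<open>Staying at a point for one step has velocity 0 and therefore costs at most this
    much.\<close>
  define C1 where "C1 = (norm P)\<^sup>2 / 2 + B"
  have wait: "S p p \<le> C1" for p
    using B(2)[of "torus_proj p"] by (simp add: S_def seg_cost_def C1_def)
  define w where "w = y k - y 0"
  have w: "w $ i \<in> \<int>" for i
    using closed by (simp add: w_def torus_proj_eq_iff)
  have proj_shift: "torus_proj (x + real m *\<^sub>R w) = torus_proj x" for x m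
    using w by (simp add: torus_proj_eq_iff)
  have S_shift: "S (x + real m *\<^sub>R w) (x' + real m *\<^sub>R w) = S x x'" for x x' m
    unfolding S_def by (rule seg_cost_translate) (simp add: proj_shift)
  \<comment> \<open>The loop closes only on the torus. Its unrolled lift moves by the integer vector
    \<open>w\<close> in each round, which leaves the segment costs unchanged.\<close>
  define Y where "Y = (\<lambda>n. y (n mod k) + real (n div k) *\<^sub>R w)"
  have SY: "S (Y n) (Y (Suc n)) = S (y (n mod k)) (y (Suc (n mod k)))" for n
  proof (cases "Suc (n mod k) = k")
    case True
    then have "Suc n mod k = 0" "Suc n div k = Suc (n div k)"
      by (auto simp: mod_Suc div_Suc)
    then have "Y (Suc n) = y (Suc (n mod k)) + real (n div k) *\<^sub>R w"
      by (simp add: Y_def True w_def algebra_simps)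
    then show ?thesis
      using S_shift by (simp add: Y_def)
  next
    case False
    then have "Suc n mod k = Suc (n mod k)" "Suc n div k = n div k"
      by (auto simp: mod_Suc div_Suc)
    then show ?thesis
      using S_shift by (simp add: Y_def)
  qed
  have rounds: "(\<Sum>n<m * k. S (Y n) (Y (Suc n))) \<le> real m * (real k * L)" for m
  proof -
    have "(\<Sum>n<m * k. S (Y n) (Y (Suc n))) = (\<Sum>q<m. \<Sum>n\<in>{q * k..<q * k + k}. S (Y n) (Y (Suc n)))"
      by (rule sum.nat_group[symmetric])
    also have "\<dots> = (\<Sum>q<m. \<Sum>i<k. S (y i) (y (Suc i)))"
    proof (rule sum.cong[OF refl])
      fix q
      have "(\<Sum>n\<in>{q * k..<q * k + k}. S (Y n) (Y (Suc n))) = (\<Sum>i<k. S (Y (q * k + i)) (Y (Suc (q * k + i))))"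
        using sum.shift_bounds_nat_ivl[of "\<lambda>n. S (Y n) (Y (Suc n))" 0 "q * k" k]
        by (simp add: atLeast0LessThan add.commute)
      also have "\<dots> = (\<Sum>i<k. S (y i) (y (Suc i)))"
        by (rule sum.cong[OF refl]) (simp add: SY)
      finally show "(\<Sum>n\<in>{q * k..<q * k + k}. S (Y n) (Y (Suc n))) = (\<Sum>i<k. S (y i) (y (Suc i)))" .
    qed
    also have "\<dots> \<le> real m * (real k * L)"
      using cost by (simp add: S_def mult_left_mono)
    finally show ?thesis .
  qed
  have "D_cost P T j \<Xi> \<le> ereal (L + (real k * \<bar>C1 - L\<bar>) / real j)" if "j \<ge> 1" for j
  proof -
    define m where "m = (j * N) div k"
    define r where "r = (j * N) mod k"
    have jN: "j * N = m * k + r" "r < k"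
      using \<open>k \<ge> 1\<close> by (auto simp: m_def r_def)
    \<comment> \<open>After \<open>m\<close> complete rounds the chain is frozen. Fewer than
      \<open>k\<close> steps remain, so their cost is bounded independently of \<open>j\<close> and
      contributes only order \<open>1/j\<close> to the mean.\<close>
    define z where "z = (\<lambda>n. Y (min n (m * k)))"
    have "torus_proj (z (j * N)) = torus_proj (z 0)"
      using \<open>k \<ge> 1\<close> proj_shift by (simp add: z_def jN(1) Y_def)
    then have D: "D_cost P T j \<Xi> \<le> ereal ((\<Sum>i<j * N. S (z i) (z (Suc i))) / (real j * real N))"
      unfolding S_def by (rule D_cost_le_chain[OF \<Xi> \<open>T > 0\<close> \<open>N \<ge> 1\<close> that])
    have "(\<Sum>i<j * N. S (z i) (z (Suc i))) = (\<Sum>i<m * k. S (z i) (z (Suc i))) + (\<Sum>i\<in>{m * k..<m * k + r}. S (z i) (z (Suc i)))"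
      unfolding jN(1) lessThan_atLeast0 by (rule sum.atLeastLessThan_concat[symmetric]) auto
    also have "(\<Sum>i<m * k. S (z i) (z (Suc i))) = (\<Sum>i<m * k. S (Y i) (Y (Suc i)))"
      by (rule sum.cong) (auto simp: z_def min_def)
    also have "(\<Sum>i\<in>{m * k..<m * k + r}. S (z i) (z (Suc i))) \<le> (\<Sum>i\<in>{m * k..<m * k + r}. C1)"
      by (rule sum_mono) (auto simp: z_def min_def intro: wait)
    also have "\<dots> = real r * C1"
      by simp
    finally have "(\<Sum>i<j * N. S (z i) (z (Suc i))) \<le> real m * (real k * L) + real r * C1"
      using rounds[of m] by linarith
    also have "\<dots> = (real j * real N) * L + real r * (C1 - L)"
      using jN(1) by (simp add: of_nat_mult[symmetric] algebra_simps del: of_nat_mult)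
    also have "real r * (C1 - L) \<le> real k * \<bar>C1 - L\<bar>"
      using jN(2) by (intro order_trans[OF mult_left_mono[OF abs_ge_self] mult_right_mono]) auto
    finally have "(\<Sum>i<j * N. S (z i) (z (Suc i))) / (real j * real N) \<le> ((real j * real N) * L + real k * \<bar>C1 - L\<bar>) / (real j * real N)"
      by (intro divide_right_mono) auto
    also have "\<dots> = L + (real k * \<bar>C1 - L\<bar>) / (real j * real N)"
      using \<open>j \<ge> 1\<close> \<open>N \<ge> 1\<close> by (simp add: add_divide_distrib)
    also have "(real k * \<bar>C1 - L\<bar>) / (real j * real N) \<le> (real k * \<bar>C1 - L\<bar>) / real j"
      using \<open>j \<ge> 1\<close> \<open>N \<ge> 1\<close> by (intro divide_left_mono) auto
    finally show ?thesis
      using D by (meson ereal_less_eq(3) add_left_mono order_trans)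
  qed
  then show ?thesis
    by blast
qed

section \<open>The value function of chains\<close>

lemma continuous_on_seg_cost:
  fixes X :: "real^'n \<Rightarrow> real"
  assumes X: "continuous_on UNIV X"
  shows "continuous_on UNIV (\<lambda>z. seg_cost X P \<tau> y z)"
proof -
  have "continuous_on UNIV (\<lambda>z. integral (cbox 0 1) (\<lambda>\<theta>. X (y + \<theta> *\<^sub>R (z - y))))"
    by (rule integral_continuous_on_param)
       (auto simp: split_beta intro!: continuous_on_compose2[OF X] continuous_intros)
  then show ?thesis
    unfolding seg_cost_def by (auto intro!: continuous_intros)
qed

lemma seg_cost_le:
  fixes X :: "real^'n \<Rightarrow> real"
  assumes X: "continuous_on UNIV X" and lower: "\<And>\<theta>. \<theta> \<in> {0..1} \<Longrightarrow> b \<le> X (y + \<theta> *\<^sub>R (z - y))"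
  shows "seg_cost X P \<tau> y z \<le> (norm ((1 / \<tau>) *\<^sub>R (z - y) - P))\<^sup>2 / 2 - b"
proof -
  have "continuous_on {0..1} (\<lambda>\<theta>. X (y + \<theta> *\<^sub>R (z - y)))"
    by (intro continuous_on_compose2[OF X] continuous_intros) auto
  then have "integral {0..1::real} (\<lambda>_. b) \<le> integral {0..1} (\<lambda>\<theta>. X (y + \<theta> *\<^sub>R (z - y)))"
    using lower by (intro integral_le integrable_continuous_interval) auto
  then show ?thesis
    by (simp add: seg_cost_def)
qed

text \<open>\<open>u x\<close> is the least cost, relative to \<open>L\<close>, of a chain ending at \<open>x\<close>. It is bounded below uniformly
  in \<open>N\<close> because a chain can be closed up in time \<open>T\<close>.\<close>

lemma discrete_subsolution_exists:
  fixes X :: "real^'n \<Rightarrow> real"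
  assumes X: "continuous_on UNIV X" "\<And>x. \<bar>X x\<bar> \<le> B"
    and per: "\<And>x w. (\<forall>i. w $ i \<in> \<int>) \<Longrightarrow> X (x + w) = X x"
    and "T > 0" "N \<ge> 1"
    and loops: "\<And>k y. \<forall>i. (y k - y 0) $ i \<in> \<int> \<Longrightarrow>
        0 \<le> (\<Sum>i<k. seg_cost X P (T / real N) (y i) (y (Suc i)) - L)"
  obtains u where "u \<in> borel_measurable borel"
    "\<And>x. \<bar>u x\<bar> \<le> T * ((real CARD('n) / T + norm P)\<^sup>2 / 2 + B + \<bar>L\<bar>)"
    "\<And>x w. (\<forall>i. w $ i \<in> \<int>) \<Longrightarrow> u (x + w) = u x"
    "\<And>y z. u z \<le> u y + T / real N * (seg_cost X P (T / real N) y z - L)"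
proof -
  define \<tau> where "\<tau> = T / real N"
  define C where "C = T * ((real CARD('n) / T + norm P)\<^sup>2 / 2 + B + \<bar>L\<bar>)"
  have "\<tau> > 0" "real N * \<tau> = T"
    using \<open>T > 0\<close> \<open>N \<ge> 1\<close> by (auto simp: \<tau>_def)
  define S where "S = (\<lambda>k y. \<Sum>i<k. seg_cost X P \<tau> (y i) (y (Suc i)) - L)"
  have S_cong: "S k y = S k y'" if "\<And>i. i \<le> k \<Longrightarrow> y i = y' i" for k y y'
    unfolding S_def by (rule sum.cong) (use that in auto)
  have S_ge: "- C \<le> \<tau> * S k y" for k y
  proof -
    \<comment> \<open>Rounding the displacement down leaves a correction \<open>D\<close> to an
      integer translate of the start with components of size at most 1; its norm is bounded by the
      sum of these.\<close>
    define w :: "real^'n" where "w = (\<chi> i. of_int \<lfloor>(y k - y 0) $ i\<rfloor>)"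
    define D where "D = y 0 + w - y k"
    have "\<bar>D $ i\<bar> \<le> 1" for i
      by (simp add: D_def w_def) linarith
    then have "norm D \<le> (\<Sum>i\<in>(UNIV :: 'n set). 1)"
      by (intro order_trans[OF norm_le_l1_cart] sum_mono)
    then have D: "norm D \<le> real CARD('n)"
      by simp
    \<comment> \<open>The correction is spread over \<open>N\<close> further steps, that is over
      time \<open>T\<close>. The speed is then at most \<open>CARD('n) / T\<close>, so the closing
      cost is the constant \<open>C\<close> for every \<open>N\<close>.\<close>
    define y' where "y' = (\<lambda>n. if n \<le> k then y n else y k + (real (n - k) / real N) *\<^sub>R D)"
    have tail: "seg_cost X P \<tau> (y' (k + m)) (y' (Suc (k + m))) \<le> (real CARD('n) / T + norm P)\<^sup>2 / 2 + B" for m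
    proof -
      have "y' (Suc (k + m)) - y' (k + m) = (1 / real N) *\<^sub>R D"
        by (cases m) (auto simp: y'_def scaleR_left_diff_distrib[symmetric] diff_divide_distrib[symmetric])
      then have "(1 / \<tau>) *\<^sub>R (y' (Suc (k + m)) - y' (k + m)) = (1 / T) *\<^sub>R D"
        using \<open>N \<ge> 1\<close> by (simp add: \<tau>_def)
      moreover have "norm ((1 / T) *\<^sub>R D - P) \<le> real CARD('n) / T + norm P"
      proof -
        have "norm ((1 / T) *\<^sub>R D - P) \<le> norm D / T + norm P"
          using \<open>T > 0\<close> by (intro order_trans[OF norm_triangle_ineq4]) simp
        also have "\<dots> \<le> real CARD('n) / T + norm P"
          using D \<open>T > 0\<close> by (simp add: divide_right_mono)
        finally show ?thesis .
      qed
      moreover have "seg_cost X P \<tau> (y' (k + m)) (y' (Suc (k + m)))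
        \<le> (norm ((1 / \<tau>) *\<^sub>R (y' (Suc (k + m)) - y' (k + m)) - P))\<^sup>2 / 2 - (- B)"
        by (rule seg_cost_le[OF X(1)]) (use X(2) in \<open>simp add: abs_le_iff minus_le_iff\<close>)
      ultimately show ?thesis
        by (smt (verit) divide_right_mono norm_ge_zero power_mono)
    qed
    have "y' (k + N) - y' 0 = w"
      using \<open>N \<ge> 1\<close> by (auto simp: y'_def D_def)
    then have "0 \<le> S (k + N) y'"
      unfolding S_def \<tau>_def by (intro loops) (simp add: w_def)
    also have "S (k + N) y' = S k y' + (\<Sum>m<N. seg_cost X P \<tau> (y' (k + m)) (y' (Suc (k + m))) - L)"
      unfolding S_def lessThan_atLeast0
      by (subst sum.atLeastLessThan_concat[of 0 k "k + N", symmetric])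
         (use sum.shift_bounds_nat_ivl[of _ 0 k N] in \<open>auto simp: add.commute\<close>)
    also have "S k y' = S k y"
      by (rule S_cong) (simp add: y'_def)
    also have "(\<Sum>m<N. seg_cost X P \<tau> (y' (k + m)) (y' (Suc (k + m))) - L) \<le>
       (\<Sum>m<N. (real CARD('n) / T + norm P)\<^sup>2 / 2 + B + \<bar>L\<bar>)"
    proof (rule sum_mono)
      show "seg_cost X P \<tau> (y' (k + m)) (y' (Suc (k + m))) - L \<le> (real CARD('n) / T + norm P)\<^sup>2 / 2 + B + \<bar>L\<bar>" for m
        using tail[of m] by linarith
    qed
    finally have "0 \<le> S k y + real N * ((real CARD('n) / T + norm P)\<^sup>2 / 2 + B + \<bar>L\<bar>)"
      by simp
    then have "0 \<le> \<tau> * (S k y + real N * ((real CARD('n) / T + norm P)\<^sup>2 / 2 + B + \<bar>L\<bar>))"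
      using \<open>\<tau> > 0\<close> by simp
    also have "\<dots> = \<tau> * S k y + C"
      unfolding C_def \<open>real N * \<tau> = T\<close>[symmetric] by (simp add: algebra_simps)
    finally show ?thesis
      by simp
  qed
  \<comment> \<open>The empty chain, \<open>k = 0\<close>, costs 0 and may end anywhere: it makes
    \<open>A x\<close> nonempty and gives \<open>u x \<le> 0\<close>.\<close>
  define A where "A = (\<lambda>x. {\<tau> * S k y |k y. y k = x})"
  define u where "u = (\<lambda>x. Inf (A x))"
  have bdd: "bdd_below (A x)" for x
    by (rule bdd_belowI[of _ "- C"]) (auto simp: A_def S_ge)
  have zero: "0 \<in> A x" for x
    unfolding A_def by (intro CollectI exI[of _ 0] exI[of _ "\<lambda>_. x"]) (simp add: S_def)
  have u_le: "u x \<le> \<tau> * S k y" if "y k = x" for x k y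
    unfolding u_def by (rule cInf_lower[OF _ bdd]) (use that in \<open>auto simp: A_def\<close>)
  have u_less: "\<exists>k y. y k = x \<and> \<tau> * S k y < a" if "u x < a" for x a
    using cInf_lessD[of "A x" a] that zero[of x] unfolding u_def A_def by blast
  show thesis
  proof (rule that[of u])
    show "u \<in> borel_measurable borel"
    \<comment> \<open>Sublevel sets are open: moving the last node of a chain changes its cost
      continuously. An empty chain has cost 0, and if this is below \<open>a\<close> then so is
      \<open>u\<close> everywhere.\<close>
    proof (rule borel_measurableI_less)
      fix a
      have "open {x. u x < a}"
      proof (subst open_subopen, intro ballI)
        fix x assume "x \<in> {x. u x < a}"
        then obtain k y where ky: "y k = x" "\<tau> * S k y < a"
          using u_less by blast
        show "\<exists>V. open V \<and> x \<in> V \<and> V \<subseteq> {x. u x < a}"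
        proof (cases k)
          case 0
          then have "0 < a"
            using ky by (simp add: S_def)
          then have "u x' < a" for x'
            using u_le[of "\<lambda>_. x'" 0 x'] by (simp add: S_def)
          then show ?thesis
            by (intro exI[of _ UNIV]) auto
        next
          case (Suc k')
          define h where "h = (\<lambda>x'. \<tau> * (S k' y + (seg_cost X P \<tau> (y k') x' - L)))"
          have h: "h x' = \<tau> * S k (y(k := x'))" for x'
          proof -
            have "S k' (y(k := x')) = S k' y"
              by (rule S_cong) (simp add: Suc)
            then show ?thesis
              by (simp add: h_def S_def Suc)
          qed
          have "continuous_on UNIV h"
            unfolding h_def by (intro continuous_intros continuous_on_seg_cost X)
          then have "open {x'. h x' < a}"
            by (intro open_Collect_less continuous_on_const)
          moreover have "h x < a"
            using ky h[of x] by (simp add: fun_upd_idem)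
          moreover have "u x' \<le> h x'" for x'
            unfolding h by (rule u_le) simp
          ultimately show ?thesis
            by (intro exI[of _ "{x'. h x' < a}"]) (auto intro: le_less_trans)
        qed
      qed
      then show "{x \<in> space borel. u x < a} \<in> sets borel"
        by simp
    qed
    have "- C \<le> u x" for x
      unfolding u_def by (rule cInf_greatest) (use zero S_ge in \<open>auto simp: A_def\<close>)
    moreover have "u x \<le> 0" for x
      unfolding u_def by (rule cInf_lower[OF zero bdd])
    ultimately show "\<bar>u x\<bar> \<le> T * ((real CARD('n) / T + norm P)\<^sup>2 / 2 + B + \<bar>L\<bar>)" for x
      unfolding C_def[symmetric] by (smt (verit))
    have shift: "u (x + w) \<le> u x" if w: "\<forall>i. w $ i \<in> \<int>" for x w
    proof (rule ccontr)
      assume "\<not> u (x + w) \<le> u x"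
      then obtain k y where ky: "y k = x" "\<tau> * S k y < u (x + w)"
        using u_less by (meson not_le)
      have "S k (\<lambda>i. y i + w) = S k y"
        unfolding S_def by (simp add: seg_cost_translate per[OF w])
      then show False
        using u_le[of "\<lambda>i. y i + w" k "x + w"] ky by simp
    qed
    show "u (x + w) = u x" if w: "\<forall>i. w $ i \<in> \<int>" for x w
    proof (rule antisym[OF shift[OF w]])
      have "\<forall>i. (- w) $ i \<in> \<int>"
        using w by simp
      from shift[OF this, of "x + w"] show "u x \<le> u (x + w)"
        by simp
    qed
    show "u z \<le> u y + T / real N * (seg_cost X P (T / real N) y z - L)" for y z
      unfolding \<tau>_def[symmetric]
    proof (rule field_le_epsilon)
      \<comment> \<open>Appending \<open>z\<close> to a chain that is optimal for \<open>y\<close>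
        up to \<open>e\<close> gives the dynamic programming inequality.\<close>
      fix e :: real assume "e > 0"
      then obtain k p where kp: "p k = y" "\<tau> * S k p < u y + e"
        using u_less[of y "u y + e"] by auto
      have "S k (p(Suc k := z)) = S k p"
        by (rule S_cong) simp
      then have "S (Suc k) (p(Suc k := z)) = S k p + (seg_cost X P \<tau> y z - L)"
        by (simp add: S_def kp)
      then have "u z \<le> \<tau> * S k p + \<tau> * (seg_cost X P \<tau> y z - L)"
        using u_le[of "p(Suc k := z)" "Suc k" z] by (simp add: distrib_left)
      then show "u z \<le> u y + \<tau> * (seg_cost X P \<tau> y z - L) + e"
        using kp by linarith
    qed
  qed
qed

section \<open>Mollified subsolutions\<close>

text \<open>Comparing the expansions at \<open>x\<close> and \<open>x + k\<close> shows that \<open>G\<close> is locally Lipschitz.\<close>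

lemma second_order_expansion_C1:
  fixes \<Phi> :: "real^'n \<Rightarrow> real" and G :: "real^'n \<Rightarrow> real^'n"
  assumes K: "\<And>x h. norm h \<le> 1 \<Longrightarrow> \<bar>\<Phi> (x + h) - \<Phi> x - h \<bullet> G x\<bar> \<le> K * (norm h)\<^sup>2"
  shows "GDERIV \<Phi> x :> G x" and "continuous_on UNIV G"
proof -
  have "K \<ge> 0"
  proof -
    obtain h :: "real^'n" where "norm h = 1"
      using vector_choose_size[of 1] by auto
    then show ?thesis
      using K[of h 0] by simp
  qed
  show "GDERIV \<Phi> x :> G x"
    unfolding gderiv_def has_derivative_at
  proof (intro conjI)
    show "bounded_linear (\<lambda>h. h \<bullet> G x)"
      by (rule bounded_linear_inner_left)
    show "(\<lambda>h. norm (\<Phi> (x + h) - \<Phi> x - h \<bullet> G x) / norm h) \<midarrow>0\<rightarrow> 0"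
    proof (rule Lim_null_comparison)
      have "\<forall>\<^sub>F h in at (0 :: real^'n). norm h \<le> 1"
        unfolding eventually_at by (intro exI[of _ 1]) auto
      then show "\<forall>\<^sub>F h in at 0. norm (norm (\<Phi> (x + h) - \<Phi> x - h \<bullet> G x) / norm h) \<le> K * norm h"
      proof eventually_elim
        case (elim h)
        then show ?case
          using K[OF elim, of x] by (cases "h = 0") (auto simp: divide_le_eq power2_eq_square mult.assoc)
      qed
      show "((\<lambda>h. K * norm h) \<longlongrightarrow> 0) (at (0 :: real^'n))"
        by (auto intro!: tendsto_eq_intros)
    qed
  qed
  have lip: "norm (G y - G x) \<le> 6 * K * norm (y - x)" if "norm (y - x) \<le> 1 / 2" for x y
  proof (cases "G y = G x")
    case True
    then show ?thesis using \<open>K \<ge> 0\<close> by simp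
  next
    case False
    define k where "k = y - x"
    \<comment> \<open>\<open>h\<close> points along \<open>G y - G x\<close> and is as long as
      \<open>k\<close>. The expansions at \<open>y\<close> with step \<open>h\<close> and at
      \<open>x\<close> with steps \<open>k\<close> and \<open>k + h\<close> contribute 1, 1 and 4,
      which gives the factor 6.\<close>
    define h where "h = (norm k / norm (G y - G x)) *\<^sub>R (G y - G x)"
    have nh: "norm h = norm k"
      using False by (simp add: h_def)
    have nk: "norm k \<le> 1 / 2"
      using that by (simp add: k_def)
    have nkh: "norm (k + h) \<le> 2 * norm k"
      using norm_triangle_ineq[of k h] nh by simp
    have 1: "\<bar>\<Phi> (y + h) - \<Phi> y - h \<bullet> G y\<bar> \<le> K * (norm k)\<^sup>2"
      using K[of h y] nh nk by simp
    have 2: "\<bar>\<Phi> y - \<Phi> x - k \<bullet> G x\<bar> \<le> K * (norm k)\<^sup>2"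
      using K[of k x] nk by (simp add: k_def)
    have "\<bar>\<Phi> (x + (k + h)) - \<Phi> x - (k + h) \<bullet> G x\<bar> \<le> K * (norm (k + h))\<^sup>2"
      using K[of "k + h" x] nkh nk by linarith
    also have "\<dots> \<le> K * (2 * norm k)\<^sup>2"
      using \<open>K \<ge> 0\<close> nkh by (intro mult_left_mono power_mono) auto
    finally have 3: "\<bar>\<Phi> (y + h) - \<Phi> x - k \<bullet> G x - h \<bullet> G x\<bar> \<le> 4 * K * (norm k)\<^sup>2"
      by (simp add: k_def inner_add_left algebra_simps)
    have "h \<bullet> (G y - G x) = norm k * norm (G y - G x)"
      using False by (simp add: h_def power2_norm_eq_inner[symmetric] power2_eq_square)
    moreover have "h \<bullet> (G y - G x) = h \<bullet> G y - h \<bullet> G x"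
      by (rule inner_diff_right)
    ultimately have "norm k * norm (G y - G x) \<le> 6 * K * (norm k)\<^sup>2"
      using 1 2 3 by (simp add: abs_le_iff)
    then have "norm k * norm (G y - G x) \<le> norm k * (6 * K * norm k)"
      by (simp add: power2_eq_square mult_ac)
    moreover have "norm k > 0"
      using False by (auto simp: k_def)
    ultimately show ?thesis
      by (simp add: k_def)
  qed
  show "continuous_on UNIV G"
    unfolding continuous_on_iff
  proof (intro ballI allI impI)
    fix x :: "real^'n" and e :: real assume "e > 0"
    define d where "d = min (1 / 2) (e / (6 * K + 1))"
    have "d > 0"
      using \<open>e > 0\<close> \<open>K \<ge> 0\<close> by (simp add: d_def)
    moreover have "dist (G y) (G x) < e" if "dist y x < d" for y
    proof -
      have "norm (G y - G x) \<le> 6 * K * norm (y - x)"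
        using that by (intro lip) (simp add: d_def dist_norm)
      also have "\<dots> \<le> (6 * K + 1) * norm (y - x)"
        by (simp add: mult_right_mono)
      also have "\<dots> < e"
        using that \<open>K \<ge> 0\<close> by (simp add: d_def dist_norm less_divide_eq mult.commute)
      finally show ?thesis
        by (simp add: dist_norm)
    qed
    ultimately show "\<exists>d>0. \<forall>x'\<in>UNIV. dist x' x < d \<longrightarrow> dist (G x') (G x) < e"
      by blast
  qed
qed

text \<open>This kernel has a Lipschitz gradient. That regularity is enough for a second-order
  expansion, and the polynomial form makes the constants explicit.\<close>

definition bump :: "real \<Rightarrow> 'a::real_inner \<Rightarrow> real" where
  "bump \<epsilon> z = (max 0 (\<epsilon>\<^sup>2 - (norm z)\<^sup>2))\<^sup>2"

definition bump_grad :: "real \<Rightarrow> 'a::real_inner \<Rightarrow> 'a" where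
  "bump_grad \<epsilon> z = - (4 * max 0 (\<epsilon>\<^sup>2 - (norm z)\<^sup>2)) *\<^sub>R z"

text \<open>The squared positive part has the derivative \<open>2 * max 0 a\<close>, which is
  Lipschitz with constant 2.\<close>

lemma square_pos_part_expansion:
  "\<bar>(max 0 b)\<^sup>2 - (max 0 a)\<^sup>2 - 2 * max 0 a * (b - a)\<bar> \<le> (b - a :: real)\<^sup>2"
proof -
  consider "a \<le> 0" "b \<le> 0" | "a \<le> 0" "b > 0" | "a > 0" "b \<le> 0" | "a > 0" "b > 0"
    by linarith
  then show ?thesis
  proof cases
    case 2
    then have "b\<^sup>2 \<le> (b - a)\<^sup>2"
      by (intro power_mono) auto
    with 2 show ?thesis by simp
  next
    case 3
    then have eq: "(max 0 b)\<^sup>2 - (max 0 a)\<^sup>2 - 2 * max 0 a * (b - a) = a * (a - 2 * b)"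
      by (simp add: power2_eq_square algebra_simps)
    have "a * (a - 2 * b) \<ge> 0" "a * (a - 2 * b) \<le> (b - a)\<^sup>2"
      using 3 by (auto simp: power2_eq_square algebra_simps)
    then show ?thesis
      unfolding eq by simp
  next
    case 4
    then have "(max 0 b)\<^sup>2 - (max 0 a)\<^sup>2 - 2 * max 0 a * (b - a) = (b - a)\<^sup>2"
      by (simp add: power2_eq_square algebra_simps)
    then show ?thesis
      by simp
  qed auto
qed

text \<open>Since \<open>norm h \<le> 1\<close>, all three terms vanish when \<open>z\<close> is
  outside the ball of radius \<open>\<epsilon> + 1\<close>. Inside, the argument of the squared
  positive part changes by at most \<open>(2 * \<epsilon> + 3) * norm h\<close>; the term
  \<open>2 * \<epsilon>\<^sup>2\<close> comes from its quadratic part.\<close>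

lemma bump_expansion:
  fixes z h :: "'a::real_inner"
  assumes "\<epsilon> > 0" "norm h \<le> 1"
  shows "\<bar>bump \<epsilon> (z + h) - bump \<epsilon> z - h \<bullet> bump_grad \<epsilon> z\<bar>
      \<le> (2 * \<epsilon>\<^sup>2 + (2 * \<epsilon> + 3)\<^sup>2) * (norm h)\<^sup>2 * indicator (cball 0 (\<epsilon> + 1)) z"
proof (cases "norm z \<le> \<epsilon> + 1")
  case True
  define a where "a = \<epsilon>\<^sup>2 - (norm z)\<^sup>2"
  define b where "b = \<epsilon>\<^sup>2 - (norm (z + h))\<^sup>2"
  have ba: "b - a = - (2 * (h \<bullet> z) + (norm h)\<^sup>2)"
    by (simp add: a_def b_def power2_norm_eq_inner inner_add_left inner_add_right inner_commute)
  have m: "0 \<le> max 0 a" "max 0 a \<le> \<epsilon>\<^sup>2"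
    by (auto simp: a_def)
  have "bump \<epsilon> (z + h) - bump \<epsilon> z - h \<bullet> bump_grad \<epsilon> z
      = ((max 0 b)\<^sup>2 - (max 0 a)\<^sup>2 - 2 * max 0 a * (b - a)) - 2 * max 0 a * (norm h)\<^sup>2"
    unfolding ba by (simp add: bump_def bump_grad_def a_def b_def algebra_simps)
  also have "\<bar>\<dots>\<bar> \<le> (b - a)\<^sup>2 + 2 * max 0 a * (norm h)\<^sup>2"
    by (intro order_trans[OF abs_triangle_ineq4] add_mono square_pos_part_expansion) (use m in simp)
  also have "\<dots> \<le> ((2 * \<epsilon> + 3) * norm h)\<^sup>2 + 2 * \<epsilon>\<^sup>2 * (norm h)\<^sup>2"
  proof (rule add_mono)
    have "\<bar>b - a\<bar> \<le> 2 * (norm h * norm z) + norm h * norm h"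
    proof -
      have "\<bar>h \<bullet> z\<bar> \<le> norm h * norm z" "0 \<le> norm h * norm h"
        using Cauchy_Schwarz_ineq2[of h z] by simp_all
      then show ?thesis
        unfolding ba power2_eq_square by linarith
    qed
    also have "\<dots> \<le> 2 * (norm h * (\<epsilon> + 1)) + norm h * 1"
      using True assms by (intro add_mono mult_left_mono) auto
    also have "\<dots> = (2 * \<epsilon> + 3) * norm h"
      by (simp add: algebra_simps)
    finally show "(b - a)\<^sup>2 \<le> ((2 * \<epsilon> + 3) * norm h)\<^sup>2"
      by (metis abs_ge_zero power2_abs power_mono)
    show "2 * max 0 a * (norm h)\<^sup>2 \<le> 2 * \<epsilon>\<^sup>2 * (norm h)\<^sup>2"
      using m by (intro mult_right_mono) auto
  qed
  also have "\<dots> = (2 * \<epsilon>\<^sup>2 + (2 * \<epsilon> + 3)\<^sup>2) * (norm h)\<^sup>2"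
    unfolding power_mult_distrib by (simp add: distrib_right)
  finally show ?thesis
    using True by simp
next
  case False
  then have "norm (z + h) \<ge> \<epsilon>"
    using norm_triangle_ineq4[of "z + h" h] assms by simp
  then have "(norm (z + h))\<^sup>2 \<ge> \<epsilon>\<^sup>2" "(norm z)\<^sup>2 \<ge> \<epsilon>\<^sup>2"
    using False assms by (auto intro!: power_mono)
  then show ?thesis
    using False by (simp add: bump_def bump_grad_def)
qed

lemma bump_nonneg: "bump \<epsilon> z \<ge> 0"
  by (simp add: bump_def)

lemma bump_eq_0: "\<epsilon> \<ge> 0 \<Longrightarrow> norm z \<ge> \<epsilon> \<Longrightarrow> bump \<epsilon> z = 0"
  by (simp add: bump_def power_mono)

lemma continuous_on_bump: "continuous_on S (bump \<epsilon>)"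
  unfolding bump_def by (intro continuous_intros)

lemma continuous_on_bump_grad: "continuous_on S (bump_grad \<epsilon>)"
  unfolding bump_grad_def by (intro continuous_intros)

section \<open>Averages against the kernel\<close>

lemma integrable_indicator_cball:
  "integrable lborel (\<lambda>x :: 'a::euclidean_space. C * indicator (cball 0 R) x :: real)"
  using emeasure_bounded_finite[OF bounded_cball, of "0::'a" R]
  by (intro integrable_mult_right integrable_real_indicator) auto

lemma integrable_lborel_bounded_support:
  fixes f :: "'a::euclidean_space \<Rightarrow> 'b::{banach, second_countable_topology}"
  assumes "f \<in> borel_measurable borel" "\<And>x. norm (f x) \<le> C * indicator (cball 0 R) x"
  shows "integrable lborel f"
proof (rule Bochner_Integration.integrable_bound)
  show "integrable lborel (\<lambda>x :: 'a. C * indicator (cball 0 R) x :: real)"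
    by (rule integrable_indicator_cball)
  show "AE x in lborel. norm (f x) \<le> norm (C * indicator (cball 0 R) x :: real)"
    using assms(2) by (intro AE_I2) (simp add: order_trans[OF _ abs_ge_self])
qed (use assms(1) in simp)

lemma integrable_bump:
  fixes v :: "'a::euclidean_space \<Rightarrow> real"
  assumes "\<epsilon> > 0" "v \<in> borel_measurable borel" "\<And>x. \<bar>v x\<bar> \<le> C"
  shows "integrable lborel (\<lambda>z. v z * bump \<epsilon> z)"
proof (rule integrable_lborel_bounded_support)
  show "(\<lambda>z. v z * bump \<epsilon> z) \<in> borel_measurable borel"
    by (intro borel_measurable_times assms(2) borel_measurable_continuous_onI continuous_on_bump)
  show "norm (v z * bump \<epsilon> z) \<le> (C * (\<epsilon>\<^sup>2)\<^sup>2) * indicator (cball 0 \<epsilon>) z" for z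
  proof (cases "norm z \<le> \<epsilon>")
    case True
    have "bump \<epsilon> z \<le> (\<epsilon>\<^sup>2)\<^sup>2"
      unfolding bump_def by (intro power_mono) auto
    moreover have "C \<ge> 0"
      using assms(3)[of z] by linarith
    ultimately show ?thesis
      using True assms(3)[of z] bump_nonneg[of \<epsilon> z] by (simp add: abs_mult mult_mono)
  next
    case False
    then show ?thesis
      using bump_eq_0[of \<epsilon> z] \<open>\<epsilon> > 0\<close> by simp
  qed
qed

lemma integral_bump_pos:
  assumes "\<epsilon> > 0"
  shows "(LINT z|lborel. bump \<epsilon> (z :: 'a::euclidean_space)) > 0"
proof -
  have int: "integrable lborel (bump \<epsilon> :: 'a \<Rightarrow> real)"
    using integrable_bump[OF assms, of "\<lambda>_. 1" 1] by simp
  have "(LINT z|lborel. bump \<epsilon> (z :: 'a)) \<noteq> 0"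
  proof
    assume "(LINT z|lborel. bump \<epsilon> (z :: 'a)) = 0"
    then have "AE z in lborel. bump \<epsilon> (z :: 'a) = 0"
      using integral_nonneg_eq_0_iff_AE[OF int] bump_nonneg by blast
    then have "AE z in lborel. z \<notin> ball (0 :: 'a) \<epsilon>"
    proof eventually_elim
      case (elim z)
      show ?case
      proof
        assume "z \<in> ball 0 \<epsilon>"
        then have "(norm z)\<^sup>2 < \<epsilon>\<^sup>2"
          by (intro power_strict_mono) auto
        with elim show False
          by (simp add: bump_def)
      qed
    qed
    then have "emeasure lborel (ball (0 :: 'a) \<epsilon>) = 0"
      by (subst (asm) AE_iff_measurable[of "ball 0 \<epsilon>"]) auto
    moreover have "emeasure lborel (ball (0 :: 'a) \<epsilon>) > 0"
      using assms content_ball_pos[of \<epsilon> "0 :: 'a"] measure_def by (metis enn2real_0 gr_zeroI less_irrefl)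
    ultimately show False
      by simp
  qed
  moreover have "(LINT z|lborel. bump \<epsilon> (z :: 'a)) \<ge> 0"
    by (rule integral_nonneg_AE) (simp add: bump_nonneg)
  ultimately show ?thesis
    by simp
qed

text \<open>The kernel is even, so this is the convolution of \<open>u\<close> with the normalised
  bump, written so that a statement about shifts of \<open>u\<close> transfers directly.\<close>

definition mollify :: "real \<Rightarrow> ('a::euclidean_space \<Rightarrow> real) \<Rightarrow> 'a \<Rightarrow> real" where
  "mollify \<epsilon> u x = (LINT z|lborel. u (x + z) * bump \<epsilon> z) / (LINT z|lborel. bump \<epsilon> (z :: 'a))"

text \<open>A one-sided inequality valid for all shifts in the support of the kernel survives
  averaging. In this form the discrete subsolution property passes to the mollified
  function.\<close>

lemma mollify_diff_le:
  fixes u :: "'a::euclidean_space \<Rightarrow> real"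
  assumes "\<epsilon> > 0" and u: "u \<in> borel_measurable borel" "\<And>x. \<bar>u x\<bar> \<le> C"
    and le: "\<And>z. norm z \<le> \<epsilon> \<Longrightarrow> u (y + z) - u (x + z) \<le> b"
  shows "mollify \<epsilon> u y - mollify \<epsilon> u x \<le> b"
proof -
  define m where "m = (LINT z|lborel. bump \<epsilon> (z :: 'a))"
  have "m > 0"
    unfolding m_def by (rule integral_bump_pos[OF \<open>\<epsilon> > 0\<close>])
  have int: "integrable lborel (\<lambda>z. u (x + z) * bump \<epsilon> z)" for x
    by (rule integrable_bump[OF \<open>\<epsilon> > 0\<close>]) (use u in \<open>auto intro!: measurable_compose[OF _ u(1)]\<close>)
  have "(LINT z|lborel. u (y + z) * bump \<epsilon> z) - (LINT z|lborel. u (x + z) * bump \<epsilon> z)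
      = (LINT z|lborel. u (y + z) * bump \<epsilon> z - u (x + z) * bump \<epsilon> z)"
    by (rule Bochner_Integration.integral_diff[symmetric]) (rule int)+
  also have "\<dots> \<le> (LINT z|lborel. b * bump \<epsilon> (z :: 'a))"
  proof (rule integral_mono)
    show "integrable lborel (\<lambda>z. u (y + z) * bump \<epsilon> z - u (x + z) * bump \<epsilon> z)"
      by (intro Bochner_Integration.integrable_diff int)
    show "integrable lborel (\<lambda>z. b * bump \<epsilon> (z :: 'a))"
      by (rule integrable_bump[OF \<open>\<epsilon> > 0\<close>, of _ "\<bar>b\<bar>"]) auto
    show "u (y + z) * bump \<epsilon> z - u (x + z) * bump \<epsilon> z \<le> b * bump \<epsilon> z" for z
    proof (cases "norm z \<le> \<epsilon>")
      case True
      then show ?thesis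
        using mult_right_mono[OF le bump_nonneg[of \<epsilon> z]] by (simp add: left_diff_distrib)
    next
      case False
      then show ?thesis
        using bump_eq_0[of \<epsilon> z] \<open>\<epsilon> > 0\<close> by simp
    qed
  qed
  also have "\<dots> = b * m"
    by (simp add: m_def)
  finally show ?thesis
    unfolding mollify_def m_def[symmetric] diff_divide_distrib[symmetric]
    using \<open>m > 0\<close> by (simp add: pos_divide_le_eq)
qed

lemma integral_lborel_translate:
  fixes f :: "'a::euclidean_space \<Rightarrow> 'b::{banach, second_countable_topology}"
  assumes "f \<in> borel_measurable borel"
  shows "(LINT z|lborel. f (c + z)) = (LINT z|lborel. f z)"
proof -
  have "(LINT z|lborel. f z) = (LINT z|distr lborel borel ((+) c). f z)"
    by (simp add: lborel_distr_plus)
  also have "\<dots> = (LINT z|lborel. f (c + z))"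
    by (rule integral_distr) (use assms in auto)
  finally show ?thesis ..
qed

text \<open>The derivative falls on the kernel, so the constant \<open>K\<close> depends on \<open>u\<close> only through its bound.\<close>

lemma mollify_expansion:
  fixes C :: real
  assumes "\<epsilon> > 0" "C \<ge> 0"
  obtains K where "K \<ge> 0"
    "\<And>u :: real^'n \<Rightarrow> real. u \<in> borel_measurable borel \<Longrightarrow> (\<And>x. \<bar>u x\<bar> \<le> C) \<Longrightarrow>
      \<exists>G. \<forall>x h. norm h \<le> 1 \<longrightarrow> \<bar>mollify \<epsilon> u (x + h) - mollify \<epsilon> u x - h \<bullet> G x\<bar> \<le> K * (norm h)\<^sup>2"
proof -
  define m where "m = (LINT z|lborel. bump \<epsilon> (z :: real^'n))"
  have "m > 0"
    unfolding m_def by (rule integral_bump_pos[OF \<open>\<epsilon> > 0\<close>])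
  define K0 where "K0 = 2 * \<epsilon>\<^sup>2 + (2 * \<epsilon> + 3)\<^sup>2"
  have "K0 \<ge> 0"
    by (simp add: K0_def)
  define V where "V = measure lborel (cball (0 :: real^'n) (\<epsilon> + 1))"
  show thesis
  proof (rule that[of "C * K0 * V / m"])
    show "0 \<le> C * K0 * V / m"
      using \<open>C \<ge> 0\<close> \<open>K0 \<ge> 0\<close> \<open>m > 0\<close> by (simp add: V_def)
    fix u :: "real^'n \<Rightarrow> real" assume u: "u \<in> borel_measurable borel" "\<And>x. \<bar>u x\<bar> \<le> C"
    have ut: "(\<lambda>z. u (x + z)) \<in> borel_measurable borel" for x
      by (rule measurable_compose[OF _ u(1)]) simp
    have bump_meas: "(bump \<epsilon> :: real^'n \<Rightarrow> real) \<in> borel_measurable borel"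
      and grad_meas: "(bump_grad \<epsilon> :: real^'n \<Rightarrow> _) \<in> borel_measurable borel"
      by (auto intro!: borel_measurable_continuous_onI continuous_on_bump continuous_on_bump_grad)
    have shift_meas: "(\<lambda>z. bump \<epsilon> (z - h)) \<in> borel_measurable borel" for h :: "real^'n"
      by (rule measurable_compose[OF _ bump_meas]) simp
    \<comment> \<open>The sign appears because the increment \<open>h\<close> of the argument
      becomes \<open>- h\<close> on the kernel.\<close>
    define G where "G = (\<lambda>x. - (1 / m) *\<^sub>R (LINT z|lborel. u (x + z) *\<^sub>R bump_grad \<epsilon> z))"
    have "\<bar>mollify \<epsilon> u (x + h) - mollify \<epsilon> u x - h \<bullet> G x\<bar> \<le> C * K0 * V / m * (norm h)\<^sup>2"
      if h: "norm h \<le> 1" for x h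
    proof -
      have int0: "integrable lborel (\<lambda>z. u (x + z) * bump \<epsilon> z)" for x
        by (rule integrable_bump[OF \<open>\<epsilon> > 0\<close> ut u(2)])
      have intG: "integrable lborel (\<lambda>z. u (x + z) *\<^sub>R bump_grad \<epsilon> z)"
      proof (rule integrable_lborel_bounded_support)
        show "norm (u (x + z) *\<^sub>R bump_grad \<epsilon> z) \<le> (C * (4 * \<epsilon>\<^sup>2 * \<epsilon>)) * indicator (cball 0 \<epsilon>) z" for z
        proof (cases "norm z \<le> \<epsilon>")
          case True
          have "norm (bump_grad \<epsilon> z) = (4 * max 0 (\<epsilon>\<^sup>2 - (norm z)\<^sup>2)) * norm z"
            by (simp add: bump_grad_def)
          also have "\<dots> \<le> (4 * \<epsilon>\<^sup>2) * \<epsilon>"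
            using True by (intro mult_mono) auto
          finally show ?thesis
            using True u(2)[of "x + z"] \<open>C \<ge> 0\<close> by (simp add: mult_mono)
        next
          case False
          then have "\<epsilon>\<^sup>2 \<le> (norm z)\<^sup>2"
            using \<open>\<epsilon> > 0\<close> by (intro power_mono) auto
          then show ?thesis
            using False by (simp add: bump_grad_def)
        qed
      qed (use ut grad_meas in simp)
      \<comment> \<open>Translation invariance moves \<open>h\<close> from \<open>u\<close>, which
        is merely measurable, onto the kernel.\<close>
      have "(LINT z|lborel. u (x + h + z) * bump \<epsilon> z) = (LINT z|lborel. u (x + (h + z)) * bump \<epsilon> (h + z - h))"
        by (simp add: add.assoc)
      also have "\<dots> = (LINT z|lborel. u (x + z) * bump \<epsilon> (z - h))"
        by (rule integral_lborel_translate[where f = "\<lambda>z. u (x + z) * bump \<epsilon> (z - h)"])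
           (use ut shift_meas in simp)
      finally have shift: "(LINT z|lborel. u (x + h + z) * bump \<epsilon> z) = (LINT z|lborel. u (x + z) * bump \<epsilon> (z - h))" .
      have int1: "integrable lborel (\<lambda>z. u (x + z) * bump \<epsilon> (z - h))"
      proof -
        have "integrable (distr lborel borel ((+) h)) (\<lambda>z. u (x + z) * bump \<epsilon> (z - h))"
        proof (subst integrable_distr_eq)
          show "integrable lborel (\<lambda>z. u (x + (h + z)) * bump \<epsilon> (h + z - h))"
            using int0[of "x + h"] by (simp add: add.assoc)
          show "(\<lambda>z. u (x + z) * bump \<epsilon> (z - h)) \<in> borel_measurable borel"
            using ut shift_meas by simp
        qed simp
        then show ?thesis
          by (simp add: lborel_distr_plus)
      qed
      define R where "R = (\<lambda>z. u (x + z) * (bump \<epsilon> (z - h) - bump \<epsilon> z - (- h) \<bullet> bump_grad \<epsilon> z))"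
      have R_eq: "R z = u (x + z) * bump \<epsilon> (z - h) - u (x + z) * bump \<epsilon> z + h \<bullet> (u (x + z) *\<^sub>R bump_grad \<epsilon> z)" for z
        by (simp add: R_def algebra_simps)
      have "(LINT z|lborel. R z) = (LINT z|lborel. u (x + z) * bump \<epsilon> (z - h)) - (LINT z|lborel. u (x + z) * bump \<epsilon> z)
          + h \<bullet> (LINT z|lborel. u (x + z) *\<^sub>R bump_grad \<epsilon> z)"
        unfolding R_eq
        by (simp only: Bochner_Integration.integral_add[OF Bochner_Integration.integrable_diff[OF int1 int0] integrable_inner_right[OF intG]]
            Bochner_Integration.integral_diff[OF int1 int0] integral_inner_right[OF intG])
      then have eq: "mollify \<epsilon> u (x + h) - mollify \<epsilon> u x - h \<bullet> G x = (LINT z|lborel. R z) / m"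
        unfolding mollify_def m_def[symmetric] shift G_def using \<open>m > 0\<close> by (simp add: field_simps)
      have R_le: "norm (R z) \<le> (C * (K0 * (norm h)\<^sup>2)) * indicator (cball 0 (\<epsilon> + 1)) z" for z
      proof -
        have "\<bar>bump \<epsilon> (z + (- h)) - bump \<epsilon> z - (- h) \<bullet> bump_grad \<epsilon> z\<bar> \<le> K0 * (norm h)\<^sup>2 * indicator (cball 0 (\<epsilon> + 1)) z"
          using bump_expansion[OF \<open>\<epsilon> > 0\<close>, of "- h" z] h by (simp add: K0_def)
        then have "\<bar>R z\<bar> \<le> C * (K0 * (norm h)\<^sup>2 * indicator (cball 0 (\<epsilon> + 1)) z)"
          unfolding R_def abs_mult using u(2) \<open>C \<ge> 0\<close> by (intro mult_mono) auto
        then show ?thesis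
          by (simp add: mult_ac)
      qed
      have R_meas: "R \<in> borel_measurable borel"
        unfolding R_def using ut shift_meas bump_meas grad_meas by simp
      have "\<bar>LINT z|lborel. R z\<bar> \<le> (LINT z|lborel. norm (R z))"
        using integral_norm_bound[of lborel R] by simp
      also have "\<dots> \<le> (LINT z|lborel. (C * (K0 * (norm h)\<^sup>2)) * indicator (cball (0 :: real^'n) (\<epsilon> + 1)) z)"
        by (intro integral_mono integrable_norm integrable_lborel_bounded_support[OF R_meas R_le] integrable_indicator_cball R_le)
      also have "\<dots> = C * (K0 * (norm h)\<^sup>2) * V"
        by (simp add: V_def)
      finally have "\<bar>(LINT z|lborel. R z) / m\<bar> \<le> C * (K0 * (norm h)\<^sup>2) * V / m"
        using \<open>m > 0\<close> by (simp add: divide_right_mono)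
      then show ?thesis
        unfolding eq by (simp add: mult_ac)
    qed
    then show "\<exists>G. \<forall>x h. norm h \<le> 1 \<longrightarrow> \<bar>mollify \<epsilon> u (x + h) - mollify \<epsilon> u x - h \<bullet> G x\<bar> \<le> C * K0 * V / m * (norm h)\<^sup>2"
      by blast
  qed
qed

lemma mollify_periodic:
  assumes "\<And>x. u (x + w) = u x"
  shows "mollify \<epsilon> u (x + w) = mollify \<epsilon> u x"
proof -
  have "u (x + w + z) = u (x + z)" for z
    using assms[of "x + z"] by (simp add: ac_simps)
  then show ?thesis
    by (simp add: mollify_def)
qed

lemma mollify_bounded:
  assumes "\<epsilon> > 0" "u \<in> borel_measurable borel" "\<And>x. \<bar>u x\<bar> \<le> C"
  shows "\<bar>mollify \<epsilon> u y - mollify \<epsilon> u x\<bar> \<le> 2 * C"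
proof -
  have "u a - u b \<le> 2 * C" for a b
    using assms(3)[of a] assms(3)[of b] by linarith
  then have "mollify \<epsilon> u y - mollify \<epsilon> u x \<le> 2 * C" "mollify \<epsilon> u x - mollify \<epsilon> u y \<le> 2 * C"
    by (intro mollify_diff_le[OF assms]; blast)+
  then show ?thesis
    by linarith
qed

text \<open>The lift is uniformly continuous on a larger cube, which contains \<open>z + v\<close>
  whenever the representative \<open>z\<close> lies in the unit cube and \<open>v\<close> has norm
  at most 1.\<close>

lemma torus_lift_near:
  fixes \<Xi> :: "'n::finite torus \<Rightarrow> real"
  assumes \<Xi>: "continuous_on UNIV \<Xi>" and "\<eta> > 0"
  obtains \<delta> where "\<delta> > 0"
    "\<And>x v. norm v \<le> \<delta> \<Longrightarrow> \<Xi> (torus_proj x) - \<eta> \<le> \<Xi> (torus_proj (x + v))"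
proof -
  define X where "X = (\<lambda>w. \<Xi> (torus_proj w))"
  have "continuous_on UNIV X"
    using \<Xi> unfolding X_def by (simp add: continuous_on_torus_iff)
  then have "uniformly_continuous_on (cbox (- 1) 2) X"
    by (intro compact_uniformly_continuous) (auto intro: continuous_on_subset)
  then obtain d where d: "d > 0"
    "\<And>x y. x \<in> cbox (- 1) 2 \<Longrightarrow> y \<in> cbox (- 1) 2 \<Longrightarrow> dist y x < d \<Longrightarrow> dist (X y) (X x) < \<eta>"
    using \<open>\<eta> > 0\<close> unfolding uniformly_continuous_on_def by metis
  show thesis
  proof (rule that[of "min 1 (d / 2)"])
    show "min 1 (d / 2) > 0"
      using d(1) by simp
    fix x v :: "real^'n" assume v: "norm v \<le> min 1 (d / 2)"
    obtain z where z: "torus_proj x = torus_proj z" "z \<in> cbox 0 1"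
      by (rule torus_cases_unit_cube)
    have "\<bar>v $ i\<bar> \<le> 1" for i
      using component_le_norm_cart[of v i] v by linarith
    then have "z \<in> cbox (- 1) 2" "z + v \<in> cbox (- 1) 2"
      using z(2) by (auto simp: mem_box_cart abs_le_iff; smt (verit))+
    then have "dist (X (z + v)) (X z) < \<eta>"
      using d v by (intro d(2)) (auto simp: dist_norm)
    moreover have "torus_proj (x + v) = torus_proj (z + v)"
      using z(1) by (simp add: torus_proj_eq_iff)
    ultimately show "\<Xi> (torus_proj x) - \<eta> \<le> \<Xi> (torus_proj (x + v))"
      using z(1) by (simp add: X_def dist_real_def)
  qed
qed

text \<open>Mollifying the discrete subsolution and letting the step be \<open>\<tau> (P + \<nabla>\<Phi>)\<close>, the optimal velocity
  in the Legendre transform, gives a smooth subsolution up to the error \<open>2\<eta>\<close>.\<close>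

lemma H_hat_le_of_loops:
  fixes \<Xi> :: "'n::finite torus \<Rightarrow> real"
  assumes \<Xi>: "continuous_on UNIV \<Xi>" and "T > 0" and "\<eta> > 0"
  obtains N where "N \<ge> 1"
    "(\<And>k y. torus_proj (y k) = torus_proj (y 0) \<Longrightarrow>
        0 \<le> (\<Sum>i<k. seg_cost (\<lambda>w. \<Xi> (torus_proj w)) P (T / real N) (y i) (y (Suc i)) - L)) \<Longrightarrow>
     H_hat \<Xi> P \<le> (norm P)\<^sup>2 / 2 - L + 2 * \<eta>"
proof -
  define X where "X = (\<lambda>w. \<Xi> (torus_proj w))"
  have X: "continuous_on UNIV X"
    using \<Xi> unfolding X_def by (simp add: continuous_on_torus_iff)
  obtain B where B: "B \<ge> 0" "\<And>x. norm (\<Xi> x) \<le> B"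
    using torus_bounded[OF \<Xi>] by blast
  obtain \<delta> where \<delta>: "\<delta> > 0" "\<And>x v. norm v \<le> \<delta> \<Longrightarrow> X x - \<eta> \<le> X (x + v)"
    using torus_lift_near[OF \<Xi> \<open>\<eta> > 0\<close>] unfolding X_def by blast
  \<comment> \<open>A shift within the kernel and a step are each at most \<epsilon>, so together
    they stay within \<delta>.\<close>
  define \<epsilon> where "\<epsilon> = \<delta> / 2"
  have "\<epsilon> > 0"
    using \<delta>(1) by (simp add: \<epsilon>_def)
  \<comment> \<open>This is the bound of \<open>discrete_subsolution_exists\<close>. It does not
    contain \<open>N\<close>, so \<open>K\<close> can be fixed before \<open>N\<close> and before
    any \<open>u\<close> is available.\<close>
  define C where "C = T * ((real CARD('n) / T + norm P)\<^sup>2 / 2 + B + \<bar>L\<bar>)"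
  have "C \<ge> 0"
    using \<open>T > 0\<close> B(1) by (simp add: C_def)
  obtain K where K: "K \<ge> 0"
    "\<And>u :: real^'n \<Rightarrow> real. u \<in> borel_measurable borel \<Longrightarrow> (\<And>x. \<bar>u x\<bar> \<le> C) \<Longrightarrow>
      \<exists>G. \<forall>x h. norm h \<le> 1 \<longrightarrow> \<bar>mollify \<epsilon> u (x + h) - mollify \<epsilon> u x - h \<bullet> G x\<bar> \<le> K * (norm h)\<^sup>2"
    using mollify_expansion[OF \<open>\<epsilon> > 0\<close> \<open>C \<ge> 0\<close>] by blast
  \<comment> \<open>\<open>M\<close> will bound the velocity \<open>G x + P\<close>: the oscillation
    \<open>2 * C\<close> and the expansion error \<open>K\<close> over a unit step bound
    \<open>G\<close>.\<close>
  define M where "M = norm P + 2 * C + K + 1"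
  have "M > 0"
    using \<open>C \<ge> 0\<close> K(1) by (simp add: M_def add_nonneg_pos)
  \<comment> \<open>A time step below \<open>t\<close> keeps the displacement at most 1, where the
    expansion is valid, and at most \<epsilon>, where the potential varies by no more than \<eta>;
    the last entry makes the quadratic error at most \<eta> per unit of time.\<close>
  define t where "t = min (min (1 / M) (\<epsilon> / M)) (\<eta> / (K * M\<^sup>2 + 1))"
  have "t > 0"
    using \<open>M > 0\<close> \<open>\<epsilon> > 0\<close> \<open>\<eta> > 0\<close> K(1) by (simp add: t_def add_nonneg_pos)
  obtain N0 :: nat where N0: "T / t < real N0"
    using reals_Archimedean2 by blast
  define N where "N = Suc N0"
  define \<tau> where "\<tau> = T / real N"
  have "\<tau> > 0"
    using \<open>T > 0\<close> by (simp add: \<tau>_def N_def)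
  have "T / t < real N"
    using N0 by (simp add: N_def)
  then have "\<tau> \<le> t"
    using \<open>t > 0\<close> by (simp add: \<tau>_def N_def field_simps)
  then have \<tau>: "\<tau> * M \<le> 1" "\<tau> * M \<le> \<epsilon>" "\<tau> * (K * M\<^sup>2 + 1) \<le> \<eta>"
    using \<open>M > 0\<close> K(1) by (auto simp: t_def pos_le_divide_eq add_nonneg_pos)
  show thesis
  proof (rule that[of N])
    show "N \<ge> 1"
      by (simp add: N_def)
    assume loops: "\<And>k y. torus_proj (y k) = torus_proj (y 0) \<Longrightarrow>
        0 \<le> (\<Sum>i<k. seg_cost (\<lambda>w. \<Xi> (torus_proj w)) P (T / real N) (y i) (y (Suc i)) - L)"
    have shift: "torus_proj (x + w) = torus_proj x" if "\<forall>i. w $ i \<in> \<int>" for x w :: "real^'n"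
      using that by (simp add: torus_proj_eq_iff)
    obtain u where u: "u \<in> borel_measurable borel" "\<And>x. \<bar>u x\<bar> \<le> C"
      "\<And>x w. (\<forall>i. w $ i \<in> \<int>) \<Longrightarrow> u (x + w) = u x"
      "\<And>y z. u z \<le> u y + \<tau> * (seg_cost X P \<tau> y z - L)"
    proof (rule discrete_subsolution_exists[OF X _ _ \<open>T > 0\<close> \<open>N \<ge> 1\<close>, of B P L])
      show "\<bar>X x\<bar> \<le> B" for x
        using B(2) by (simp add: X_def)
      show "X (x + w) = X x" if "\<forall>i. w $ i \<in> \<int>" for x w
        using shift[OF that] by (simp add: X_def)
      show "0 \<le> (\<Sum>i<k. seg_cost X P (T / real N) (y i) (y (Suc i)) - L)"
        if "\<forall>i. (y k - y 0) $ i \<in> \<int>" for k and y :: "nat \<Rightarrow> real^'n"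
        using loops[of y k] that by (simp add: X_def torus_proj_eq_iff)
    qed (use that in \<open>auto simp: C_def \<tau>_def\<close>)
    obtain G where G: "\<And>x h. norm h \<le> 1 \<Longrightarrow> \<bar>mollify \<epsilon> u (x + h) - mollify \<epsilon> u x - h \<bullet> G x\<bar> \<le> K * (norm h)\<^sup>2"
      using K(2)[OF u(1,2)] by blast
    note C1 = second_order_expansion_C1[of "mollify \<epsilon> u" G K, OF G]
    \<comment> \<open>Any choice of representative gives the same value, because the mollified
      function inherits the periodicity of \<open>u\<close>.\<close>
    define \<phi> where "\<phi> = (\<lambda>x. mollify \<epsilon> u (SOME z. torus_proj z = x))"
    have lift: "\<phi> (torus_proj w) = mollify \<epsilon> u w" for w
    proof -
      define z where "z = (SOME z. torus_proj z = torus_proj w)"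
      have "torus_proj z = torus_proj w"
        unfolding z_def by (rule someI) (rule refl)
      then have "\<forall>i. (z - w) $ i \<in> \<int>"
        by (simp add: torus_proj_eq_iff)
      from mollify_periodic[of u "z - w" \<epsilon> w, OF u(3)[OF this]] show ?thesis
        by (simp add: \<phi>_def z_def)
    qed
    have grad: "GDERIV (\<lambda>w. \<phi> (torus_proj w)) x :> G x" for x
      unfolding lift by (rule C1(1))
    have \<phi>: "\<phi> \<in> torus_C1"
      by (rule torus_C1I[OF grad C1(2)])
    have G_bound: "norm (G x) \<le> 2 * C + K" for x
    proof (cases "G x = 0")
      case True
      then show ?thesis using \<open>C \<ge> 0\<close> K(1) by simp
    next
      case False
      \<comment> \<open>A unit step along the gradient turns the bound on the oscillation into a
        bound on \<open>G\<close>.\<close>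
      define h where "h = (1 / norm (G x)) *\<^sub>R G x"
      have h: "norm h = 1" "h \<bullet> G x = norm (G x)"
        using False by (simp_all add: h_def power2_norm_eq_inner[symmetric] power2_eq_square)
      have "\<bar>mollify \<epsilon> u (x + h) - mollify \<epsilon> u x\<bar> \<le> 2 * C"
        by (rule mollify_bounded[OF \<open>\<epsilon> > 0\<close> u(1,2)])
      then show ?thesis
        using G[of h x] h by simp
    qed
    have "(norm (G x + P))\<^sup>2 / 2 + X x \<le> (norm P)\<^sup>2 / 2 - L + 2 * \<eta>" for x
    proof -
      define v where "v = G x + P"
      have v: "norm v \<le> M"
        using G_bound[of x] norm_triangle_ineq[of "G x" P] by (simp add: v_def M_def)
      define d where "d = \<tau> *\<^sub>R v"
      have nd: "norm d \<le> \<tau> * M"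
        using v \<open>\<tau> > 0\<close> by (simp add: d_def)
      have "mollify \<epsilon> u (x + d) - mollify \<epsilon> u x \<le> \<tau> * ((norm (v - P))\<^sup>2 / 2 - (X x - \<eta>) - L)"
      proof (rule mollify_diff_le[OF \<open>\<epsilon> > 0\<close> u(1,2)])
        fix z :: "real^'n" assume z: "norm z \<le> \<epsilon>"
        have "seg_cost X P \<tau> (x + z) (x + d + z) \<le> (norm ((1 / \<tau>) *\<^sub>R ((x + d + z) - (x + z)) - P))\<^sup>2 / 2 - (X x - \<eta>)"
        proof (rule seg_cost_le[OF X])
          fix \<theta> :: real assume \<theta>: "\<theta> \<in> {0..1}"
          have "norm (z + \<theta> *\<^sub>R d) \<le> norm z + \<theta> * norm d"
            using \<theta> by (intro order_trans[OF norm_triangle_ineq]) simp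
          also have "\<dots> \<le> \<epsilon> + 1 * \<epsilon>"
            using \<theta> z nd \<tau>(2) by (intro add_mono mult_mono) auto
          finally have "norm (z + \<theta> *\<^sub>R d) \<le> \<delta>"
            by (simp add: \<epsilon>_def)
          from \<delta>(2)[OF this, of x] show "X x - \<eta> \<le> X (x + z + \<theta> *\<^sub>R (x + d + z - (x + z)))"
            by (simp add: add.assoc)
        qed
        then have "seg_cost X P \<tau> (x + z) (x + d + z) \<le> (norm (v - P))\<^sup>2 / 2 - (X x - \<eta>)"
          using \<open>\<tau> > 0\<close> by (simp add: d_def)
        then have "\<tau> * (seg_cost X P \<tau> (x + z) (x + d + z) - L) \<le> \<tau> * ((norm (v - P))\<^sup>2 / 2 - (X x - \<eta>) - L)"
          using \<open>\<tau> > 0\<close> by (intro mult_left_mono) auto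
        then show "u (x + d + z) - u (x + z) \<le> \<tau> * ((norm (v - P))\<^sup>2 / 2 - (X x - \<eta>) - L)"
          using u(4)[of "x + d + z" "x + z"] by linarith
      qed
      moreover have "d \<bullet> G x - K * (norm d)\<^sup>2 \<le> mollify \<epsilon> u (x + d) - mollify \<epsilon> u x"
        using G[of d x] nd \<tau>(1) by (simp add: abs_le_iff)
      ultimately have "\<tau> * (v \<bullet> G x) - K * (norm d)\<^sup>2 \<le> \<tau> * ((norm (v - P))\<^sup>2 / 2 - (X x - \<eta>) - L)"
        by (simp add: d_def)
      \<comment> \<open>This error is quadratic in \<tau>, whereas the other terms are linear; after
        division by \<tau> it still fits into \<eta>.\<close>
      moreover have "K * (norm d)\<^sup>2 \<le> \<tau> * \<eta>"
      proof -
        have "K * (norm d)\<^sup>2 \<le> K * (\<tau> * M)\<^sup>2"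
          using nd K(1) by (intro mult_left_mono power_mono) auto
        also have "\<dots> \<le> \<tau> * (\<tau> * (K * M\<^sup>2 + 1))"
          using \<open>\<tau> > 0\<close> by (simp add: power2_eq_square algebra_simps)
        also have "\<dots> \<le> \<tau> * \<eta>"
          using \<tau>(3) \<open>\<tau> > 0\<close> by (intro mult_left_mono) auto
        finally show ?thesis .
      qed
      ultimately have "\<tau> * (v \<bullet> G x) \<le> \<tau> * ((norm (v - P))\<^sup>2 / 2 - (X x - \<eta>) - L + \<eta>)"
        by (simp add: algebra_simps)
      then have "v \<bullet> G x \<le> (norm (v - P))\<^sup>2 / 2 - (X x - \<eta>) - L + \<eta>"
        using \<open>\<tau> > 0\<close> by simp
      moreover have "v \<bullet> G x - (norm (v - P))\<^sup>2 / 2 = (norm (G x + P))\<^sup>2 / 2 - (norm P)\<^sup>2 / 2"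
        by (simp add: v_def power2_norm_eq_inner inner_add_left inner_add_right inner_commute field_simps)
      ultimately show ?thesis
        by linarith
    qed
    then have "(norm (torus_grad \<phi> (torus_proj x) + P))\<^sup>2 / 2 + \<Xi> (torus_proj x) \<le> (norm P)\<^sup>2 / 2 - L + 2 * \<eta>" for x
      unfolding torus_grad_eqI[OF grad] by (simp add: X_def)
    then have "(norm (torus_grad \<phi> y + P))\<^sup>2 / 2 + \<Xi> y \<le> (norm P)\<^sup>2 / 2 - L + 2 * \<eta>" for y
      by (metis torus_proj_surj)
    then show "H_hat \<Xi> P \<le> (norm P)\<^sup>2 / 2 - L + 2 * \<eta>"
      by (rule H_hat_le[OF \<Xi> \<phi>])
  qed
qed

text \<open>Take \<open>L\<close> halfway between the claimed limit and \<open>a\<close>. If no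
  closed chain had mean cost below \<open>L\<close>, then \<open>H_hat_le_of_loops\<close> would
  push \<open>H_hat\<close> below its own value; so such a loop exists, and repeating it bounds
  \<open>D_cost\<close> up to order \<open>1/j\<close>.\<close>

lemma D_cost_eventually_less:
  fixes \<Xi> :: "'n::finite torus \<Rightarrow> real"
  assumes \<Xi>: "continuous_on UNIV \<Xi>" and "T > 0" and a: "(norm P)\<^sup>2 / 2 - H_hat \<Xi> P < a"
  shows "eventually (\<lambda>j. D_cost P T j \<Xi> < ereal a) sequentially"
proof -
  define e where "e = (a - ((norm P)\<^sup>2 / 2 - H_hat \<Xi> P)) / 2"
  define L where "L = (norm P)\<^sup>2 / 2 - H_hat \<Xi> P + e"
  have "e > 0" "L < a"
    using a by (simp_all add: e_def L_def field_simps)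
  \<comment> \<open>The resulting error \<open>2 * (e / 4)\<close> stays below the distance
    \<open>e\<close> of \<open>L\<close> from the claimed limit.\<close>
  have "e / 4 > 0"
    using \<open>e > 0\<close> by simp
  from H_hat_le_of_loops[OF \<Xi> \<open>T > 0\<close> this, of P L] obtain N where N: "N \<ge> 1"
    "(\<And>k y. torus_proj (y k) = torus_proj (y 0) \<Longrightarrow>
        0 \<le> (\<Sum>i<k. seg_cost (\<lambda>w. \<Xi> (torus_proj w)) P (T / real N) (y i) (y (Suc i)) - L)) \<Longrightarrow>
     H_hat \<Xi> P \<le> (norm P)\<^sup>2 / 2 - L + 2 * (e / 4)"
    by blast
  have "\<not> H_hat \<Xi> P \<le> (norm P)\<^sup>2 / 2 - L + 2 * (e / 4)"
    using \<open>e > 0\<close> by (simp add: L_def)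
  then obtain k y where ky: "torus_proj (y k) = torus_proj (y 0)"
    "(\<Sum>i<k. seg_cost (\<lambda>w. \<Xi> (torus_proj w)) P (T / real N) (y i) (y (Suc i)) - L) < 0"
    using N(2) by (meson not_le)
  have "k \<ge> 1"
    using ky(2) by (cases k) auto
  moreover have "(\<Sum>i<k. seg_cost (\<lambda>w. \<Xi> (torus_proj w)) P (T / real N) (y i) (y (Suc i))) \<le> real k * L"
    using ky(2) by (simp add: sum_subtractf)
  ultimately obtain C where C: "\<And>j. j \<ge> 1 \<Longrightarrow> D_cost P T j \<Xi> \<le> ereal (L + C / real j)"
    using D_cost_le_loop[OF \<Xi> \<open>T > 0\<close> N(1) _ ky(1)] by blast
  have "(\<lambda>j. L + C / real j) \<longlonglongrightarrow> L + 0"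
    by (intro tendsto_intros lim_const_over_n)
  then have "eventually (\<lambda>j. L + C / real j < a) sequentially"
    using \<open>L < a\<close> by (intro order_tendstoD(2)) auto
  then show ?thesis
    using eventually_ge_at_top[of 1]
  proof eventually_elim
    case (elim j)
    have "D_cost P T j \<Xi> \<le> ereal (L + C / real j)"
      by (rule C[OF elim(2)])
    also have "\<dots> < ereal a"
      using elim(1) by simp
    finally show ?case .
  qed
qed

theorem theorem4p6:
  fixes \<Xi> :: "'n::finite torus \<Rightarrow> real" and P :: "real^'n" and T :: real
  assumes "continuous_on UNIV \<Xi>" and "T > 0"
  shows "\<exists>L::real. (\<lambda>j. D_cost P T j \<Xi>) \<longlonglongrightarrow> ereal L \<and>
                   H_hat \<Xi> P = (norm P)\<^sup>2 / 2 - L"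
proof (intro exI[of _ "(norm P)\<^sup>2 / 2 - H_hat \<Xi> P"] conjI)
  show "(\<lambda>j. D_cost P T j \<Xi>) \<longlonglongrightarrow> ereal ((norm P)\<^sup>2 / 2 - H_hat \<Xi> P)"
  proof (rule order_tendstoI)
    fix a assume "a < ereal ((norm P)\<^sup>2 / 2 - H_hat \<Xi> P)"
    moreover have "eventually (\<lambda>j. ereal ((norm P)\<^sup>2 / 2 - H_hat \<Xi> P) \<le> D_cost P T j \<Xi>) sequentially"
      using eventually_ge_at_top[of 1] by eventually_elim (rule D_cost_ge[OF assms])
    ultimately show "eventually (\<lambda>j. a < D_cost P T j \<Xi>) sequentially"
      by (auto elim: eventually_mono intro: less_le_trans)
  next
    fix a assume "ereal ((norm P)\<^sup>2 / 2 - H_hat \<Xi> P) < a"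
    then obtain r where r: "ereal ((norm P)\<^sup>2 / 2 - H_hat \<Xi> P) < ereal r" "ereal r < a"
      using ereal_dense2 by blast
    then have "eventually (\<lambda>j. D_cost P T j \<Xi> < ereal r) sequentially"
      by (intro D_cost_eventually_less[OF assms]) simp
    then show "eventually (\<lambda>j. D_cost P T j \<Xi> < a) sequentially"
      using r(2) by (auto elim: eventually_mono intro: less_trans)
  qed
qed simp

end
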